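(* Let $\mathcal{M}$ be a compact Riemannian manifold with normalized Riemannian measure $\mu$, and let $T=\{T_t\}_{t\ge0}$ be the heat semigroup on $M=L^\infty(\mathcal{M})$. For $t>0$ and $\mathfrak{p}\in\mathfrak{P}_t$, there is an isomorphism $\mathcal{H}^T(\mathfrak{p},t)\cong L^2(\mathcal{M}_\mathfrak{p},\mu_\mathfrak{p})$ of W$^*$-$M$-bimodules.
   Context: Heat semigroup. $\Delta$ is the self-adjoint positive Laplacian on $L^2(\mathcal{M})=L^2(\mathcal{M},\mu)$ and $T_t=e^{-t\Delta}$. There is a heat kernel $\{p_t\}_{t>0}$ of measurable functions on $\mathcal{M}\times\mathcal{M}$ with $(T_tf)(x)=\int_\mathcal{M}p_t(x,y)f(y)\,d\mu(y)$ and: $p_t(x,y)=p_t(y,x)\ge0$; $\int_\mathcal{M}p_t(x,y)\,d\mu(y)=1$; $p_{s+t}(x,z)=\int_\mathcal{M}p_s(x,y)p_t(y,z)\,d\mu(y)$. By this formula $T$ is extended to $L^\infty(\mathcal{M})$, where it is a CP$_0$-semigroup (a $\sigma$-weakly continuous semigroup of normal unital completely positive maps) on the von Neumann algebra $M=L^\infty(\mathcal{M})$. $\mathfrak{P}_t$ ($t>0$) is the set of finite tuples $\mathfrak{p}=(t_1,\dots,t_n)$ with $t_i>0$, $\sum t_i=t$. For such $\mathfrak{p}$, $\mathcal{M}_\mathfrak{p}=\mathcal{M}^{n+1}$ carries the probability measure $\mu_\mathfrak{p}=p_{t_1}(x_1,x_2)p_{t_2}(x_2,x_3)\cdots p_{t_n}(x_n,x_{n+1})\,\mu^{n+1}$.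 $L^2(\mathcal{M}_\mathfrak{p},\mu_\mathfrak{p})$ is a W$^*$-$M$-bimodule via $(gf)(x_1,\dots,x_{n+1})=g(x_1)f(x_1,\dots,x_{n+1})$ and $(fg)(x_1,\dots,x_{n+1})=f(x_1,\dots,x_{n+1})g(x_{n+1})$ for $g\in M$. W$^*$-bimodules. A W$^*$-$M$-bimodule is a Hilbert space with commuting normal $*$-representations of $M$ (left action) and $M^\circ$ (right action). The standard space is $L^2(M)=L^2(\mathcal{M})$; let $\tau$ be the faithful normal tracial state on $M$ given by integration against $\mu$, with vector $\tau^{1/2}=1\in L^2(\mathcal{M})$. A vector $\xi$ in a W$^*$-$M$-bimodule $\mathcal{H}$ is $\tau$-bounded if $\|\xi x\|\le c\|\tau^{1/2}x\|$ for all $x\in M$ and some $c>0$; then $\pi_\tau(\xi):L^2(M)\to\mathcal{H}$ is the bounded operator $\tau^{1/2}x\mapsto\xi x$. The relative tensor product $\mathcal{H}\otimes^M\mathcal{K}$ is the separation-completion of $\mathcal{D}(\mathcal{H};\tau)\otimes_{\mathrm{alg}}\mathcal{K}$ (with $\mathcal{D}(\mathcal{H};\tau)$ the $\tau$-bounded vectors) for $\langle\xi_1\tau^{-1/2}\eta_1,\xi_2\tau^{-1/2}\eta_2\rangle=\langle\eta_1,\pi_\tau(\xi_1)^*\pi_\tau(\xi_2)\eta_2\rangle$, where $\pi_\tau(\xi_1)^*\pi_\tau(\xi_2)\in\mathrm{End}(L^2(M)_M)=M$; it is independent of the choice of faithful normal state up to canonical isomorphism. $M\otimes_sL^2(M)$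 is the W$^*$-$M$-bimodule obtained from $M\otimes_{\mathrm{alg}}L^2(M)$ by separation-completion for $\langle x\otimes\xi,y\otimes\eta\rangle=\langle\xi,T_s(x^*y)\eta\rangle$, with $a(x\otimes\xi)b=(ax)\otimes(\xi b)$. For $\mathfrak{p}=(t_1,\dots,t_n)\in\mathfrak{P}_t$, $\mathcal{H}^T(\mathfrak{p},t)=(M\otimes_{t_1}L^2(M))\otimes^M\cdots\otimes^M(M\otimes_{t_n}L^2(M))$. *)

theory Defs
  imports "HOL-Analysis.Analysis" "HOL-Probability.Probability_Measure"
begin

section \<open>Compact Riemannian manifolds\<close>

definition partial_deriv :: "'n \<Rightarrow> (real^'n \<Rightarrow> 'b) \<Rightarrow> real^'n \<Rightarrow> 'b::real_normed_vector" where
  "partial_deriv i f y = frechet_derivative f (at y) (axis i 1)"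

text \<open>Used for open \<open>S\<close> only.\<close>
primrec Ck_on :: "nat \<Rightarrow> (real^'n) set \<Rightarrow> (real^'n \<Rightarrow> 'b::real_normed_vector) \<Rightarrow> bool" where
  "Ck_on 0 S f \<longleftrightarrow> continuous_on S f"
| "Ck_on (Suc k) S f \<longleftrightarrow>
     (\<forall>y\<in>S. f differentiable (at y)) \<and> (\<forall>i. Ck_on k S (partial_deriv i f))"

definition smooth_on :: "(real^'n) set \<Rightarrow> (real^'n \<Rightarrow> 'b::real_normed_vector) \<Rightarrow> bool" where
  "smooth_on S f \<longleftrightarrow> (\<forall>k. Ck_on k S f)"

text \<open>A chart is a pair of its domain and the coordinate map. The dimension of the manifold is
  \<open>CARD('n)\<close>; the manifold itself is the type \<open>'a\<close>. Connectedness is not required.\<close>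
type_synonym ('a, 'n) chart = "'a set \<times> ('a \<Rightarrow> real^'n)"

definition param :: "('a, 'n) chart \<Rightarrow> real^'n \<Rightarrow> 'a" where
  "param c = inv_into (fst c) (snd c)"

definition coords :: "('a, 'n) chart \<Rightarrow> (real^'n) set" where
  "coords c = snd c ` fst c"

definition smooth_atlas ::
    "('a::{t2_space,second_countable_topology}, 'n::finite) chart set \<Rightarrow> bool" where
  "smooth_atlas \<A> \<longleftrightarrow>
     (\<Union>c\<in>\<A>. fst c) = UNIV \<and>
     (\<forall>c\<in>\<A>. open (fst c) \<and> open (coords c) \<and>
        homeomorphism (fst c) (coords c) (snd c) (param c)) \<and>
     (\<forall>c\<in>\<A>. \<forall>d\<in>\<A>. smooth_on (snd c ` (fst c \<inter> fst d)) (snd d \<circ> param c))"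

text \<open>A metric is given by its Gram matrices \<open>(g\<^sub>i\<^sub>j)\<close> in the coordinates of each chart; the last
  clause is the transformation rule of a covariant 2-tensor.\<close>
type_synonym ('a, 'n) metric = "('a, 'n) chart \<Rightarrow> real^'n \<Rightarrow> real^'n^'n"

definition riemannian_metric ::
    "('a, 'n::finite) chart set \<Rightarrow> ('a, 'n) metric \<Rightarrow> bool" where
  "riemannian_metric \<A> g \<longleftrightarrow>
     (\<forall>c\<in>\<A>. \<forall>i j. smooth_on (coords c) (\<lambda>y. g c y $ i $ j)) \<and>
     (\<forall>c\<in>\<A>. \<forall>y\<in>coords c. transpose (g c y) = g c y \<and> (\<forall>v. v \<noteq> 0 \<longrightarrow> 0 < v \<bullet> (g c y *v v))) \<and>
     (\<forall>c\<in>\<A>. \<forall>d\<in>\<A>. \<forall>x\<in>fst c \<inter> fst d.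
        (let J = jacobian (snd d \<circ> param c) (at (snd c x))
         in g c (snd c x) = transpose J ** g d (snd d x) ** J))"

definition compact_riemannian_manifold ::
    "('a::{t2_space,second_countable_topology}, 'n::finite) chart set \<Rightarrow> ('a, 'n) metric \<Rightarrow> bool" where
  "compact_riemannian_manifold \<A> g \<longleftrightarrow>
     compact (UNIV :: 'a set) \<and> smooth_atlas \<A> \<and> riemannian_metric \<A> g"

definition riemannian_measure ::
    "('a::topological_space, 'n::finite) chart set \<Rightarrow> ('a, 'n) metric \<Rightarrow> 'a measure \<Rightarrow> bool" where
  "riemannian_measure \<A> g V \<longleftrightarrow>
     sets V = sets borel \<and>
     (\<forall>c\<in>\<A>. \<forall>B\<in>sets borel. B \<subseteq> fst c \<longrightarrow>
        emeasure V B = (\<integral>\<^sup>+ y. ennreal (sqrt (det (g c y))) * indicator (snd c ` B) y \<partial>lborel))"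

definition normalized_riemannian_measure ::
    "('a::topological_space, 'n::finite) chart set \<Rightarrow> ('a, 'n) metric \<Rightarrow> 'a measure \<Rightarrow> bool" where
  "normalized_riemannian_measure \<A> g \<mu> \<longleftrightarrow>
     prob_space \<mu> \<and> (\<exists>V r. riemannian_measure \<A> g V \<and> \<mu> = scale_measure r V)"

definition smooth_function ::
    "('a, 'n::finite) chart set \<Rightarrow> ('a \<Rightarrow> complex) \<Rightarrow> bool" where
  "smooth_function \<A> u \<longleftrightarrow> (\<forall>c\<in>\<A>. smooth_on (coords c) (u \<circ> param c))"

text \<open>The positive Laplacian \<open>-div grad\<close> in local coordinates.\<close>
definition local_laplacian ::
    "(real^'n \<Rightarrow> real^'n^'n) \<Rightarrow> (real^'n \<Rightarrow> complex) \<Rightarrow> real^'n \<Rightarrow> complex" where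
  "local_laplacian G u y =
     - ((1 / sqrt (det (G y))) *\<^sub>R
        (\<Sum>i\<in>UNIV. partial_deriv i
           (\<lambda>z. sqrt (det (G z)) *\<^sub>R
              (\<Sum>j\<in>UNIV. (matrix_inv (G z) $ i $ j) *\<^sub>R partial_deriv j u z)) y))"

definition is_laplacian ::
    "('a, 'n::finite) chart set \<Rightarrow> ('a, 'n) metric \<Rightarrow> ('a \<Rightarrow> complex) \<Rightarrow> ('a \<Rightarrow> complex) \<Rightarrow> bool" where
  "is_laplacian \<A> g u h \<longleftrightarrow>
     (\<forall>c\<in>\<A>. \<forall>x\<in>fst c. h x = local_laplacian (g c) (u \<circ> param c) (snd c x))"


section \<open>Hilbert spaces\<close>

text \<open>Complex inner products are conjugate-linear in the first argument.\<close>
record 'v cspace =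
  carr :: "'v set"
  vzero :: "'v"
  vadd :: "'v \<Rightarrow> 'v \<Rightarrow> 'v"
  vscale :: "complex \<Rightarrow> 'v \<Rightarrow> 'v"
  vip :: "'v \<Rightarrow> 'v \<Rightarrow> complex"

definition vnorm :: "('v, 'z) cspace_scheme \<Rightarrow> 'v \<Rightarrow> real" where
  "vnorm H u = sqrt (Re (vip H u u))"

definition vdist :: "('v, 'z) cspace_scheme \<Rightarrow> 'v \<Rightarrow> 'v \<Rightarrow> real" where
  "vdist H u v = vnorm H (vadd H u (vscale H (-1) v))"

definition complex_vector_space :: "('v, 'z) cspace_scheme \<Rightarrow> bool" where
  "complex_vector_space H \<longleftrightarrow>
     vzero H \<in> carr H \<and>
     (\<forall>u\<in>carr H. \<forall>v\<in>carr H. vadd H u v \<in> carr H) \<and>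
     (\<forall>a. \<forall>u\<in>carr H. vscale H a u \<in> carr H) \<and>
     (\<forall>u\<in>carr H. \<forall>v\<in>carr H. \<forall>w\<in>carr H. vadd H (vadd H u v) w = vadd H u (vadd H v w)) \<and>
     (\<forall>u\<in>carr H. \<forall>v\<in>carr H. vadd H u v = vadd H v u) \<and>
     (\<forall>u\<in>carr H. vadd H (vzero H) u = u) \<and>
     (\<forall>u\<in>carr H. vadd H u (vscale H (-1) u) = vzero H) \<and>
     (\<forall>a. \<forall>u\<in>carr H. \<forall>v\<in>carr H. vscale H a (vadd H u v) = vadd H (vscale H a u) (vscale H a v)) \<and>
     (\<forall>a b. \<forall>u\<in>carr H. vscale H (a + b) u = vadd H (vscale H a u) (vscale H b u)) \<and>
     (\<forall>a b. \<forall>u\<in>carr H. vscale H (a * b) u = vscale H a (vscale H b u)) \<and>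
     (\<forall>u\<in>carr H. vscale H 1 u = u)"

definition hilbert_space :: "('v, 'z) cspace_scheme \<Rightarrow> bool" where
  "hilbert_space H \<longleftrightarrow>
     complex_vector_space H \<and>
     (\<forall>u\<in>carr H. \<forall>v\<in>carr H. \<forall>w\<in>carr H. vip H u (vadd H v w) = vip H u v + vip H u w) \<and>
     (\<forall>a. \<forall>u\<in>carr H. \<forall>v\<in>carr H. vip H u (vscale H a v) = a * vip H u v) \<and>
     (\<forall>u\<in>carr H. \<forall>v\<in>carr H. vip H v u = cnj (vip H u v)) \<and>
     (\<forall>u\<in>carr H. 0 \<le> Re (vip H u u)) \<and>
     (\<forall>u\<in>carr H. vip H u u = 0 \<longrightarrow> u = vzero H) \<and>
     (\<forall>X. (\<forall>n. X n \<in> carr H) \<and> (\<forall>e>0. \<exists>N. \<forall>m\<ge>N. \<forall>n\<ge>N. vdist H (X m) (X n) < e) \<longrightarrow>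
        (\<exists>u\<in>carr H. (\<lambda>n::nat. vdist H (X n) u) \<longlonglongrightarrow> 0))"

definition bounded_op ::
    "('v, 'y) cspace_scheme \<Rightarrow> ('w, 'z) cspace_scheme \<Rightarrow> ('v \<Rightarrow> 'w) \<Rightarrow> bool" where
  "bounded_op H K T \<longleftrightarrow>
     (\<forall>u\<in>carr H. T u \<in> carr K) \<and>
     (\<forall>u\<in>carr H. \<forall>v\<in>carr H. T (vadd H u v) = vadd K (T u) (T v)) \<and>
     (\<forall>a. \<forall>u\<in>carr H. T (vscale H a u) = vscale K a (T u)) \<and>
     (\<exists>C. \<forall>u\<in>carr H. vnorm K (T u) \<le> C * vnorm H u)"

definition adjoint_op ::
    "('v, 'y) cspace_scheme \<Rightarrow> ('w, 'z) cspace_scheme \<Rightarrow> ('v \<Rightarrow> 'w) \<Rightarrow> 'w \<Rightarrow> 'v" where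
  "adjoint_op H K T w = (THE v. v \<in> carr H \<and> (\<forall>u\<in>carr H. vip H v u = vip K w (T u)))"


section \<open>The spaces of square integrable and of bounded functions\<close>

text \<open>Elements are classes of measurable functions modulo equality almost everywhere. On a finite
  measure space a bounded function therefore has the same class in both spaces.\<close>
definition ae_class :: "'x measure \<Rightarrow> ('x \<Rightarrow> complex) \<Rightarrow> ('x \<Rightarrow> complex) set" where
  "ae_class N f = {h \<in> borel_measurable N. AE x in N. h x = f x}"

definition ae_rep :: "('x \<Rightarrow> complex) set \<Rightarrow> 'x \<Rightarrow> complex" where
  "ae_rep A = (SOME f. f \<in> A)"

definition cls_add :: "'x measure \<Rightarrow> ('x \<Rightarrow> complex) set \<Rightarrow> ('x \<Rightarrow> complex) set \<Rightarrow> ('x \<Rightarrow> complex) set" where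
  "cls_add N A B = ae_class N (\<lambda>x. ae_rep A x + ae_rep B x)"

definition cls_mult :: "'x measure \<Rightarrow> ('x \<Rightarrow> complex) set \<Rightarrow> ('x \<Rightarrow> complex) set \<Rightarrow> ('x \<Rightarrow> complex) set" where
  "cls_mult N A B = ae_class N (\<lambda>x. ae_rep A x * ae_rep B x)"

definition cls_scale :: "'x measure \<Rightarrow> complex \<Rightarrow> ('x \<Rightarrow> complex) set \<Rightarrow> ('x \<Rightarrow> complex) set" where
  "cls_scale N a A = ae_class N (\<lambda>x. a * ae_rep A x)"

definition cls_star :: "'x measure \<Rightarrow> ('x \<Rightarrow> complex) set \<Rightarrow> ('x \<Rightarrow> complex) set" where
  "cls_star N A = ae_class N (\<lambda>x. cnj (ae_rep A x))"

definition cls_one :: "'x measure \<Rightarrow> ('x \<Rightarrow> complex) set" where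
  "cls_one N = ae_class N (\<lambda>_. 1)"

definition Linf :: "'x measure \<Rightarrow> ('x \<Rightarrow> complex) set set" where
  "Linf N = ae_class N ` {f \<in> borel_measurable N. \<exists>C. AE x in N. cmod (f x) \<le> C}"

definition L2 :: "'x measure \<Rightarrow> ('x \<Rightarrow> complex) set cspace" where
  "L2 N = \<lparr>carr = ae_class N ` {f \<in> borel_measurable N. integrable N (\<lambda>x. (cmod (f x))\<^sup>2)},
          vzero = ae_class N (\<lambda>_. 0), vadd = cls_add N, vscale = cls_scale N,
          vip = (\<lambda>A B. \<integral>x. cnj (ae_rep A x) * ae_rep B x \<partial>N)\<rparr>"


section \<open>The heat semigroup and the heat kernel\<close>

text \<open>The self-adjoint Laplacian, as a graph: on a compact manifold it is the closure of the
  Laplacian on smooth functions.\<close>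
definition laplacian_graph ::
    "('a::topological_space, 'n::finite) chart set \<Rightarrow> ('a, 'n) metric \<Rightarrow> 'a measure \<Rightarrow>
     (('a \<Rightarrow> complex) set \<times> ('a \<Rightarrow> complex) set) set" where
  "laplacian_graph \<A> g \<mu> = {(f, h). f \<in> carr (L2 \<mu>) \<and> h \<in> carr (L2 \<mu>) \<and>
     (\<exists>u w. (\<forall>n::nat. smooth_function \<A> (u n) \<and> is_laplacian \<A> g (u n) (w n)) \<and>
        (\<lambda>n. vdist (L2 \<mu>) (ae_class \<mu> (u n)) f) \<longlonglongrightarrow> 0 \<and>
        (\<lambda>n. vdist (L2 \<mu>) (ae_class \<mu> (w n)) h) \<longlonglongrightarrow> 0)}"

text \<open>\<open>T\<^sub>t = exp (- t \<Delta>)\<close>: the strongly continuous semigroup on \<open>L\<^sup>2\<close> whose generator is exactly \<open>-\<Delta>\<close>.\<close>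
definition heat_semigroup ::
    "('a::topological_space, 'n::finite) chart set \<Rightarrow> ('a, 'n) metric \<Rightarrow> 'a measure \<Rightarrow>
     (real \<Rightarrow> ('a \<Rightarrow> complex) set \<Rightarrow> ('a \<Rightarrow> complex) set) \<Rightarrow> bool" where
  "heat_semigroup \<A> g \<mu> T \<longleftrightarrow>
     (\<forall>t\<ge>0. bounded_op (L2 \<mu>) (L2 \<mu>) (T t)) \<and>
     (\<forall>f\<in>carr (L2 \<mu>). T 0 f = f) \<and>
     (\<forall>s\<ge>0. \<forall>t\<ge>0. \<forall>f\<in>carr (L2 \<mu>). T (s + t) f = T s (T t f)) \<and>
     (\<forall>f\<in>carr (L2 \<mu>). ((\<lambda>t. vdist (L2 \<mu>) (T t f) f) \<longlongrightarrow> 0) (at_right 0)) \<and>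
     (\<forall>f\<in>carr (L2 \<mu>). \<forall>h\<in>carr (L2 \<mu>).
        ((\<lambda>t. vdist (L2 \<mu>)
            (cls_scale \<mu> (complex_of_real (1 / t)) (cls_add \<mu> (T t f) (cls_scale \<mu> (-1) f)))
            (cls_scale \<mu> (-1) h)) \<longlongrightarrow> 0) (at_right 0)
        \<longleftrightarrow> (f, h) \<in> laplacian_graph \<A> g \<mu>)"

definition heat_kernel ::
    "'a measure \<Rightarrow> (real \<Rightarrow> ('a \<Rightarrow> complex) set \<Rightarrow> ('a \<Rightarrow> complex) set) \<Rightarrow>
     (real \<Rightarrow> 'a \<Rightarrow> 'a \<Rightarrow> real) \<Rightarrow> bool" where
  "heat_kernel \<mu> T p \<longleftrightarrow>
     (\<forall>t>0. (\<lambda>(x, y). p t x y) \<in> borel_measurable (\<mu> \<Otimes>\<^sub>M \<mu>)) \<and>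
     (\<forall>t>0. \<forall>f\<in>carr (L2 \<mu>).
        T t f = ae_class \<mu> (\<lambda>x. \<integral>y. complex_of_real (p t x y) * ae_rep f y \<partial>\<mu>)) \<and>
     (\<forall>t>0. \<forall>x y. p t x y = p t y x \<and> 0 \<le> p t x y) \<and>
     (\<forall>t>0. \<forall>x. (\<integral>\<^sup>+ y. ennreal (p t x y) \<partial>\<mu>) = 1) \<and>
     (\<forall>s>0. \<forall>t>0. \<forall>x z. ennreal (p (s + t) x z) = (\<integral>\<^sup>+ y. ennreal (p s x y * p t y z) \<partial>\<mu>))"

text \<open>The extension of \<open>T\<^sub>t\<close>, \<open>t > 0\<close>, to bounded functions.\<close>
definition heat_Linf ::
    "'a measure \<Rightarrow> (real \<Rightarrow> 'a \<Rightarrow> 'a \<Rightarrow> real) \<Rightarrow> real \<Rightarrow> ('a \<Rightarrow> complex) set \<Rightarrow> ('a \<Rightarrow> complex) set" where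
  "heat_Linf \<mu> p t a = ae_class \<mu> (\<lambda>x. \<integral>y. complex_of_real (p t x y) * ae_rep a y \<partial>\<mu>)"


section \<open>Bimodules over the von Neumann algebra of bounded functions\<close>

record ('m, 'v) bimodule = "'v cspace" +
  lact :: "'m \<Rightarrow> 'v \<Rightarrow> 'v"
  ract :: "'v \<Rightarrow> 'm \<Rightarrow> 'v"

text \<open>The multiplication is a parameter so as to cover the opposite algebra. In the last clause,
  the \<open>\<sigma>\<close>-weakly continuous functionals on \<open>B(H)\<close> are the sums of vector functionals and those on
  \<open>L\<^sup>\<infinity>\<close> are the integrals against functions in the predual \<open>L\<^sup>1\<close>; normality says that the
  former pull back to the latter.\<close>
definition normal_star_rep ::
    "'a measure \<Rightarrow> (('a \<Rightarrow> complex) set \<Rightarrow> ('a \<Rightarrow> complex) set \<Rightarrow> ('a \<Rightarrow> complex) set) \<Rightarrow>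
     ('v, 'z) cspace_scheme \<Rightarrow> (('a \<Rightarrow> complex) set \<Rightarrow> 'v \<Rightarrow> 'v) \<Rightarrow> bool" where
  "normal_star_rep \<mu> mul H \<pi> \<longleftrightarrow>
     (\<forall>a\<in>Linf \<mu>. bounded_op H H (\<pi> a)) \<and>
     (\<forall>u\<in>carr H. \<pi> (cls_one \<mu>) u = u) \<and>
     (\<forall>a\<in>Linf \<mu>. \<forall>b\<in>Linf \<mu>. \<forall>u\<in>carr H. \<pi> (cls_add \<mu> a b) u = vadd H (\<pi> a u) (\<pi> b u)) \<and>
     (\<forall>z. \<forall>a\<in>Linf \<mu>. \<forall>u\<in>carr H. \<pi> (cls_scale \<mu> z a) u = vscale H z (\<pi> a u)) \<and>
     (\<forall>a\<in>Linf \<mu>. \<forall>b\<in>Linf \<mu>. \<forall>u\<in>carr H. \<pi> (mul a b) u = \<pi> a (\<pi> b u)) \<and>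
     (\<forall>a\<in>Linf \<mu>. \<forall>u\<in>carr H. \<forall>v\<in>carr H. vip H (\<pi> a u) v = vip H u (\<pi> (cls_star \<mu> a) v)) \<and>
     (\<forall>\<xi> \<eta>. (\<forall>n::nat. \<xi> n \<in> carr H \<and> \<eta> n \<in> carr H) \<and>
        summable (\<lambda>n. (vnorm H (\<xi> n))\<^sup>2) \<and> summable (\<lambda>n. (vnorm H (\<eta> n))\<^sup>2) \<longrightarrow>
        (\<exists>h. integrable \<mu> h \<and>
           (\<forall>a\<in>Linf \<mu>. (\<lambda>n. vip H (\<xi> n) (\<pi> a (\<eta> n))) sums (\<integral>x. ae_rep a x * h x \<partial>\<mu>))))"

definition wstar_bimodule ::
    "'a measure \<Rightarrow> (('a \<Rightarrow> complex) set, 'v) bimodule \<Rightarrow> bool" where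
  "wstar_bimodule \<mu> H \<longleftrightarrow>
     hilbert_space H \<and>
     normal_star_rep \<mu> (cls_mult \<mu>) H (lact H) \<and>
     normal_star_rep \<mu> (\<lambda>a b. cls_mult \<mu> b a) H (\<lambda>a u. ract H u a) \<and>
     (\<forall>a\<in>Linf \<mu>. \<forall>b\<in>Linf \<mu>. \<forall>u\<in>carr H. ract H (lact H a u) b = lact H a (ract H u b))"

definition bimodule_iso ::
    "'a measure \<Rightarrow> (('a \<Rightarrow> complex) set, 'v) bimodule \<Rightarrow> (('a \<Rightarrow> complex) set, 'w) bimodule \<Rightarrow> bool" where
  "bimodule_iso \<mu> H K \<longleftrightarrow>
     wstar_bimodule \<mu> H \<and> wstar_bimodule \<mu> K \<and>
     (\<exists>U. bij_betw U (carr H) (carr K) \<and>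
        bounded_op H K U \<and>
        (\<forall>u\<in>carr H. \<forall>v\<in>carr H. vip K (U u) (U v) = vip H u v) \<and>
        (\<forall>a\<in>Linf \<mu>. \<forall>u\<in>carr H. U (lact H a u) = lact K a (U u)) \<and>
        (\<forall>a\<in>Linf \<mu>. \<forall>u\<in>carr H. U (ract H u a) = ract K (U u) a))"

definition std_bimodule ::
    "'a measure \<Rightarrow> (('a \<Rightarrow> complex) set, ('a \<Rightarrow> complex) set) bimodule" where
  "std_bimodule \<mu> = cspace.extend (L2 \<mu>) (bimodule.fields (cls_mult \<mu>) (cls_mult \<mu>))"


section \<open>Separation-completions and relative tensor products\<close>

text \<open>Iterated tensor products have to live in one type that does not depend on the number of
  factors. A vector of a tensor product is \<open>Lim X\<close> for a Cauchy sequence \<open>X\<close> of formal sums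
  \<open>\<Sum> z (u \<otimes> v)\<close>, written as lists of triples \<open>(z, u, v)\<close>; vectors that are not built by a
  tensor product are \<open>Atom\<close>s.\<close>
datatype 'b tvec =
  Atom (the_atom: 'b)
| Lim (the_seq: "nat \<Rightarrow> (complex \<times> 'b tvec \<times> 'b tvec) list")

type_synonym 'b gen = "'b tvec \<times> 'b tvec"
type_synonym 'b fsum = "(complex \<times> 'b gen) list"

definition fscale :: "complex \<Rightarrow> 'b fsum \<Rightarrow> 'b fsum" where
  "fscale a xs = map (\<lambda>(z, e). (a * z, e)) xs"

definition fmap :: "('b gen \<Rightarrow> 'b gen) \<Rightarrow> 'b fsum \<Rightarrow> 'b fsum" where
  "fmap \<phi> xs = map (\<lambda>(z, e). (z, \<phi> e)) xs"

definition fform :: "('b gen \<Rightarrow> 'b gen \<Rightarrow> complex) \<Rightarrow> 'b fsum \<Rightarrow> 'b fsum \<Rightarrow> complex" where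
  "fform B xs ys = (\<Sum>(z, e)\<leftarrow>xs. \<Sum>(w, f)\<leftarrow>ys. cnj z * w * B e f)"

definition fdist :: "('b gen \<Rightarrow> 'b gen \<Rightarrow> complex) \<Rightarrow> 'b fsum \<Rightarrow> 'b fsum \<Rightarrow> real" where
  "fdist B xs ys = (let d = xs @ fscale (-1) ys in sqrt (Re (fform B d d)))"

definition fcauchy :: "'b gen set \<Rightarrow> ('b gen \<Rightarrow> 'b gen \<Rightarrow> complex) \<Rightarrow> (nat \<Rightarrow> 'b fsum) set" where
  "fcauchy D B = {X. (\<forall>n. snd ` set (X n) \<subseteq> D) \<and>
     (\<forall>e>0. \<exists>N. \<forall>m\<ge>N. \<forall>n\<ge>N. fdist B (X m) (X n) < e)}"

text \<open>The chosen representative of the class of \<open>X\<close> modulo null sequences.\<close>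
definition fclass ::
    "'b gen set \<Rightarrow> ('b gen \<Rightarrow> 'b gen \<Rightarrow> complex) \<Rightarrow> (nat \<Rightarrow> 'b fsum) \<Rightarrow> 'b tvec" where
  "fclass D B X = Lim (SOME Y. Y \<in> fcauchy D B \<and> (\<lambda>n. fdist B (X n) (Y n)) \<longlonglongrightarrow> 0)"

text \<open>The separation-completion of the span of the symbols \<open>u \<otimes> v\<close>, \<open>(u, v) \<in> D\<close>, for the
  sesquilinear extension of \<open>B\<close>, with actions given on symbols by \<open>l\<close> and \<open>r\<close>. If \<open>D\<close> is a product
  of vector spaces and \<open>B\<close> is biadditive and homogeneous in the two components of a symbol, the
  bilinearity relations of the algebraic tensor product are null vectors, so that this is the
  separation-completion of the algebraic tensor product.\<close>
definition sep_completion ::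
    "'b gen set \<Rightarrow> ('b gen \<Rightarrow> 'b gen \<Rightarrow> complex) \<Rightarrow> ('m \<Rightarrow> 'b gen \<Rightarrow> 'b gen) \<Rightarrow>
     ('b gen \<Rightarrow> 'm \<Rightarrow> 'b gen) \<Rightarrow> ('m, 'b tvec) bimodule" where
  "sep_completion D B l r =
     \<lparr>carr = fclass D B ` fcauchy D B,
      vzero = fclass D B (\<lambda>_. []),
      vadd = (\<lambda>u v. fclass D B (\<lambda>n. the_seq u n @ the_seq v n)),
      vscale = (\<lambda>a u. fclass D B (\<lambda>n. fscale a (the_seq u n))),
      vip = (\<lambda>u v. lim (\<lambda>n. fform B (the_seq u n) (the_seq v n))),
      lact = (\<lambda>a u. fclass D B (\<lambda>n. fmap (l a) (the_seq u n))),
      ract = (\<lambda>u a. fclass D B (\<lambda>n. fmap (\<lambda>e. r e a) (the_seq u n)))\<rparr>"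

text \<open>The vector \<open>\<tau>\<^sup>1\<^sup>/\<^sup>2 x\<close> of the standard space.\<close>
definition tau_half :: "'a measure \<Rightarrow> ('a \<Rightarrow> complex) set \<Rightarrow> ('a \<Rightarrow> complex) set" where
  "tau_half \<mu> x = ract (std_bimodule \<mu>) (cls_one \<mu>) x"

definition tau_bounded ::
    "'a measure \<Rightarrow> (('a \<Rightarrow> complex) set, 'v) bimodule \<Rightarrow> 'v set" where
  "tau_bounded \<mu> H = {\<xi> \<in> carr H. \<exists>c>0. \<forall>x\<in>Linf \<mu>.
     vnorm H (ract H \<xi> x) \<le> c * vnorm (L2 \<mu>) (tau_half \<mu> x)}"

definition pi_tau ::
    "'a measure \<Rightarrow> (('a \<Rightarrow> complex) set, 'v) bimodule \<Rightarrow> 'v \<Rightarrow> ('a \<Rightarrow> complex) set \<Rightarrow> 'v" where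
  "pi_tau \<mu> H \<xi> = (THE P. P \<in> extensional (carr (L2 \<mu>)) \<and> bounded_op (L2 \<mu>) H P \<and>
     (\<forall>x\<in>Linf \<mu>. P (tau_half \<mu> x) = ract H \<xi> x))"

text \<open>The element of \<open>M\<close> acting from the left on the standard space as \<open>\<pi>\<^sub>\<tau>(\<xi>)\<^sup>* \<pi>\<^sub>\<tau>(\<zeta>)\<close>.\<close>
definition tau_inner ::
    "'a measure \<Rightarrow> (('a \<Rightarrow> complex) set, 'v) bimodule \<Rightarrow> 'v \<Rightarrow> 'v \<Rightarrow> ('a \<Rightarrow> complex) set" where
  "tau_inner \<mu> H \<xi> \<zeta> = (THE m. m \<in> Linf \<mu> \<and>
     (\<forall>f\<in>carr (L2 \<mu>). lact (std_bimodule \<mu>) m f =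
        adjoint_op (L2 \<mu>) H (pi_tau \<mu> H \<xi>) (pi_tau \<mu> H \<zeta> f)))"

definition rel_tensor ::
    "'a measure \<Rightarrow> (('a \<Rightarrow> complex) set, 'b tvec) bimodule \<Rightarrow> (('a \<Rightarrow> complex) set, 'b tvec) bimodule \<Rightarrow>
     (('a \<Rightarrow> complex) set, 'b tvec) bimodule" where
  "rel_tensor \<mu> H K = sep_completion (tau_bounded \<mu> H \<times> carr K)
     (\<lambda>(\<xi>1, \<eta>1) (\<xi>2, \<eta>2). vip K \<eta>1 (lact K (tau_inner \<mu> H \<xi>1 \<xi>2) \<eta>2))
     (\<lambda>a (\<xi>, \<eta>). (lact H a \<xi>, \<eta>))
     (\<lambda>(\<xi>, \<eta>) a. (\<xi>, ract K \<eta> a))"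


section \<open>The bimodules of the theorem\<close>

text \<open>\<open>M \<otimes>\<^sub>s L\<^sup>2(M)\<close>\<close>
definition heat_tensor ::
    "'a measure \<Rightarrow> (real \<Rightarrow> 'a \<Rightarrow> 'a \<Rightarrow> real) \<Rightarrow> real \<Rightarrow>
     (('a \<Rightarrow> complex) set, ('a \<Rightarrow> complex) set tvec) bimodule" where
  "heat_tensor \<mu> p s = sep_completion (Atom ` Linf \<mu> \<times> Atom ` carr (L2 \<mu>))
     (\<lambda>(x, \<xi>) (y, \<eta>). vip (L2 \<mu>) (the_atom \<xi>)
        (lact (std_bimodule \<mu>)
          (heat_Linf \<mu> p s (cls_mult \<mu> (cls_star \<mu> (the_atom x)) (the_atom y))) (the_atom \<eta>)))
     (\<lambda>a (x, \<xi>). (Atom (cls_mult \<mu> a (the_atom x)), \<xi>))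
     (\<lambda>(x, \<xi>) b. (x, Atom (ract (std_bimodule \<mu>) (the_atom \<xi>) b)))"

definition time_partitions :: "real \<Rightarrow> real list set" where
  "time_partitions t = {ts. ts \<noteq> [] \<and> (\<forall>s\<in>set ts. 0 < s) \<and> sum_list ts = t}"

text \<open>\<open>\<H>\<^sup>T(\<pp>, t)\<close>, bracketed to the right; left undefined for the empty list, which is not a
  partition.\<close>
fun HT ::
    "'a measure \<Rightarrow> (real \<Rightarrow> 'a \<Rightarrow> 'a \<Rightarrow> real) \<Rightarrow> real list \<Rightarrow>
     (('a \<Rightarrow> complex) set, ('a \<Rightarrow> complex) set tvec) bimodule" where
  "HT \<mu> p [s] = heat_tensor \<mu> p s"
| "HT \<mu> p (s # s' # ts) = rel_tensor \<mu> (heat_tensor \<mu> p s) (HT \<mu> p (s' # ts))"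

text \<open>The points \<open>(x\<^sub>1, \<dots>, x\<^sub>n\<^sub>+\<^sub>1)\<close> are functions on the indices \<open>0, \<dots>, n\<close>.\<close>
definition path_measure ::
    "'a measure \<Rightarrow> (real \<Rightarrow> 'a \<Rightarrow> 'a \<Rightarrow> real) \<Rightarrow> real list \<Rightarrow> (nat \<Rightarrow> 'a) measure" where
  "path_measure \<mu> p ts = density (Pi\<^sub>M {0..length ts} (\<lambda>_. \<mu>))
     (\<lambda>x. \<Prod>i<length ts. ennreal (p (ts ! i) (x i) (x (Suc i))))"

definition path_L2 ::
    "'a measure \<Rightarrow> (real \<Rightarrow> 'a \<Rightarrow> 'a \<Rightarrow> real) \<Rightarrow> real list \<Rightarrow>
     (('a \<Rightarrow> complex) set, ((nat \<Rightarrow> 'a) \<Rightarrow> complex) set) bimodule" where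
  "path_L2 \<mu> p ts = (let N = path_measure \<mu> p ts in
     cspace.extend (L2 N)
       (bimodule.fields
         (\<lambda>a f. ae_class N (\<lambda>x. ae_rep a (x 0) * ae_rep f x))
         (\<lambda>f a. ae_class N (\<lambda>x. ae_rep f x * ae_rep a (x (length ts))))))"

end

theory Submission
  imports Defs "HOL-Probability.Infinite_Product_Measure"
begin

text \<open>The measure of \<open>\<M>\<^sub>\<pp>\<close> is built by adding one point at a time in front: the space of
  \<open>(s, t\<^sub>1, \<dots>)\<close> is \<open>\<mu> \<otimes> \<mu>\<^sub>\<pp>\<close> with density \<open>p\<^sub>s(y, x\<^sub>1)\<close>. In such a one-step extension the functions
  \<open>f(y, x\<^sub>1) \<eta>(x\<^sub>1, x\<^sub>2, \<dots>)\<close> satisfy \<open>\<langle>f \<eta>, f' \<eta>'\<rangle> = \<langle>\<eta>, m(x\<^sub>1) \<eta>'\<rangle>\<close> with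
  \<open>m(x) = \<integral> p\<^sub>s(y, x) cnj(f(y, x)) f'(y, x) d\<mu>(y)\<close>. For \<open>f = a(y)\<close> this \<open>m\<close> is \<open>T\<^sub>s(a\<^sup>* a')\<close>, the form
  defining \<open>M \<otimes>\<^sub>s L\<^sup>2(M)\<close>; for \<open>\<tau>\<close>-bounded \<open>f\<close> in the two-point space it is
  \<open>\<pi>\<^sub>\<tau>(f)\<^sup>* \<pi>\<^sub>\<tau>(f')\<close>, the form defining the relative tensor product. So multiplication of functions is
  isometric on symbols in both cases, and its range is total because it contains the indicator
  functions of rectangles.\<close>

section \<open>Functions modulo null sets\<close>

text \<open>\<open>HT\<close> is bracketed to the right, so the induction on the partition adds its
  new point in front and uses the theorem for the tail. The factors it meets are abstract bimodules
  known only up to isomorphism, so \<open>rel_tensor_iso\<close> reads the symbols through chosen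
  isomorphisms. Nothing about a separation-completion is verified directly: its vectors are
  arbitrary representatives chosen by \<open>SOME\<close>, and the Hilbert space and representation
  laws are pulled back along a bijection onto a space where they are known. On that side the laws
  rest on the coordinates being measure preserving: then multiplication by
  \<open>b(x\<^sub>i)\<close> depends only on the class of \<open>b\<close>, and Radon-Nikodym gives
  normality. Both marginals of the density \<open>k y x\<close> on two copies of \<mu> are \<mu>,
  since the kernel is symmetric with total mass 1. The one-step extension is described by abstract
  maps \<open>h0\<close>, \<open>sh\<close>, \<open>glue\<close> because it has to cover two
  encodings: over \<mu> itself, whose points are not sequences, and over a space of finite
  sequences.\<close>

lemma borel_measurable_cnj [measurable]:
  "f \<in> borel_measurable N \<Longrightarrow> (\<lambda>x. cnj (f x)) \<in> borel_measurable N"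
  by (rule measurable_compose[OF _ borel_measurable_continuous_onI]) (auto intro: continuous_intros)

lemma ae_class_eqI: "AE x in N. f x = g x \<Longrightarrow> ae_class N f = ae_class N g"
  unfolding ae_class_def by (auto elim: AE_mp)

lemma ae_class_self: "f \<in> borel_measurable N \<Longrightarrow> f \<in> ae_class N f"
  by (simp add: ae_class_def)

lemma ae_rep_in: "f \<in> borel_measurable N \<Longrightarrow> ae_rep (ae_class N f) \<in> ae_class N f"
  unfolding ae_rep_def by (rule someI[where P = "\<lambda>h. h \<in> ae_class N f"], rule ae_class_self)

lemma ae_rep_measurable [measurable]: "f \<in> borel_measurable N \<Longrightarrow> ae_rep (ae_class N f) \<in> borel_measurable N"
  and AE_ae_rep: "f \<in> borel_measurable N \<Longrightarrow> AE x in N. ae_rep (ae_class N f) x = f x"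
  using ae_rep_in[of f N] by (auto simp: ae_class_def)

lemma ae_class_ae_rep: "f \<in> borel_measurable N \<Longrightarrow> ae_class N (ae_rep (ae_class N f)) = ae_class N f"
  by (rule ae_class_eqI, rule AE_ae_rep)

lemma cls_add_class: "f \<in> borel_measurable N \<Longrightarrow> g \<in> borel_measurable N \<Longrightarrow>
    cls_add N (ae_class N f) (ae_class N g) = ae_class N (\<lambda>x. f x + g x)"
  unfolding cls_add_def using AE_ae_rep[of f N] AE_ae_rep[of g N]
  by (intro ae_class_eqI) auto

lemma cls_mult_class: "f \<in> borel_measurable N \<Longrightarrow> g \<in> borel_measurable N \<Longrightarrow>
    cls_mult N (ae_class N f) (ae_class N g) = ae_class N (\<lambda>x. f x * g x)"
  unfolding cls_mult_def using AE_ae_rep[of f N] AE_ae_rep[of g N]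
  by (intro ae_class_eqI) auto

lemma cls_scale_class: "f \<in> borel_measurable N \<Longrightarrow>
    cls_scale N a (ae_class N f) = ae_class N (\<lambda>x. a * f x)"
  unfolding cls_scale_def using AE_ae_rep[of f N]
  by (intro ae_class_eqI) auto

lemma cls_star_class: "f \<in> borel_measurable N \<Longrightarrow>
    cls_star N (ae_class N f) = ae_class N (\<lambda>x. cnj (f x))"
  unfolding cls_star_def using AE_ae_rep[of f N]
  by (intro ae_class_eqI) auto

text \<open>A representative bounded everywhere, and not just almost everywhere, lets the bound pass
  through any composition \<open>b (q x)\<close> without a null set argument.\<close>

lemma LinfE:
  assumes "a \<in> Linf N"
  obtains f C where "f \<in> borel_measurable N" "\<And>x. cmod (f x) \<le> C" "C \<ge> 0" "a = ae_class N f"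
proof -
  obtain f C where f: "f \<in> borel_measurable N" "AE x in N. cmod (f x) \<le> C" "a = ae_class N f"
    using assms by (auto simp: Linf_def)
  \<comment> \<open>The values beyond the bound sit on a null set and are reset to 0. The absolute
    value keeps the bound nonnegative even for a null measure, where \<open>C\<close> could be
    negative.\<close>
  define g where "g x = (if cmod (f x) \<le> \<bar>C\<bar> then f x else 0)" for x
  have "a = ae_class N g"
    unfolding f(3) using f(2) by (intro ae_class_eqI) (auto simp: g_def)
  moreover have "g \<in> borel_measurable N"
    unfolding g_def using f(1) by measurable
  ultimately show ?thesis
    using that[of g "\<bar>C\<bar>"] by (simp add: g_def)
qed

lemma LinfI: "f \<in> borel_measurable N \<Longrightarrow> AE x in N. cmod (f x) \<le> C \<Longrightarrow> ae_class N f \<in> Linf N"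
  by (auto simp: Linf_def)

lemma cls_one_Linf [simp]: "cls_one N \<in> Linf N"
  unfolding cls_one_def by (rule LinfI[where C = 1]) auto

lemma cls_add_Linf [simp]:
  assumes "a \<in> Linf N" "b \<in> Linf N"
  shows "cls_add N a b \<in> Linf N"
proof -
  obtain f C where [measurable]: "f \<in> borel_measurable N" and f: "\<And>x. cmod (f x) \<le> C" "a = ae_class N f"
    using LinfE[OF assms(1)] by metis
  obtain g D where [measurable]: "g \<in> borel_measurable N" and g: "\<And>x. cmod (g x) \<le> D" "b = ae_class N g"
    using LinfE[OF assms(2)] by metis
  show ?thesis
    unfolding f(2) g(2) using f(1) g(1)
    by (subst cls_add_class) (auto intro!: LinfI[where C = "C + D"] norm_triangle_mono)
qed

lemma cls_mult_Linf [simp]: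
  assumes "a \<in> Linf N" "b \<in> Linf N"
  shows "cls_mult N a b \<in> Linf N"
proof -
  obtain f C where [measurable]: "f \<in> borel_measurable N" and f: "\<And>x. cmod (f x) \<le> C" "C \<ge> 0" "a = ae_class N f"
    using LinfE[OF assms(1)] by metis
  obtain g D where [measurable]: "g \<in> borel_measurable N" and g: "\<And>x. cmod (g x) \<le> D" "b = ae_class N g"
    using LinfE[OF assms(2)] by metis
  show ?thesis
    unfolding f(3) g(2) using f(1,2) g(1)
    by (subst cls_mult_class) (auto intro!: LinfI[where C = "C * D"] AE_I2 mult_mono simp: norm_mult)
qed

lemma cls_scale_Linf [simp]:
  assumes "a \<in> Linf N"
  shows "cls_scale N z a \<in> Linf N"
proof -
  obtain f C where [measurable]: "f \<in> borel_measurable N" and f: "\<And>x. cmod (f x) \<le> C" "a = ae_class N f"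
    using LinfE[OF assms] by metis
  show ?thesis
    unfolding f(2) using f(1)
    by (subst cls_scale_class) (auto intro!: LinfI[where C = "cmod z * C"] AE_I2 mult_left_mono simp: norm_mult)
qed

lemma cls_star_Linf [simp]:
  assumes "a \<in> Linf N"
  shows "cls_star N a \<in> Linf N"
proof -
  obtain f C where [measurable]: "f \<in> borel_measurable N" and f: "\<And>x. cmod (f x) \<le> C" "a = ae_class N f"
    using LinfE[OF assms] by metis
  show ?thesis
    unfolding f(2) using f(1) by (subst cls_star_class) (auto intro!: LinfI[where C = C])
qed

section \<open>Hilbert spaces and linear combinations\<close>

locale hilbert =
  fixes H :: "('v, 'z) cspace_scheme"
  assumes hilbert: "hilbert_space H"
begin

lemma cvs: "complex_vector_space H"
  using hilbert unfolding hilbert_space_def by blast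

lemma zero_closed [simp, intro]: "vzero H \<in> carr H"
  and add_closed [simp, intro]: "u \<in> carr H \<Longrightarrow> v \<in> carr H \<Longrightarrow> vadd H u v \<in> carr H"
  and scale_closed [simp, intro]: "u \<in> carr H \<Longrightarrow> vscale H a u \<in> carr H"
  and add_neg [simp]: "u \<in> carr H \<Longrightarrow> vadd H u (vscale H (-1) u) = vzero H"
  and scale_add: "u \<in> carr H \<Longrightarrow> v \<in> carr H \<Longrightarrow>
    vscale H a (vadd H u v) = vadd H (vscale H a u) (vscale H a v)"
  and add_scale: "u \<in> carr H \<Longrightarrow> vscale H (a + b) u = vadd H (vscale H a u) (vscale H b u)"
  and scale_scale: "u \<in> carr H \<Longrightarrow> vscale H a (vscale H b u) = vscale H (a * b) u"
  and scale_one [simp]: "u \<in> carr H \<Longrightarrow> vscale H 1 u = u"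
  using cvs by (simp_all add: complex_vector_space_def)

lemma add_assoc: "u \<in> carr H \<Longrightarrow> v \<in> carr H \<Longrightarrow> w \<in> carr H \<Longrightarrow>
    vadd H (vadd H u v) w = vadd H u (vadd H v w)"
  using cvs unfolding complex_vector_space_def by blast

lemma add_commute: "u \<in> carr H \<Longrightarrow> v \<in> carr H \<Longrightarrow> vadd H u v = vadd H v u"
  using cvs unfolding complex_vector_space_def by blast

lemma zero_add [simp]: "u \<in> carr H \<Longrightarrow> vadd H (vzero H) u = u"
  using cvs unfolding complex_vector_space_def by blast

lemma ip_add_right: "u \<in> carr H \<Longrightarrow> v \<in> carr H \<Longrightarrow> w \<in> carr H \<Longrightarrow>
    vip H u (vadd H v w) = vip H u v + vip H u w"
  using hilbert[unfolded hilbert_space_def, THEN conjunct2, THEN conjunct1] by simp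

lemma ip_scale_right: "u \<in> carr H \<Longrightarrow> v \<in> carr H \<Longrightarrow> vip H u (vscale H a v) = a * vip H u v"
  using hilbert[unfolded hilbert_space_def, THEN conjunct2, THEN conjunct2, THEN conjunct1] by simp

lemma ip_cnj: "u \<in> carr H \<Longrightarrow> v \<in> carr H \<Longrightarrow> vip H v u = cnj (vip H u v)"
  using hilbert[unfolded hilbert_space_def, THEN conjunct2, THEN conjunct2, THEN conjunct2, THEN conjunct1]
  by blast

lemma ip_self_nonneg: "u \<in> carr H \<Longrightarrow> 0 \<le> Re (vip H u u)"
  using hilbert[unfolded hilbert_space_def, THEN conjunct2, THEN conjunct2, THEN conjunct2, THEN conjunct2,
      THEN conjunct1] by blast

lemma ip_self_eq_0: "u \<in> carr H \<Longrightarrow> vip H u u = 0 \<Longrightarrow> u = vzero H"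
  and complete: "(\<And>n. X n \<in> carr H) \<Longrightarrow>
    (\<And>e. e > 0 \<Longrightarrow> \<exists>N. \<forall>m\<ge>N. \<forall>n\<ge>N. vdist H (X m) (X n) < e) \<Longrightarrow>
    \<exists>u\<in>carr H. (\<lambda>n::nat. vdist H (X n) u) \<longlonglongrightarrow> 0"
  using hilbert[unfolded hilbert_space_def, THEN conjunct2, THEN conjunct2, THEN conjunct2, THEN conjunct2,
      THEN conjunct2] by simp_all

lemma ip_add_left: "u \<in> carr H \<Longrightarrow> v \<in> carr H \<Longrightarrow> w \<in> carr H \<Longrightarrow>
    vip H (vadd H v w) u = vip H v u + vip H w u"
  by (metis add_closed complex_cnj_add ip_add_right ip_cnj)

lemma ip_scale_left: "u \<in> carr H \<Longrightarrow> v \<in> carr H \<Longrightarrow> vip H (vscale H a v) u = cnj a * vip H v u"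
  by (metis complex_cnj_mult ip_cnj ip_scale_right scale_closed)

lemma scale_zero: "u \<in> carr H \<Longrightarrow> vscale H 0 u = vzero H"
  using add_scale[of u 1 "-1"] by simp

lemma ip_zero_right [simp]: "u \<in> carr H \<Longrightarrow> vip H u (vzero H) = 0"
  by (metis ip_scale_right mult_zero_left scale_zero)

lemma ip_zero_left [simp]: "u \<in> carr H \<Longrightarrow> vip H (vzero H) u = 0"
  using ip_cnj[of "u" "vzero H"] by simp

lemma ip_self_real: "u \<in> carr H \<Longrightarrow> vip H u u = complex_of_real (Re (vip H u u))"
  using ip_cnj[of u u] by (metis Reals_cnj_iff of_real_Re)

lemma norm_nonneg [simp]: "u \<in> carr H \<Longrightarrow> 0 \<le> vnorm H u"
  by (simp add: vnorm_def ip_self_nonneg)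

lemma norm_sq: "u \<in> carr H \<Longrightarrow> (vnorm H u)\<^sup>2 = Re (vip H u u)"
  by (simp add: vnorm_def ip_self_nonneg)

lemma ip_self: "u \<in> carr H \<Longrightarrow> vip H u u = complex_of_real ((vnorm H u)\<^sup>2)"
  using ip_self_real norm_sq by simp

lemma norm_eq_0: "u \<in> carr H \<Longrightarrow> vnorm H u = 0 \<Longrightarrow> u = vzero H"
  by (metis ip_self ip_self_eq_0 of_real_0 zero_eq_power2)

lemma norm_zero [simp]: "vnorm H (vzero H) = 0"
  by (simp add: vnorm_def)

lemma norm_scale: "u \<in> carr H \<Longrightarrow> vnorm H (vscale H a u) = cmod a * vnorm H u"
proof -
  assume u: "u \<in> carr H"
  have "vip H (vscale H a u) (vscale H a u) = complex_of_real ((cmod a)\<^sup>2) * vip H u u"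
    using u by (simp only: ip_scale_left ip_scale_right scale_closed complex_norm_square mult_ac)
  then show ?thesis
    by (simp add: vnorm_def real_sqrt_mult)
qed

lemma cauchy_schwarz:
  assumes u: "u \<in> carr H" and v: "v \<in> carr H"
  shows "cmod (vip H u v) \<le> vnorm H u * vnorm H v"
proof (cases "vnorm H v = 0")
  case True
  then show ?thesis using norm_eq_0[OF v] u by simp
next
  case False
  define b where "b = (vnorm H v)\<^sup>2"
  define z where "z = vip H v u"
  have b: "b > 0" using False v by (simp add: b_def)
  have uv: "vip H u v = cnj z" using ip_cnj[OF v u] by (simp add: z_def)
  \<comment> \<open>This is the component of \<open>u\<close> orthogonal to \<open>v\<close>: its
    squared norm is |u|^2 - |z|^2 / |v|^2, which is therefore nonnegative.\<close>
  define w where "w = vadd H u (vscale H (- z / of_real b) v)"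
  have w: "w \<in> carr H" using u v by (simp add: w_def)
  have "vip H w w = vip H u u + (- z / of_real b) * vip H u v
      + cnj (- z / of_real b) * vip H v u + cnj (- z / of_real b) * (- z / of_real b) * vip H v v"
    unfolding w_def using u v
    by (simp add: ip_add_left ip_add_right ip_scale_left ip_scale_right algebra_simps)
  also have "\<dots> = of_real ((vnorm H u)\<^sup>2) - z * cnj z / of_real b"
    using b by (simp add: uv ip_self[OF u] ip_self[OF v] z_def[symmetric] b_def[symmetric] field_simps)
  also have "\<dots> = of_real ((vnorm H u)\<^sup>2 - (cmod z)\<^sup>2 / b)"
    by (simp add: complex_norm_square del: of_real_power)
  finally have "0 \<le> (vnorm H u)\<^sup>2 - (cmod z)\<^sup>2 / b"
    using ip_self_nonneg[OF w] by simp
  then have "(cmod z)\<^sup>2 \<le> (vnorm H u * vnorm H v)\<^sup>2"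
    using b by (simp add: field_simps b_def power_mult_distrib)
  then show ?thesis
    using u v power2_le_imp_le[of "cmod z" "vnorm H u * vnorm H v"] by (simp add: uv)
qed

lemma norm_triangle:
  assumes u: "u \<in> carr H" and v: "v \<in> carr H"
  shows "vnorm H (vadd H u v) \<le> vnorm H u + vnorm H v"
proof (rule power2_le_imp_le)
  have "(vnorm H (vadd H u v))\<^sup>2 = (vnorm H u)\<^sup>2 + (vnorm H v)\<^sup>2 + (Re (vip H u v) + Re (vip H v u))"
    using u v by (simp add: norm_sq ip_add_left ip_add_right)
  also have "Re (vip H u v) + Re (vip H v u) \<le> 2 * (vnorm H u * vnorm H v)"
    using cauchy_schwarz[OF u v] cauchy_schwarz[OF v u] complex_Re_le_cmod[of "vip H u v"]
      complex_Re_le_cmod[of "vip H v u"] by (simp add: mult.commute)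
  finally show "(vnorm H (vadd H u v))\<^sup>2 \<le> (vnorm H u + vnorm H v)\<^sup>2"
    by (simp add: power2_sum)
qed (use u v in simp)

abbreviation dif where "dif u v \<equiv> vadd H u (vscale H (-1) v)"

lemma dist_nonneg [simp]: "u \<in> carr H \<Longrightarrow> v \<in> carr H \<Longrightarrow> 0 \<le> vdist H u v"
  by (simp add: vdist_def)

lemma add_left_commute: "u \<in> carr H \<Longrightarrow> v \<in> carr H \<Longrightarrow> w \<in> carr H \<Longrightarrow>
    vadd H u (vadd H v w) = vadd H v (vadd H u w)"
  by (metis add_assoc add_commute)

lemma add_zero [simp]: "u \<in> carr H \<Longrightarrow> vadd H u (vzero H) = u"
  by (metis add_commute zero_add zero_closed)

lemma dif_dif: "u \<in> carr H \<Longrightarrow> v \<in> carr H \<Longrightarrow> w \<in> carr H \<Longrightarrow> vadd H (dif u v) (dif v w) = dif u w"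
proof -
  assume *: "u \<in> carr H" "v \<in> carr H" "w \<in> carr H"
  have "vadd H (dif u v) (dif v w) = vadd H u (vadd H (vadd H (vscale H (-1) v) v) (vscale H (-1) w))"
    using * by (simp add: add_assoc)
  also have "vadd H (vscale H (-1) v) v = vzero H"
    using * by (simp add: add_commute[of "vscale H (-1) v" v])
  finally show ?thesis using * by simp
qed

lemma dif_swap: "u \<in> carr H \<Longrightarrow> v \<in> carr H \<Longrightarrow> dif v u = vscale H (-1) (dif u v)"
  by (simp add: scale_add scale_scale add_commute)

lemma dist_triangle: "u \<in> carr H \<Longrightarrow> v \<in> carr H \<Longrightarrow> w \<in> carr H \<Longrightarrow>
    vdist H u w \<le> vdist H u v + vdist H v w"
  using norm_triangle[of "dif u v" "dif v w"] by (simp add: vdist_def dif_dif)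

lemma dist_commute: "u \<in> carr H \<Longrightarrow> v \<in> carr H \<Longrightarrow> vdist H u v = vdist H v u"
  unfolding vdist_def by (subst dif_swap[of u v]) (simp_all add: norm_scale)

lemma dist_self [simp]: "u \<in> carr H \<Longrightarrow> vdist H u u = 0"
  by (simp add: vdist_def)

lemma dist_eq_0:
  assumes u: "u \<in> carr H" and v: "v \<in> carr H" and d: "vdist H u v = 0"
  shows "u = v"
proof -
  have "dif u v = vzero H"
    using d u v by (intro norm_eq_0) (auto simp: vdist_def)
  then have "vadd H (dif u v) v = v" using v by simp
  moreover have "vadd H (dif u v) v = vadd H u (vadd H (vscale H (-1) v) v)"
    using u v by (simp add: add_assoc)
  moreover have "vadd H (vscale H (-1) v) v = vzero H"
    using v by (simp add: add_commute[of "vscale H (-1) v" v])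
  ultimately show ?thesis using u by simp
qed

lemma dist_add:
  assumes "u \<in> carr H" "v \<in> carr H" "u' \<in> carr H" "v' \<in> carr H"
  shows "vdist H (vadd H u v) (vadd H u' v') \<le> vdist H u u' + vdist H v v'"
proof -
  have "dif (vadd H u v) (vadd H u' v') = vadd H (dif u u') (dif v v')"
    using assms by (simp add: scale_add add_assoc add_left_commute[of v])
  then show ?thesis
    using assms norm_triangle[of "dif u u'" "dif v v'"] by (simp add: vdist_def)
qed

lemma dist_scale: "u \<in> carr H \<Longrightarrow> v \<in> carr H \<Longrightarrow> vdist H (vscale H a u) (vscale H a v) = cmod a * vdist H u v"
proof -
  assume *: "u \<in> carr H" "v \<in> carr H"
  then have "dif (vscale H a u) (vscale H a v) = vscale H a (dif u v)"
    by (simp add: scale_add scale_scale)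
  then show ?thesis using * by (simp add: vdist_def norm_scale)
qed

lemma norm_eq_dist: "u \<in> carr H \<Longrightarrow> vnorm H u = vdist H u (vzero H)"
  by (metis add_neg add_zero scale_closed vdist_def zero_add zero_closed)

lemma norm_le_dist: "u \<in> carr H \<Longrightarrow> v \<in> carr H \<Longrightarrow> vnorm H u \<le> vdist H u v + vnorm H v"
  using dist_triangle[of u v "vzero H"] by (simp add: norm_eq_dist)

section \<open>Convergence of sequences in norm\<close>

definition vlim :: "(nat \<Rightarrow> 'v) \<Rightarrow> 'v \<Rightarrow> bool" where
  "vlim X u \<longleftrightarrow> (\<forall>n. X n \<in> carr H) \<and> u \<in> carr H \<and> (\<lambda>n. vdist H (X n) u) \<longlonglongrightarrow> 0"

lemma tendsto_0_squeeze: "(\<And>n. 0 \<le> f n) \<Longrightarrow> (\<And>n. f n \<le> h n) \<Longrightarrow> h \<longlonglongrightarrow> 0 \<Longrightarrow> f \<longlonglongrightarrow> (0::real)"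
  by (rule tendsto_sandwich[of "\<lambda>_. 0" f sequentially h]) auto

lemma vlim_dist_0:
  assumes "vlim X u" "vlim Y v"
  shows "(\<lambda>n. vdist H (X n) (Y n)) \<longlonglongrightarrow> vdist H u v"
proof -
  have "(\<lambda>n. vdist H (X n) (Y n) - vdist H u v) \<longlonglongrightarrow> 0"
  proof (rule Lim_null_comparison)
    show "(\<lambda>n. vdist H (X n) u + vdist H (Y n) v) \<longlonglongrightarrow> 0"
      using tendsto_add[of "\<lambda>n. vdist H (X n) u" 0 _ "\<lambda>n. vdist H (Y n) v" 0] assms by (simp add: vlim_def)
    have "norm (vdist H (X n) (Y n) - vdist H u v) \<le> vdist H (X n) u + vdist H (Y n) v" for n
    proof -
      have c: "X n \<in> carr H" "Y n \<in> carr H" "u \<in> carr H" "v \<in> carr H"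
        using assms by (auto simp: vlim_def)
      then show ?thesis
        using dist_triangle[of "X n" u "Y n"] dist_triangle[of u v "Y n"] dist_commute[of v "Y n"]
          dist_triangle[of u "X n" v] dist_triangle[of "X n" "Y n" v] dist_commute[of u "X n"]
        by (simp add: abs_le_iff)
    qed
    then show "\<forall>\<^sub>F n in sequentially. norm (vdist H (X n) (Y n) - vdist H u v) \<le> vdist H (X n) u + vdist H (Y n) v"
      by simp
  qed
  then show ?thesis using LIM_zero_iff by blast
qed

lemma vlim_const: "u \<in> carr H \<Longrightarrow> vlim (\<lambda>_. u) u"
  by (simp add: vlim_def)

lemma vlim_unique:
  assumes "vlim X u" "vlim X v"
  shows "u = v"
proof -
  have "(\<lambda>n. vdist H (X n) (X n)) \<longlonglongrightarrow> vdist H u v"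
    using vlim_dist_0[OF assms] .
  moreover have "(\<lambda>n. vdist H (X n) (X n)) = (\<lambda>n. 0)"
    using assms by (auto simp: vlim_def)
  ultimately have "vdist H u v = 0"
    by (simp add: LIMSEQ_const_iff)
  then show ?thesis
    using assms dist_eq_0 by (auto simp: vlim_def)
qed

lemma vlim_add: "vlim X u \<Longrightarrow> vlim Y v \<Longrightarrow> vlim (\<lambda>n. vadd H (X n) (Y n)) (vadd H u v)"
proof -
  assume *: "vlim X u" "vlim Y v"
  then have "(\<lambda>n. vdist H (X n) u + vdist H (Y n) v) \<longlonglongrightarrow> 0"
    using tendsto_add[of "\<lambda>n. vdist H (X n) u" 0 _ "\<lambda>n. vdist H (Y n) v" 0] by (simp add: vlim_def)
  then have "(\<lambda>n. vdist H (vadd H (X n) (Y n)) (vadd H u v)) \<longlonglongrightarrow> 0"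
    by (rule tendsto_0_squeeze[rotated 2]) (use * in \<open>auto simp: vlim_def intro: dist_add\<close>)
  then show ?thesis using * by (auto simp: vlim_def)
qed

lemma vlim_scale: "vlim X u \<Longrightarrow> vlim (\<lambda>n. vscale H a (X n)) (vscale H a u)"
  using tendsto_mult_left[of "\<lambda>n. vdist H (X n) u" 0 sequentially "cmod a"]
  by (auto simp: vlim_def dist_scale)

lemma vlim_ip:
  assumes "vlim X u" "vlim Y v"
  shows "(\<lambda>n. vip H (X n) (Y n)) \<longlonglongrightarrow> vip H u v"
proof -
  have c: "X n \<in> carr H" "Y n \<in> carr H" "u \<in> carr H" "v \<in> carr H" for n
    using assms by (auto simp: vlim_def)
  have "(\<lambda>n. vip H (X n) (Y n) - vip H u v) \<longlonglongrightarrow> 0"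
  proof (rule Lim_null_comparison)
    have "(\<lambda>n. vdist H (X n) u * (vdist H (Y n) v + vnorm H v) + vnorm H u * vdist H (Y n) v)
        \<longlonglongrightarrow> 0 * (0 + vnorm H v) + vnorm H u * 0"
      using assms by (intro tendsto_intros) (auto simp: vlim_def)
    then show "(\<lambda>n. vdist H (X n) u * (vdist H (Y n) v + vnorm H v) + vnorm H u * vdist H (Y n) v)
        \<longlonglongrightarrow> 0" by simp
    have "norm (vip H (X n) (Y n) - vip H u v) \<le>
        vdist H (X n) u * (vdist H (Y n) v + vnorm H v) + vnorm H u * vdist H (Y n) v" for n
    proof -
      \<comment> \<open>One argument is changed at a time; the norm of \<open>Y n\<close> that this
        leaves is then bounded through the limit \<open>v\<close>.\<close>
      have "vip H (X n) (Y n) - vip H u v = vip H (dif (X n) u) (Y n) + vip H u (dif (Y n) v)"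
        using c by (simp add: ip_add_left ip_add_right ip_scale_left ip_scale_right)
      also have "norm \<dots> \<le> cmod (vip H (dif (X n) u) (Y n)) + cmod (vip H u (dif (Y n) v))"
        by (rule norm_triangle_ineq)
      also have "\<dots> \<le> vdist H (X n) u * vnorm H (Y n) + vnorm H u * vdist H (Y n) v"
        using c cauchy_schwarz[of "dif (X n) u" "Y n"] cauchy_schwarz[of u "dif (Y n) v"]
        by (simp add: vdist_def)
      also have "\<dots> \<le> vdist H (X n) u * (vdist H (Y n) v + vnorm H v) + vnorm H u * vdist H (Y n) v"
        using c norm_le_dist[of "Y n" v] by (simp add: mult_left_mono)
      finally show ?thesis .
    qed
    then show "\<forall>\<^sub>F n in sequentially. norm (vip H (X n) (Y n) - vip H u v) \<le>
        vdist H (X n) u * (vdist H (Y n) v + vnorm H v) + vnorm H u * vdist H (Y n) v"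
      by simp
  qed
  then show ?thesis using LIM_zero_iff by blast
qed

lemma vlim_Cauchy:
  assumes "vlim X u" "e > 0"
  shows "\<exists>N. \<forall>m\<ge>N. \<forall>n\<ge>N. vdist H (X m) (X n) < e"
proof -
  have c: "X n \<in> carr H" "u \<in> carr H" for n
    using assms by (auto simp: vlim_def)
  have "(\<lambda>n. vdist H (X n) u) \<longlonglongrightarrow> 0"
    using assms by (auto simp: vlim_def)
  then have "\<forall>\<^sub>F n in sequentially. vdist H (X n) u < e / 2"
    using order_tendstoD(2)[of _ 0 _ "e/2"] assms(2) by simp
  then obtain N where N: "\<And>n. n \<ge> N \<Longrightarrow> vdist H (X n) u < e / 2"
    by (auto simp: eventually_sequentially)
  have "vdist H (X m) (X n) < e" if "m \<ge> N" "n \<ge> N" for m n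
    using N[OF that(1)] N[OF that(2)] dist_triangle[of "X m" u "X n"] dist_commute[of u "X n"] c
    by simp
  then show ?thesis by blast
qed

lemma Cauchy_vlim:
  assumes "\<And>n. X n \<in> carr H" "\<And>e. e > 0 \<Longrightarrow> \<exists>N. \<forall>m\<ge>N. \<forall>n\<ge>N. vdist H (X m) (X n) < e"
  shows "\<exists>u. vlim X u"
  using complete[of X] assms by (auto simp: vlim_def)

end

lemma bounded_op_vlim:
  assumes "hilbert H" "hilbert K" and L: "bounded_op H K L" and X: "hilbert.vlim H X u"
  shows "hilbert.vlim K (\<lambda>n. L (X n)) (L u)"
proof -
  interpret H: hilbert H by fact
  interpret K: hilbert K by fact
  have c: "X n \<in> carr H" "u \<in> carr H" for n
    using X by (auto simp: H.vlim_def)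
  obtain C where C: "\<And>u. u \<in> carr H \<Longrightarrow> vnorm K (L u) \<le> C * vnorm H u"
    using L unfolding bounded_op_def by blast
  have Lc: "L u \<in> carr K" if "u \<in> carr H" for u
    using L that by (auto simp: bounded_op_def)
  have "vdist K (L v) (L w) \<le> C * vdist H v w" if "v \<in> carr H" "w \<in> carr H" for v w
  proof -
    have "vadd K (L v) (vscale K (-1) (L w)) = L (vadd H v (vscale H (-1) w))"
      using L that by (simp add: bounded_op_def)
    then show ?thesis using C[of "vadd H v (vscale H (-1) w)"] that by (simp add: vdist_def)
  qed
  moreover have "(\<lambda>n. C * vdist H (X n) u) \<longlonglongrightarrow> 0"
    using X tendsto_mult_left[of "\<lambda>n. vdist H (X n) u" 0 sequentially C] by (simp add: H.vlim_def)
  ultimately have "(\<lambda>n. vdist K (L (X n)) (L u)) \<longlonglongrightarrow> 0"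
    using c Lc by (intro K.tendsto_0_squeeze[of "\<lambda>n. vdist K (L (X n)) (L u)" "\<lambda>n. C * vdist H (X n) u"]) auto
  then show ?thesis using c Lc by (simp add: K.vlim_def)
qed

text \<open>Interprets a formal sum in \<open>H\<close> once every symbol \<open>e\<close> stands
  for the vector \<open>J e\<close>. For symbols of type \<open>'b gen\<close> the lists are the
  formal sums of \<open>sep_completion\<close>.\<close>

primrec lincomb :: "('v, 'z) cspace_scheme \<Rightarrow> ('e \<Rightarrow> 'v) \<Rightarrow> (complex \<times> 'e) list \<Rightarrow> 'v" where
  "lincomb H J [] = vzero H"
| "lincomb H J (p # xs) = vadd H (vscale H (fst p) (J (snd p))) (lincomb H J xs)"

section \<open>Evaluation of formal sums\<close>

context hilbert
begin

context
  fixes D and J :: "'e \<Rightarrow> 'v"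
  assumes J: "\<And>e. e \<in> D \<Longrightarrow> J e \<in> carr H"
begin

lemma lincomb_closed: "snd ` set xs \<subseteq> D \<Longrightarrow> lincomb H J xs \<in> carr H"
  by (induction xs) (auto simp: J)

lemma lincomb_append:
  "snd ` set xs \<subseteq> D \<Longrightarrow> snd ` set ys \<subseteq> D \<Longrightarrow>
    lincomb H J (xs @ ys) = vadd H (lincomb H J xs) (lincomb H J ys)"
  by (induction xs) (auto simp: J lincomb_closed add_assoc)

lemma lincomb_scale:
  "snd ` set xs \<subseteq> D \<Longrightarrow> lincomb H J (map (\<lambda>(z, e). (a * z, e)) xs) = vscale H a (lincomb H J xs)"
proof (induction xs)
  case Nil
  have "vscale H a (vzero H) = vzero H"
    by (metis mult_zero_right scale_scale scale_zero zero_closed)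
  then show ?case by simp
qed (auto simp: J lincomb_closed scale_add scale_scale split: prod.splits)

lemma ip_lincomb_right:
  "u \<in> carr H \<Longrightarrow> snd ` set xs \<subseteq> D \<Longrightarrow> vip H u (lincomb H J xs) = (\<Sum>(z, e)\<leftarrow>xs. z * vip H u (J e))"
  by (induction xs) (auto simp: J lincomb_closed ip_add_right ip_scale_right)

lemma ip_lincomb_left:
  "u \<in> carr H \<Longrightarrow> snd ` set xs \<subseteq> D \<Longrightarrow> vip H (lincomb H J xs) u = (\<Sum>(z, e)\<leftarrow>xs. cnj z * vip H (J e) u)"
  by (induction xs) (auto simp: J lincomb_closed ip_add_left ip_scale_left)

lemma ip_lincomb:
  "snd ` set xs \<subseteq> D \<Longrightarrow> snd ` set ys \<subseteq> D \<Longrightarrow>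
    vip H (lincomb H J xs) (lincomb H J ys) =
    (\<Sum>(z, e)\<leftarrow>xs. \<Sum>(w, f)\<leftarrow>ys. cnj z * w * vip H (J e) (J f))"
proof -
  assume xs: "snd ` set xs \<subseteq> D" and ys: "snd ` set ys \<subseteq> D"
  have "cnj z * vip H (J e) (lincomb H J ys) = (\<Sum>(w, f)\<leftarrow>ys. cnj z * w * vip H (J e) (J f))"
    if "e \<in> D" for z e
    using that ys by (simp add: ip_lincomb_right J sum_list_const_mult[symmetric] case_prod_unfold mult.assoc)
  then show ?thesis
    unfolding ip_lincomb_left[OF lincomb_closed[OF ys] xs]
    using xs by (intro arg_cong[where f = sum_list] map_cong refl) auto
qed

text \<open>Formal sums are acted on by relabelling their symbols. If the relabelling matches
  \<open>L\<close> on symbols, linearity makes it match \<open>L\<close> on all sums; this carries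
  the module actions over.\<close>

lemma lincomb_bounded_op:
  assumes "bounded_op H H L"
    and "\<And>e. e \<in> D \<Longrightarrow> J (\<phi> e) = L (J e)"
  shows "snd ` set xs \<subseteq> D \<Longrightarrow> lincomb H J (map (\<lambda>(z, e). (z, \<phi> e)) xs) = L (lincomb H J xs)"
proof (induction xs)
  case Nil
  \<comment> \<open>\<open>bounded_op\<close> asserts additivity and homogeneity only, so
    preservation of the zero vector is obtained by scaling with 0.\<close>
  have "L (vscale H 0 (vzero H)) = vscale H 0 (L (vzero H))" "L (vzero H) \<in> carr H"
    using assms(1) by (auto simp: bounded_op_def)
  then have "L (vzero H) = vzero H" by (simp add: scale_zero)
  then show ?case by simp
next
  case (Cons p xs)
  then show ?case using assms by (cases p) (auto simp: bounded_op_def J lincomb_closed)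
qed

end

end

section \<open>Closed linear spans\<close>

context hilbert
begin

text \<open>The closed linear span of the family \<open>J\<close>, in the \<epsilon> form in which
  \<open>sep_completion_iso\<close> asks for density.\<close>

definition lin_closure :: "'e set \<Rightarrow> ('e \<Rightarrow> 'v) \<Rightarrow> 'v set" where
  "lin_closure D J = {v \<in> carr H. \<forall>\<epsilon>>0. \<exists>xs. snd ` set xs \<subseteq> D \<and> vdist H (lincomb H J xs) v < \<epsilon>}"

context
  fixes D and J :: "'e \<Rightarrow> 'v"
  assumes J: "\<And>e. e \<in> D \<Longrightarrow> J e \<in> carr H"
begin

lemma lin_closure_base: "e \<in> D \<Longrightarrow> J e \<in> lin_closure D J"
  unfolding lin_closure_def using J by (auto intro!: exI[of _ "[(1, e)]"])

lemma lin_closure_add: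
  assumes u: "u \<in> lin_closure D J" and v: "v \<in> lin_closure D J"
  shows "vadd H u v \<in> lin_closure D J"
proof -
  have c: "u \<in> carr H" "v \<in> carr H" using u v by (auto simp: lin_closure_def)
  have "\<exists>xs. snd ` set xs \<subseteq> D \<and> vdist H (lincomb H J xs) (vadd H u v) < \<epsilon>" if \<epsilon>: "\<epsilon> > 0" for \<epsilon>
  proof -
    obtain xs where xs: "snd ` set xs \<subseteq> D" "vdist H (lincomb H J xs) u < \<epsilon> / 2"
      using u half_gt_zero[OF \<epsilon>] unfolding lin_closure_def by blast
    obtain ys where ys: "snd ` set ys \<subseteq> D" "vdist H (lincomb H J ys) v < \<epsilon> / 2"
      using v half_gt_zero[OF \<epsilon>] unfolding lin_closure_def by blast
    have "vdist H (lincomb H J (xs @ ys)) (vadd H u v) < \<epsilon>"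
      using dist_add[of "lincomb H J xs" "lincomb H J ys" u v] xs ys c lincomb_closed[OF J xs(1)] lincomb_closed[OF J ys(1)]
      by (simp add: lincomb_append[OF J])
    then show ?thesis using xs(1) ys(1) by (intro exI[of _ "xs @ ys"]) auto
  qed
  then show ?thesis using c by (simp add: lin_closure_def)
qed

lemma lin_closure_scale:
  assumes u: "u \<in> lin_closure D J"
  shows "vscale H a u \<in> lin_closure D J"
proof -
  have c: "u \<in> carr H" using u by (auto simp: lin_closure_def)
  have "\<exists>xs. snd ` set xs \<subseteq> D \<and> vdist H (lincomb H J xs) (vscale H a u) < \<epsilon>" if \<epsilon>: "\<epsilon> > 0" for \<epsilon>
  proof -
    \<comment> \<open>The summand 1 avoids division by zero for \<open>a = 0\<close>.\<close>
    have "\<epsilon> / (cmod a + 1) > 0" using \<epsilon> by (simp add: add_nonneg_pos)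
    then obtain xs where xs: "snd ` set xs \<subseteq> D" "vdist H (lincomb H J xs) u < \<epsilon> / (cmod a + 1)"
      using u unfolding lin_closure_def by blast
    have L: "lincomb H J xs \<in> carr H" using lincomb_closed[OF J xs(1)] .
    let ?ys = "map (\<lambda>(z, e). (a * z, e)) xs"
    have "vdist H (lincomb H J ?ys) (vscale H a u) = cmod a * vdist H (lincomb H J xs) u"
      using xs(1) by (simp add: lincomb_scale[OF J] dist_scale L c)
    also have "\<dots> \<le> (cmod a + 1) * vdist H (lincomb H J xs) u"
      using L c by (intro mult_right_mono) auto
    also have "\<dots> < \<epsilon>"
      using xs(2) by (simp add: pos_less_divide_eq add_nonneg_pos mult.commute)
    finally show ?thesis using xs(1) by (intro exI[of _ ?ys]) force
  qed
  then show ?thesis using c by (simp add: lin_closure_def)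
qed

lemma lin_closure_lim:
  assumes X: "\<And>n. X n \<in> lin_closure D J" and u: "u \<in> carr H" and lim: "(\<lambda>n::nat. vdist H (X n) u) \<longlonglongrightarrow> 0"
  shows "u \<in> lin_closure D J"
proof -
  have "\<exists>xs. snd ` set xs \<subseteq> D \<and> vdist H (lincomb H J xs) u < \<epsilon>" if \<epsilon>: "\<epsilon> > 0" for \<epsilon>
  proof -
    have "\<forall>\<^sub>F n in sequentially. vdist H (X n) u < \<epsilon> / 2"
      using order_tendstoD(2)[OF lim, of "\<epsilon> / 2"] \<epsilon> by simp
    then obtain n where n: "vdist H (X n) u < \<epsilon> / 2" by (auto simp: eventually_sequentially)
    obtain xs where xs: "snd ` set xs \<subseteq> D" "vdist H (lincomb H J xs) (X n) < \<epsilon> / 2"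
      using X[of n] half_gt_zero[OF \<epsilon>] unfolding lin_closure_def by blast
    have "X n \<in> carr H" using X[of n] by (simp add: lin_closure_def)
    then have "vdist H (lincomb H J xs) u < \<epsilon>"
      using dist_triangle[of "lincomb H J xs" "X n" u] lincomb_closed[OF J xs(1)] xs n u by simp
    then show ?thesis using xs(1) by blast
  qed
  then show ?thesis using u by (simp add: lin_closure_def)
qed

end

end

section \<open>Transfer of the bimodule structure and separation-completions\<close>

text \<open>Every clause in the definition of a W*-bimodule is an equation between vectors, a
  statement about inner products or a convergence statement. \<open>U\<close> sends each to the same
  clause in \<open>K\<close>, and injectivity brings the equations back. In this way the operations
  of a completion, which are defined through arbitrary choices, never have to be
  manipulated.\<close>

lemma wstar_bimodule_transfer:
  fixes H :: "(('a \<Rightarrow> complex) set, 'v) bimodule" and K :: "(('a \<Rightarrow> complex) set, 'w) bimodule"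
  assumes K: "wstar_bimodule \<mu> K"
    and bij: "bij_betw U (carr H) (carr K)"
    and zero: "vzero H \<in> carr H" "U (vzero H) = vzero K"
    and add: "\<And>u v. u \<in> carr H \<Longrightarrow> v \<in> carr H \<Longrightarrow> vadd H u v \<in> carr H \<and> U (vadd H u v) = vadd K (U u) (U v)"
    and scale: "\<And>a u. u \<in> carr H \<Longrightarrow> vscale H a u \<in> carr H \<and> U (vscale H a u) = vscale K a (U u)"
    and ip: "\<And>u v. u \<in> carr H \<Longrightarrow> v \<in> carr H \<Longrightarrow> vip H u v = vip K (U u) (U v)"
    and la: "\<And>a u. a \<in> Linf \<mu> \<Longrightarrow> u \<in> carr H \<Longrightarrow> lact H a u \<in> carr H \<and> U (lact H a u) = lact K a (U u)"
    and ra: "\<And>a u. a \<in> Linf \<mu> \<Longrightarrow> u \<in> carr H \<Longrightarrow> ract H u a \<in> carr H \<and> U (ract H u a) = ract K (U u) a"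
  shows "bimodule_iso \<mu> H K"
proof -
  have hK: "hilbert_space K" using K by (simp add: wstar_bimodule_def)
  interpret K: hilbert K by unfold_locales (rule hK)
  have Uc: "U u \<in> carr K" if "u \<in> carr H" for u
    using bij that by (auto simp: bij_betw_def)
  have inj: "u = v" if "U u = U v" "u \<in> carr H" "v \<in> carr H" for u v
    using bij that by (auto simp: bij_betw_def inj_on_def)
  have surj: "\<exists>u\<in>carr H. U u = w" if "w \<in> carr K" for w
    using bij that unfolding bij_betw_def by (metis imageE)
  have nrm: "vnorm H u = vnorm K (U u)" if "u \<in> carr H" for u
    using ip that by (simp add: vnorm_def)
  have dst: "vdist H u v = vdist K (U u) (U v)" if "u \<in> carr H" "v \<in> carr H" for u v
    using add scale nrm that by (simp add: vdist_def)
  note c = zero add[THEN conjunct1] scale[THEN conjunct1] add[THEN conjunct2] scale[THEN conjunct2] Uc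
  have "complex_vector_space H"
    unfolding complex_vector_space_def
    by (intro conjI ballI allI; (rule inj)?;
        simp add: c K.add_assoc K.add_commute K.add_left_commute K.scale_add K.add_scale K.scale_scale)
  moreover have "\<exists>u\<in>carr H. (\<lambda>n::nat. vdist H (X n) u) \<longlonglongrightarrow> 0"
    if X: "\<forall>n. X n \<in> carr H" "\<forall>e>0. \<exists>N. \<forall>m\<ge>N. \<forall>n\<ge>N. vdist H (X m) (X n) < e" for X
  proof -
    obtain w where "w \<in> carr K" "(\<lambda>n. vdist K (U (X n)) w) \<longlonglongrightarrow> 0"
      using K.complete[of "\<lambda>n. U (X n)"] X Uc by (auto simp: dst)
    then show ?thesis using surj[of w] X by (auto simp: dst)
  qed
  ultimately have "hilbert_space H"
    unfolding hilbert_space_def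
    using K.ip_self_eq_0 inj
    by (simp add: ip c K.ip_add_right K.ip_scale_right K.ip_self_nonneg K.ip_cnj[symmetric])
  moreover have rep: "normal_star_rep \<mu> mul H \<rho>"
    if R: "normal_star_rep \<mu> mul K \<sigma>"
      and r: "\<And>a u. a \<in> Linf \<mu> \<Longrightarrow> u \<in> carr H \<Longrightarrow> \<rho> a u \<in> carr H \<and> U (\<rho> a u) = \<sigma> a (U u)"
      and m: "\<And>a b. a \<in> Linf \<mu> \<Longrightarrow> b \<in> Linf \<mu> \<Longrightarrow> mul a b \<in> Linf \<mu>" for mul \<rho> \<sigma>
  proof -
    note r' = r[THEN conjunct1] r[THEN conjunct2]
    have bop: "bounded_op H H (\<rho> a)" if a: "a \<in> Linf \<mu>" for a
    proof -
      have b: "bounded_op K K (\<sigma> a)" using R a by (simp add: normal_star_rep_def)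
      then obtain C where "\<And>u. u \<in> carr K \<Longrightarrow> vnorm K (\<sigma> a u) \<le> C * vnorm K u"
        unfolding bounded_op_def by blast
      then have C: "\<exists>C. \<forall>u\<in>carr H. vnorm H (\<rho> a u) \<le> C * vnorm H u"
        using a by (intro exI[of _ C]) (simp add: nrm r' Uc)
      show ?thesis
        unfolding bounded_op_def
        by (insert b[unfolded bounded_op_def] a C) (intro conjI ballI allI; (rule inj)?; simp add: c r')
    qed
    have one: "\<rho> (cls_one \<mu>) u = u" if "u \<in> carr H" for u
      by (rule inj) (use R that in \<open>auto simp: r' Uc normal_star_rep_def\<close>)
    have alg: "\<rho> (cls_add \<mu> a b) u = vadd H (\<rho> a u) (\<rho> b u)" "\<rho> (mul a b) u = \<rho> a (\<rho> b u)"
       "\<rho> (cls_scale \<mu> z a) u = vscale H z (\<rho> a u)"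
      if "u \<in> carr H" "a \<in> Linf \<mu>" "b \<in> Linf \<mu>" for a b u z
      by (insert R that, unfold normal_star_rep_def, (rule inj; simp add: r' c m)+)
    have star: "vip H (\<rho> a u) v = vip H u (\<rho> (cls_star \<mu> a) v)" if "a \<in> Linf \<mu>" "u \<in> carr H" "v \<in> carr H" for a u v
      using R that by (auto simp: ip r' Uc normal_star_rep_def)
    \<comment> \<open>The functional given by \<xi> and \<eta> on \<open>H\<close> is the one given
      by their images on \<open>K\<close>, so the same density \<open>h\<close> works.\<close>
    have normal: "\<exists>h. integrable \<mu> h \<and>
           (\<forall>a\<in>Linf \<mu>. (\<lambda>n. vip H (\<xi> n) (\<rho> a (\<eta> n))) sums (\<integral>x. ae_rep a x * h x \<partial>\<mu>))"
      if "\<forall>n. \<xi> n \<in> carr H \<and> \<eta> n \<in> carr H"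
        "summable (\<lambda>n. (vnorm H (\<xi> n))\<^sup>2)" "summable (\<lambda>n. (vnorm H (\<eta> n))\<^sup>2)" for \<xi> \<eta> :: "nat \<Rightarrow> 'v"
    proof -
      have "\<exists>h. integrable \<mu> h \<and>
           (\<forall>a\<in>Linf \<mu>. (\<lambda>n. vip K (U (\<xi> n)) (\<sigma> a (U (\<eta> n)))) sums (\<integral>x. ae_rep a x * h x \<partial>\<mu>))"
        using R[unfolded normal_star_rep_def, THEN conjunct2, THEN conjunct2, THEN conjunct2, THEN conjunct2,
          THEN conjunct2, THEN conjunct2, rule_format, of "\<lambda>n. U (\<xi> n)" "\<lambda>n. U (\<eta> n)"] that
        by (simp add: nrm Uc)
      then show ?thesis using that by (simp add: ip r')
    qed
    show ?thesis
      unfolding normal_star_rep_def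
      by (intro conjI ballI allI impI; (elim conjE)?; (rule bop one alg star normal)?; (assumption | simp))
  qed
  have "normal_star_rep \<mu> (cls_mult \<mu>) H (lact H)"
    using K by (intro rep[of _ "lact K"]) (auto simp: wstar_bimodule_def la)
  moreover have "normal_star_rep \<mu> (\<lambda>a b. cls_mult \<mu> b a) H (\<lambda>a u. ract H u a)"
    using K by (intro rep[of _ "\<lambda>a u. ract K u a"]) (auto simp: wstar_bimodule_def ra)
  moreover have "ract H (lact H a u) b = lact H a (ract H u b)" if "a \<in> Linf \<mu>" "b \<in> Linf \<mu>" "u \<in> carr H" for a b u
    by (rule inj) (use K that in \<open>auto simp: wstar_bimodule_def la ra Uc\<close>)
  ultimately have "wstar_bimodule \<mu> H"
    by (simp add: wstar_bimodule_def)
  moreover have "bounded_op H K U"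
    unfolding bounded_op_def by (auto simp: c nrm intro!: exI[of _ 1])
  ultimately show ?thesis
    unfolding bimodule_iso_def using K bij ip la ra by auto
qed

text \<open>\<open>B\<close> is the Gram kernel of the vectors \<open>J e\<close>, so the seminorm
  of a formal sum is the norm of its value in \<open>K\<close>. A Cauchy sequence of sums then has a
  limit in \<open>K\<close>, two such sequences differ by a null sequence exactly when their limits
  agree, and totality of the \<open>J e\<close> makes every vector of \<open>K\<close> a
  limit.\<close>

lemma sep_completion_iso:
  fixes K :: "(('a \<Rightarrow> complex) set, 'w) bimodule" and J :: "'b gen \<Rightarrow> 'w"
  assumes K: "wstar_bimodule \<mu> K"
    and J: "\<And>e. e \<in> D \<Longrightarrow> J e \<in> carr K"
    and B: "\<And>e f. e \<in> D \<Longrightarrow> f \<in> D \<Longrightarrow> B e f = vip K (J e) (J f)"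
    and dense: "\<And>v \<epsilon>. v \<in> carr K \<Longrightarrow> \<epsilon> > 0 \<Longrightarrow> \<exists>xs. snd ` set xs \<subseteq> D \<and> vdist K (lincomb K J xs) v < \<epsilon>"
    and l: "\<And>a e. a \<in> Linf \<mu> \<Longrightarrow> e \<in> D \<Longrightarrow> l a e \<in> D \<and> J (l a e) = lact K a (J e)"
    and r: "\<And>a e. a \<in> Linf \<mu> \<Longrightarrow> e \<in> D \<Longrightarrow> r e a \<in> D \<and> J (r e a) = ract K (J e) a"
  shows "bimodule_iso \<mu> (sep_completion D B l r) K"
proof -
  interpret K: hilbert K by unfold_locales (use K in \<open>simp add: wstar_bimodule_def\<close>)
  define ok :: "'b fsum \<Rightarrow> bool" where "ok xs \<longleftrightarrow> snd ` set xs \<subseteq> D" for xs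
  define L where "L = lincomb K J"
  define lm where "lm X = (THE w. K.vlim (\<lambda>n. L (X n)) w)" for X :: "nat \<Rightarrow> 'b fsum"
  let ?H = "sep_completion D B l r"
  define U where "U u = lm (the_seq u)" for u
  have L_in: "L xs \<in> carr K" if "ok xs" for xs
    using that by (simp add: L_def ok_def K.lincomb_closed[OF J])
  have L_app: "L (xs @ ys) = vadd K (L xs) (L ys)" if "ok xs" "ok ys" for xs ys
    using that by (simp add: L_def ok_def K.lincomb_append[OF J])
  have L_scale: "L (fscale a xs) = vscale K a (L xs)" if "ok xs" for a xs
    using that by (simp add: L_def ok_def fscale_def K.lincomb_scale[OF J])
  have ok_app: "ok (xs @ ys)" if "ok xs" "ok ys" for xs ys
    using that by (auto simp: ok_def)
  have ok_scale: "ok (fscale a xs)" if "ok xs" for a xs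
    using that by (force simp: ok_def fscale_def)
  have form: "fform B xs ys = vip K (L xs) (L ys)" if "ok xs" "ok ys" for xs ys
  proof -
    have "fform B xs ys = (\<Sum>(z, e)\<leftarrow>xs. \<Sum>(w, f)\<leftarrow>ys. cnj z * w * vip K (J e) (J f))"
      unfolding fform_def using that B
      by (intro arg_cong[where f = sum_list] map_cong refl) (force simp: ok_def intro!: arg_cong[where f = sum_list])
    then show ?thesis
      using that by (simp add: L_def ok_def K.ip_lincomb[OF J])
  qed
  have dist: "fdist B xs ys = vdist K (L xs) (L ys)" if "ok xs" "ok ys" for xs ys
    using that by (simp add: fdist_def Let_def form ok_app ok_scale L_app L_scale vdist_def vnorm_def)
  have fc: "X \<in> fcauchy D B \<longleftrightarrow> (\<forall>n. ok (X n)) \<and> (\<exists>w. K.vlim (\<lambda>n. L (X n)) w)" for X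
  proof
    assume "X \<in> fcauchy D B"
    then have *: "\<forall>n. ok (X n)" "\<forall>e>0. \<exists>N. \<forall>m\<ge>N. \<forall>n\<ge>N. fdist B (X m) (X n) < e"
      by (auto simp: fcauchy_def ok_def)
    have "\<exists>w. K.vlim (\<lambda>n. L (X n)) w"
      by (rule K.Cauchy_vlim) (use * in \<open>simp_all add: dist L_in\<close>)
    then show "(\<forall>n. ok (X n)) \<and> (\<exists>w. K.vlim (\<lambda>n. L (X n)) w)"
      using * by simp
  next
    assume "(\<forall>n. ok (X n)) \<and> (\<exists>w. K.vlim (\<lambda>n. L (X n)) w)"
    then show "X \<in> fcauchy D B"
      using K.vlim_Cauchy[of "\<lambda>n. L (X n)"] by (auto simp: fcauchy_def ok_def[symmetric] dist)
  qed
  have lm_eq: "lm X = w" if "K.vlim (\<lambda>n. L (X n)) w" for X w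
    unfolding lm_def using that K.vlim_unique by blast
  have lmI: "K.vlim (\<lambda>n. L (X n)) (lm X)" if "X \<in> fcauchy D B" for X
    using that lm_eq by (auto simp: fc)
  have null: "(\<lambda>n. fdist B (X n) (Y n)) \<longlonglongrightarrow> 0 \<longleftrightarrow> lm Y = lm X"
    if X: "X \<in> fcauchy D B" and Y: "Y \<in> fcauchy D B" for X Y
  proof -
    have "(\<lambda>n. fdist B (X n) (Y n)) \<longlonglongrightarrow> vdist K (lm X) (lm Y)"
      using K.vlim_dist_0[OF lmI[OF X] lmI[OF Y]] X Y by (simp add: fc dist)
    then have "(\<lambda>n. fdist B (X n) (Y n)) \<longlonglongrightarrow> 0 \<longleftrightarrow> vdist K (lm X) (lm Y) = 0"
      using LIMSEQ_unique by metis
    also have "\<dots> \<longleftrightarrow> lm Y = lm X"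
      using K.dist_eq_0[of "lm X" "lm Y"] lmI[OF X] lmI[OF Y] by (auto simp: K.vlim_def)
    finally show ?thesis .
  qed
  \<comment> \<open>The predicate under \<open>SOME\<close> depends on \<open>X\<close> only through
    \<open>lm X\<close>. Sequences with equal limits thus get literally the same representative,
    which makes \<open>U\<close> injective.\<close>
  have cls: "fclass D B X = Lim (SOME Y. Y \<in> fcauchy D B \<and> lm Y = lm X)" if "X \<in> fcauchy D B" for X
    unfolding fclass_def using null[OF that] by (metis (no_types, lifting))
  have cls': "the_seq (fclass D B X) \<in> fcauchy D B \<and> lm (the_seq (fclass D B X)) = lm X"
    if "X \<in> fcauchy D B" for X
    unfolding cls[OF that] tvec.sel by (rule someI[of _ X]) (use that in simp)
  have carr: "carr ?H = fclass D B ` fcauchy D B"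
    by (simp add: sep_completion_def)
  \<comment> \<open>All operations of the completion apply \<open>fclass\<close> to a sequence
    formed termwise; this computes the image of such a class from the limit of the terms.\<close>
  have G: "fclass D B X \<in> carr ?H \<and> U (fclass D B X) = w"
    if "\<And>n. ok (X n)" "K.vlim (\<lambda>n. L (X n)) w" for X w
  proof -
    have "X \<in> fcauchy D B" using that by (auto simp: fc)
    then show ?thesis using cls' lm_eq[OF that(2)] by (auto simp: carr U_def)
  qed
  have S: "ok (the_seq u n)" "K.vlim (\<lambda>n. L (the_seq u n)) (U u)" "the_seq u \<in> fcauchy D B"
      "fclass D B (the_seq u) = u"
    if "u \<in> carr ?H" for u n
  proof -
    obtain X where X: "X \<in> fcauchy D B" and u: "u = fclass D B X"
      using \<open>u \<in> carr ?H\<close> carr by auto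
    show 1: "the_seq u \<in> fcauchy D B"
      using cls'[OF X] u by simp
    then show "ok (the_seq u n)" "K.vlim (\<lambda>n. L (the_seq u n)) (U u)"
      using lmI by (auto simp: fc U_def)
    show "fclass D B (the_seq u) = u"
      using cls[OF 1] cls[OF X] cls'[OF X] u by simp
  qed
  have U_in: "U u \<in> carr K" if "u \<in> carr ?H" for u
    using S(2)[OF that] by (simp add: K.vlim_def)
  have act: "fclass D B (\<lambda>n. fmap \<phi> (the_seq u n)) \<in> carr ?H \<and>
      U (fclass D B (\<lambda>n. fmap \<phi> (the_seq u n))) = A (U u)"
    if u: "u \<in> carr ?H" and A: "bounded_op K K A" and \<phi>: "\<And>e. e \<in> D \<Longrightarrow> \<phi> e \<in> D \<and> J (\<phi> e) = A (J e)" for \<phi> A u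
  proof (rule G)
    show "ok (fmap \<phi> (the_seq u n))" for n
      using S(1)[OF u, of n] \<phi> by (force simp: ok_def fmap_def)
    have "L (fmap \<phi> xs) = A (L xs)" if "ok xs" for xs
      using that \<phi> A by (simp add: L_def ok_def fmap_def K.lincomb_bounded_op[OF J])
    then show "K.vlim (\<lambda>n. L (fmap \<phi> (the_seq u n))) (A (U u))"
      using bounded_op_vlim[OF K.hilbert_axioms K.hilbert_axioms A S(2)[OF u]] S(1)[OF u] by simp
  qed
  show ?thesis
  proof (rule wstar_bimodule_transfer[OF K, where U = U])
    show "bij_betw U (carr ?H) (carr K)"
      unfolding bij_betw_def
    proof (intro conjI inj_onI subset_antisym subsetI)
      fix u v assume "u \<in> carr ?H" "v \<in> carr ?H" "U u = U v"
      then show "u = v"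
        using cls[OF S(3), of u] cls[OF S(3), of v] S(4)[of u] S(4)[of v] by (simp add: U_def)
    next
      fix w assume w: "w \<in> carr K"
      \<comment> \<open>Approximation within 1/(n+1) at stage \<open>n\<close> produces a sequence
        of sums converging to \<open>w\<close>, hence a preimage of \<open>w\<close>.\<close>
      have "\<exists>xs. ok xs \<and> vdist K (L xs) w < inverse (real (Suc n))" for n
        using dense[OF w, of "inverse (real (Suc n))"] by (simp add: ok_def L_def)
      then obtain X where X: "\<And>n. ok (X n)" "\<And>n. vdist K (L (X n)) w < inverse (real (Suc n))"
        by metis
      have "K.vlim (\<lambda>n. L (X n)) w"
        unfolding K.vlim_def
        using K.tendsto_0_squeeze[OF _ _ LIMSEQ_inverse_real_of_nat, of "\<lambda>n. vdist K (L (X n)) w"]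
          X(2) less_imp_le w L_in[OF X(1)] by auto
      then show "w \<in> U ` carr ?H"
        using G[of X w] X(1) by auto
    qed (use U_in in auto)
    show "vzero ?H \<in> carr ?H" "U (vzero ?H) = vzero K"
      using G[of "\<lambda>_. []" "vzero K"] K.vlim_const[of "vzero K"]
      by (simp_all add: sep_completion_def ok_def L_def)
    show "vadd ?H u v \<in> carr ?H \<and> U (vadd ?H u v) = vadd K (U u) (U v)"
      if u: "u \<in> carr ?H" and v: "v \<in> carr ?H" for u v
      using G[of "\<lambda>n. the_seq u n @ the_seq v n" "vadd K (U u) (U v)"] K.vlim_add[OF S(2)[OF u] S(2)[OF v]]
        S(1)[OF u] S(1)[OF v] by (simp add: sep_completion_def ok_app L_app)
    show "vscale ?H a u \<in> carr ?H \<and> U (vscale ?H a u) = vscale K a (U u)"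
      if u: "u \<in> carr ?H" for a u
      using G[of "\<lambda>n. fscale a (the_seq u n)" "vscale K a (U u)"] K.vlim_scale[OF S(2)[OF u]]
        S(1)[OF u] by (simp add: sep_completion_def ok_scale L_scale)
    show "vip ?H u v = vip K (U u) (U v)" if u: "u \<in> carr ?H" and v: "v \<in> carr ?H" for u v
      using limI[OF K.vlim_ip[OF S(2)[OF u] S(2)[OF v]]] S(1)[OF u] S(1)[OF v]
      by (simp add: sep_completion_def form)
    show "lact ?H a u \<in> carr ?H \<and> U (lact ?H a u) = lact K a (U u)"
      if "a \<in> Linf \<mu>" and u: "u \<in> carr ?H" for a u
      using act[OF u, of "lact K a" "l a"] K l that
      by (simp add: sep_completion_def wstar_bimodule_def normal_star_rep_def)
    show "ract ?H u a \<in> carr ?H \<and> U (ract ?H u a) = ract K (U u) a"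
      if "a \<in> Linf \<mu>" and u: "u \<in> carr ?H" for a u
      using act[OF u, of "\<lambda>u. ract K u a" "\<lambda>e. r e a"] K r that
      by (simp add: sep_completion_def wstar_bimodule_def normal_star_rep_def)
  qed
qed

section \<open>Square integrable functions\<close>

definition sq_int :: "'x measure \<Rightarrow> ('x \<Rightarrow> complex) \<Rightarrow> bool" where
  "sq_int N f \<longleftrightarrow> f \<in> borel_measurable N \<and> integrable N (\<lambda>x. (cmod (f x))\<^sup>2)"

lemma sq_intI: "f \<in> borel_measurable N \<Longrightarrow> (\<integral>\<^sup>+x. ennreal ((cmod (f x))\<^sup>2) \<partial>N) < \<infinity> \<Longrightarrow> sq_int N f"
  unfolding sq_int_def by (auto intro!: integrableI_bounded)

lemma sq_intI': "f \<in> borel_measurable N \<Longrightarrow> integrable N (\<lambda>x. (cmod (f x))\<^sup>2) \<Longrightarrow> sq_int N f"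
  by (simp add: sq_int_def)

lemma sq_int_measurable [measurable_dest, simp]: "sq_int N f \<Longrightarrow> f \<in> borel_measurable N"
  by (simp add: sq_int_def)

lemma sq_int_integrable [simp]: "sq_int N f \<Longrightarrow> integrable N (\<lambda>x. (cmod (f x))\<^sup>2)"
  unfolding sq_int_def by blast

lemma nn_integral_sq_int: "sq_int N f \<Longrightarrow> (\<integral>\<^sup>+x. ennreal ((cmod (f x))\<^sup>2) \<partial>N) = ennreal (\<integral>x. (cmod (f x))\<^sup>2 \<partial>N)"
  by (intro nn_integral_eq_integral) auto

lemma sq_int_cong_AE: "sq_int N f \<Longrightarrow> g \<in> borel_measurable N \<Longrightarrow> AE x in N. g x = f x \<Longrightarrow> sq_int N g"
  by (rule sq_intI') (auto intro: integrable_cong_AE_imp[of N "\<lambda>x. (cmod (f x))\<^sup>2"])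

lemma mult_le_sum_squares: "a * b \<le> a\<^sup>2 + (b::real)\<^sup>2"
  using sum_squares_bound[of a b] zero_le_power2[of a] zero_le_power2[of b] zero_le_square[of "a+b"]
  by (simp add: power2_eq_square algebra_simps)

lemma sq_int_mult:
  assumes "sq_int N f" "sq_int N g"
  shows "integrable N (\<lambda>x. cnj (f x) * g x)"
proof (rule Bochner_Integration.integrable_bound[where f = "\<lambda>x. (cmod (f x))\<^sup>2 + (cmod (g x))\<^sup>2"])
  have [measurable]: "f \<in> borel_measurable N" "g \<in> borel_measurable N"
    using assms by simp_all
  show "(\<lambda>x. cnj (f x) * g x) \<in> borel_measurable N" by measurable
qed (use assms mult_le_sum_squares in \<open>auto simp: norm_mult\<close>)

lemma sq_int_add:
  assumes "sq_int N f" "sq_int N g"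
  shows "sq_int N (\<lambda>x. f x + g x)"
proof -
  have "(cmod (f x + g x))\<^sup>2 \<le> 2 * (cmod (f x))\<^sup>2 + 2 * (cmod (g x))\<^sup>2" for x
  proof -
    have "(cmod (f x + g x))\<^sup>2 \<le> (cmod (f x) + cmod (g x))\<^sup>2"
      by (intro power_mono norm_triangle_ineq) auto
    also have "\<dots> \<le> 2 * (cmod (f x))\<^sup>2 + 2 * (cmod (g x))\<^sup>2"
      using sum_squares_bound[of "cmod (f x)" "cmod (g x)"] by (simp add: power2_sum)
    finally show ?thesis .
  qed
  note le = this
  have [measurable]: "f \<in> borel_measurable N" "g \<in> borel_measurable N"
    using assms by simp_all
  have "integrable N (\<lambda>x. (cmod (f x + g x))\<^sup>2)"
    by (rule Bochner_Integration.integrable_bound[of N "\<lambda>x. 2 * (cmod (f x))\<^sup>2 + 2 * (cmod (g x))\<^sup>2"])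
      (use assms le in simp_all)
  then show ?thesis by (intro sq_intI') measurable
qed

lemma sq_int_scale: "sq_int N f \<Longrightarrow> sq_int N (\<lambda>x. a * f x)"
  by (rule sq_intI') (auto simp: norm_mult power_mult_distrib)

lemma sq_int_diff: "sq_int N f \<Longrightarrow> sq_int N g \<Longrightarrow> sq_int N (\<lambda>x. f x - g x)"
  using sq_int_add[of N f "\<lambda>x. - 1 * g x"] sq_int_scale[of N g "- 1"] by simp

lemma sq_int_bounded_mult:
  assumes "sq_int N f" and [measurable]: "h \<in> borel_measurable N" and h: "AE x in N. cmod (h x) \<le> C"
  shows "sq_int N (\<lambda>x. h x * f x)"

proof (rule sq_intI')
  have [measurable]: "f \<in> borel_measurable N" using assms(1) by simp
  show "(\<lambda>x. h x * f x) \<in> borel_measurable N" by measurable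
  show "integrable N (\<lambda>x. (cmod (h x * f x))\<^sup>2)"
  proof (rule Bochner_Integration.integrable_bound[where f = "\<lambda>x. C\<^sup>2 * (cmod (f x))\<^sup>2"])
    show "AE x in N. norm ((cmod (h x * f x))\<^sup>2) \<le> norm (C\<^sup>2 * (cmod (f x))\<^sup>2)"
      using h by eventually_elim (simp add: norm_mult power_mult_distrib mult_right_mono power_mono)
  qed (use assms(1) in auto)
qed

lemma sq_int_zero [simp]: "sq_int N (\<lambda>_. 0)"
  by (rule sq_intI') auto

lemma (in finite_measure) sq_int_const [simp]: "sq_int M (\<lambda>_. c)"
  by (rule sq_intI') auto

lemma (in finite_measure) sq_int_bounded:
  "f \<in> borel_measurable M \<Longrightarrow> AE x in M. cmod (f x) \<le> C \<Longrightarrow> sq_int M f"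
  using sq_int_bounded_mult[of M "\<lambda>_. 1" f C] by simp

section \<open>Square integrable classes as an inner product space\<close>

lemma L2_carr: "A \<in> carr (L2 N) \<longleftrightarrow> (\<exists>f. sq_int N f \<and> A = ae_class N f)"
  by (auto simp: L2_def intro: sq_intI')

lemma L2_class [simp, intro]: "sq_int N f \<Longrightarrow> ae_class N f \<in> carr (L2 N)"
  by (auto simp: L2_carr)

lemma L2E:
  assumes "A \<in> carr (L2 N)"
  obtains f where "sq_int N f" "A = ae_class N f"
  using assms by (auto simp: L2_carr)

lemma L2_rep:
  assumes "A \<in> carr (L2 N)"
  shows "sq_int N (ae_rep A)" "ae_class N (ae_rep A) = A"
proof -
  obtain f where f: "sq_int N f" "A = ae_class N f"
    using assms by (rule L2E)
  show "sq_int N (ae_rep A)"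
    using f AE_ae_rep[of f N] by (auto intro: sq_int_cong_AE)
  show "ae_class N (ae_rep A) = A"
    using f by (simp add: ae_class_ae_rep)
qed

lemma L2_simps [simp]:
  "vzero (L2 N) = ae_class N (\<lambda>_. 0)" "vadd (L2 N) = cls_add N" "vscale (L2 N) = cls_scale N"
  by (simp_all add: L2_def)

lemma L2_ip:
  assumes [measurable]: "f \<in> borel_measurable N" "g \<in> borel_measurable N"
  shows "vip (L2 N) (ae_class N f) (ae_class N g) = (\<integral>x. cnj (f x) * g x \<partial>N)"
proof -
  have "AE x in N. cnj (ae_rep (ae_class N f) x) * ae_rep (ae_class N g) x = cnj (f x) * g x"
    using AE_ae_rep[OF assms(1)] AE_ae_rep[OF assms(2)] by eventually_elim simp
  then show ?thesis
    unfolding L2_def cspace.simps by (rule integral_cong_AE[rotated 2]) measurable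
qed

lemma L2_norm: "f \<in> borel_measurable N \<Longrightarrow> vnorm (L2 N) (ae_class N f) = sqrt (\<integral>x. (cmod (f x))\<^sup>2 \<partial>N)"
  by (simp add: vnorm_def L2_ip complex_norm_square[symmetric] mult.commute[of "cnj _"] del: of_real_power)

lemma L2_dist:
  "f \<in> borel_measurable N \<Longrightarrow> g \<in> borel_measurable N \<Longrightarrow>
    vdist (L2 N) (ae_class N f) (ae_class N g) = sqrt (\<integral>x. (cmod (f x - g x))\<^sup>2 \<partial>N)"
  by (simp add: vdist_def cls_scale_class cls_add_class L2_norm)

section \<open>Completeness of the space of square integrable classes\<close>

lemma (in prob_space) integral_le_sqrt_integral_square:
  assumes "sq_int M f"
  shows "(\<integral>x. cmod (f x) \<partial>M) \<le> sqrt (\<integral>x. (cmod (f x))\<^sup>2 \<partial>M)" "integrable M (\<lambda>x. cmod (f x))"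
proof -
  have [measurable]: "f \<in> borel_measurable M" using assms by simp
  have one: "sq_int M (\<lambda>x. 1)" by simp
  show i: "integrable M (\<lambda>x. cmod (f x))"
    using sq_int_mult[OF one assms] by (simp add: integrable_norm)
  define E where "E = (\<integral>x. cmod (f x) \<partial>M)"
  \<comment> \<open>\<open>E\<close> is the mean, so this is the nonnegativity of the variance of
    \<open>cmod (f x)\<close>.\<close>
  have "0 \<le> (\<integral>x. (cmod (f x) - E)\<^sup>2 \<partial>M)" by simp
  also have "\<dots> = (\<integral>x. (cmod (f x))\<^sup>2 - 2 * E * cmod (f x) + E\<^sup>2 \<partial>M)"
    by (intro Bochner_Integration.integral_cong) (auto simp: power2_diff algebra_simps)
  also have "\<dots> = (\<integral>x. (cmod (f x))\<^sup>2 \<partial>M) - 2 * E * E + E\<^sup>2"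
    using i assms by (simp add: E_def prob_space)
  finally have "E\<^sup>2 \<le> (\<integral>x. (cmod (f x))\<^sup>2 \<partial>M)" by (simp add: power2_eq_square)
  then show "(\<integral>x. cmod (f x) \<partial>M) \<le> sqrt (\<integral>x. (cmod (f x))\<^sup>2 \<partial>M)"
    unfolding E_def[symmetric] by (simp add: real_le_rsqrt)
qed

text \<open>Interchanging sum and integral shows that the sum of the norms has finite integral, and
  such a sum is finite almost everywhere.\<close>

lemma AE_summable:
  fixes f :: "nat \<Rightarrow> 'x \<Rightarrow> 'b::{banach, second_countable_topology}"
  assumes f: "\<And>i. integrable N (f i)" and s: "summable (\<lambda>i. \<integral>x. norm (f i x) \<partial>N)"
  shows "AE x in N. summable (\<lambda>i. norm (f i x))"
proof -
  have [measurable]: "f i \<in> borel_measurable N" for i using f by auto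
  have "(\<integral>\<^sup>+x. (\<Sum>i. ennreal (norm (f i x))) \<partial>N) = (\<Sum>i. ennreal (\<integral>x. norm (f i x) \<partial>N))"
    using f by (simp add: nn_integral_suminf nn_integral_eq_integral)
  also have "\<dots> \<noteq> \<infinity>"
    using s by (subst suminf_ennreal2) auto
  finally have "AE x in N. (\<Sum>i. ennreal (norm (f i x))) \<noteq> \<infinity>"
    by (intro nn_integral_PInf_AE) auto
  then show ?thesis
    by eventually_elim (auto intro: summable_suminf_not_top)
qed

text \<open>The Riesz-Fischer argument: along a subsequence the increments are summable in mean, so
  it converges almost everywhere, and Fatou's lemma passes the Cauchy estimate on to the limit
  function.\<close>

theorem (in prob_space) L2_complete:
  assumes f: "\<And>n. sq_int M (f n)"
    and Cauchy: "\<And>e. e > 0 \<Longrightarrow> \<exists>N. \<forall>m\<ge>N. \<forall>n\<ge>N. (\<integral>x. (cmod (f m x - f n x))\<^sup>2 \<partial>M) < e\<^sup>2"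
  shows "\<exists>h. sq_int M h \<and> (\<lambda>n. \<integral>x. (cmod (f n x - h x))\<^sup>2 \<partial>M) \<longlonglongrightarrow> 0"
proof -
  have [measurable]: "f n \<in> borel_measurable M" for n using f by simp
  obtain R where R: "\<And>k m n. m \<ge> R k \<Longrightarrow> n \<ge> R k \<Longrightarrow> (\<integral>x. (cmod (f m x - f n x))\<^sup>2 \<partial>M) < ((1/2)^k)\<^sup>2"
    using Cauchy[of "(1/2)^k" for k] by (metis zero_less_power half_gt_zero_iff zero_less_one)
  \<comment> \<open>The partial sum up to \<open>k\<close> is at least every \<open>R j\<close> with
    \<open>j \<le> k\<close>, so this index lies past all earlier thresholds at once.\<close>
  define r where "r k = (\<Sum>i\<le>k. R i)" for k
  have r: "R k \<le> r k" for k by (simp add: r_def member_le_sum)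
  have r': "R k \<le> r j" if "k \<le> j" for k j
    using that by (auto simp: r_def intro!: member_le_sum)
  define g where "g k = f (r k)" for k
  have g [measurable]: "g k \<in> borel_measurable M" for k by (simp add: g_def)
  define d where "d k x = g (Suc k) x - g k x" for k x
  have d: "sq_int M (d k)" for k
    unfolding d_def g_def by (intro sq_int_diff f)
  have "(\<integral>x. norm (d k x) \<partial>M) \<le> (1/2)^k" for k
  proof -
    have "(\<integral>x. norm (d k x) \<partial>M) \<le> sqrt (\<integral>x. (cmod (d k x))\<^sup>2 \<partial>M)"
      by (rule integral_le_sqrt_integral_square[OF d])
    also have "\<dots> \<le> sqrt (((1/2)^k)\<^sup>2)"
      using R[of k "r (Suc k)" "r k"] r'[of k "Suc k"] r[of k]
      by (intro real_sqrt_le_mono) (simp add: d_def g_def)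
    finally show ?thesis by simp
  qed
  then have "summable (\<lambda>k. \<integral>x. norm (d k x) \<partial>M)"
    by (intro summable_comparison_test'[OF summable_geometric[of "1/2::real"], of 0]) auto
  moreover have "integrable M (d k)" for k
    using integral_le_sqrt_integral_square(2)[OF d[of k]] d[of k] by (simp add: integrable_norm_iff)
  ultimately have "AE x in M. summable (\<lambda>k. norm (d k x))"
    by (rule AE_summable[rotated])
  then have conv: "AE x in M. convergent (\<lambda>k. g k x)"
  proof eventually_elim
    case (elim x)
    then have "summable (\<lambda>k. d k x)" by (rule summable_norm_cancel)
    then have "convergent (\<lambda>n. g 0 x + (\<Sum>k<n. d k x))"
      by (intro convergent_add convergent_const) (simp add: summable_iff_convergent)
    moreover have "g 0 x + (\<Sum>k<n. d k x) = g n x" for n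
      using sum_lessThan_telescope[of "\<lambda>k. g k x" n] by (simp add: d_def)
    ultimately show ?case by simp
  qed
  \<comment> \<open>Where the subsequence diverges \<open>lim\<close> is an arbitrary value, which
    affects only a null set.\<close>
  define h where "h x = lim (\<lambda>k. g k x)" for x
  have [measurable]: "h \<in> borel_measurable M" unfolding h_def by measurable
  have lim: "AE x in M. (\<lambda>k. g k x) \<longlonglongrightarrow> h x"
    using conv by eventually_elim (simp add: h_def convergent_LIMSEQ_iff)
  have bound: "(\<integral>\<^sup>+x. ennreal ((cmod (f m x - h x))\<^sup>2) \<partial>M) \<le> ennreal (((1/2)^k)\<^sup>2)" if "m \<ge> R k" for m k
  proof -
    have "(\<integral>\<^sup>+x. ennreal ((cmod (f m x - h x))\<^sup>2) \<partial>M) \<le>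
        (\<integral>\<^sup>+x. liminf (\<lambda>j. ennreal ((cmod (f m x - g j x))\<^sup>2)) \<partial>M)"
    proof (rule nn_integral_mono_AE)
      show "AE x in M. ennreal ((cmod (f m x - h x))\<^sup>2) \<le> liminf (\<lambda>j. ennreal ((cmod (f m x - g j x))\<^sup>2))"
        using lim
      proof eventually_elim
        case (elim x)
        then have "(\<lambda>j. ennreal ((cmod (f m x - g j x))\<^sup>2)) \<longlonglongrightarrow> ennreal ((cmod (f m x - h x))\<^sup>2)"
          by (intro tendsto_intros tendsto_ennrealI)
        from lim_imp_Liminf[OF _ this] show ?case by simp
      qed
    qed
    also have "\<dots> \<le> liminf (\<lambda>j. \<integral>\<^sup>+x. ennreal ((cmod (f m x - g j x))\<^sup>2) \<partial>M)"
      by (rule nn_integral_liminf) simp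
    also have "\<dots> \<le> liminf (\<lambda>j::nat. ennreal (((1/2)^k)\<^sup>2))"
    proof (rule Liminf_mono)
      have "(\<integral>\<^sup>+x. ennreal ((cmod (f m x - g j x))\<^sup>2) \<partial>M) \<le> ennreal (((1/2)^k)\<^sup>2)" if "j \<ge> k" for j
        using R[OF \<open>m \<ge> R k\<close> r'[OF that]]
        by (subst nn_integral_sq_int[OF sq_int_diff]) (auto simp: g_def f intro!: ennreal_leI)
      then show "\<forall>\<^sub>F j in sequentially. (\<integral>\<^sup>+x. ennreal ((cmod (f m x - g j x))\<^sup>2) \<partial>M) \<le> ennreal (((1/2)^k)\<^sup>2)"
        by (auto simp: eventually_sequentially)
    qed
    finally show ?thesis by (simp add: Liminf_const)
  qed
  \<comment> \<open>The Fatou bound makes \<open>f m - h\<close> square integrable for large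
    \<open>m\<close>, and then \<open>h = f m - (f m - h)\<close> is square integrable as
    well.\<close>
  have diff: "sq_int M (\<lambda>x. f m x - h x)" if "m \<ge> R 0" for m
    using bound[OF that] by (intro sq_intI) (auto simp: le_less_trans)
  have h: "sq_int M h"
    using sq_int_diff[OF f[of "R 0"] diff[of "R 0"]] by simp
  have "(\<lambda>n. \<integral>x. (cmod (f n x - h x))\<^sup>2 \<partial>M) \<longlonglongrightarrow> 0"
  proof (rule LIMSEQ_I)
    fix e :: real assume "e > 0"
    then obtain k where k: "(1/2)^k < min e 1"
      using real_arch_pow_inv[of "min e 1" "1/2"] by auto
    have "norm ((\<integral>x. (cmod (f m x - h x))\<^sup>2 \<partial>M) - 0) < e" if m: "m \<ge> R k" for m
    proof -
      have "(\<integral>x. (cmod (f m x - h x))\<^sup>2 \<partial>M) \<le> ((1/2)^k)\<^sup>2"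
        using bound[OF m] nn_integral_sq_int[OF sq_int_diff[OF f[of m] h]] by simp
      also have "\<dots> \<le> (1/2)^k"
        using power_decreasing[of k "2 * k" "1/2::real"] by (simp add: power_mult[symmetric] mult.commute)
      also have "\<dots> < e" using k by simp
      finally show ?thesis by simp
    qed
    then show "\<exists>N. \<forall>n\<ge>N. norm ((\<integral>x. (cmod (f n x - h x))\<^sup>2 \<partial>M) - 0) < e" by blast
  qed
  then show ?thesis using h by blast
qed

theorem (in prob_space) hilbert_space_L2: "hilbert_space (L2 M)"
proof -
  note cl = cls_add_class cls_scale_class L2_ip sq_int_add sq_int_scale
  have ip_cnj: "(\<integral>x. cnj (g x) * f x \<partial>M) = cnj (\<integral>x. cnj (f x) * g x \<partial>M)" for f g
  proof -
    have "(\<integral>x. cnj (g x) * f x \<partial>M) = (\<integral>x. cnj (cnj (f x) * g x) \<partial>M)" by (simp add: mult.commute)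
    then show ?thesis by (simp only: Bochner_Integration.integral_cnj)
  qed
  have cvs: "complex_vector_space (L2 M)"
    unfolding complex_vector_space_def
    by (auto elim!: L2E simp: cl algebra_simps intro!: L2_class sq_int_add sq_int_scale)
  have add: "vip (L2 M) u (vadd (L2 M) v w) = vip (L2 M) u v + vip (L2 M) u w"
    if "u \<in> carr (L2 M)" "v \<in> carr (L2 M)" "w \<in> carr (L2 M)" for u v w
    using that
    by (auto elim!: L2E simp: cl distrib_left intro!: Bochner_Integration.integral_add sq_int_mult)
  have scale: "vip (L2 M) u (vscale (L2 M) a v) = a * vip (L2 M) u v"
    if "u \<in> carr (L2 M)" "v \<in> carr (L2 M)" for u v a
    using that by (auto elim!: L2E simp: cl mult.left_commute)
  have sym: "vip (L2 M) v u = cnj (vip (L2 M) u v)"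
    if "u \<in> carr (L2 M)" "v \<in> carr (L2 M)" for u v
    using that
    by (elim L2E) (simp add: cl, rule ip_cnj)
  have pos: "0 \<le> Re (vip (L2 M) u u)" if "u \<in> carr (L2 M)" for u
    using that by (auto elim!: L2E simp: cl complex_norm_square[symmetric] mult.commute[of "cnj _"] simp del: of_real_power)
  have definite: "u = vzero (L2 M)" if "u \<in> carr (L2 M)" "vip (L2 M) u u = 0" for u
  proof -
    obtain f where f: "sq_int M f" "u = ae_class M f" using \<open>u \<in> carr (L2 M)\<close> by (rule L2E)
    then have "(\<integral>x. (cmod (f x))\<^sup>2 \<partial>M) = 0"
      using that(2) by (simp add: cl complex_norm_square[symmetric] mult.commute[of "cnj _"] del: of_real_power)
    then have "AE x in M. f x = 0"
      using f by (subst (asm) integral_nonneg_eq_0_iff_AE) auto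
    then show ?thesis unfolding f(2) L2_simps by (rule ae_class_eqI)
  qed
  have compl: "\<exists>u\<in>carr (L2 M). (\<lambda>n::nat. vdist (L2 M) (X n) u) \<longlonglongrightarrow> 0"
    if X: "\<forall>n. X n \<in> carr (L2 M)" "\<forall>e>0. \<exists>N. \<forall>m\<ge>N. \<forall>n\<ge>N. vdist (L2 M) (X m) (X n) < e" for X
  proof -
    have "\<forall>n. \<exists>f. sq_int M f \<and> X n = ae_class M f" using X(1) by (simp add: L2_carr)
    then obtain f where f: "\<And>n. sq_int M (f n)" "\<And>n. X n = ae_class M (f n)" by metis
    have "\<exists>h. sq_int M h \<and> (\<lambda>n. \<integral>x. (cmod (f n x - h x))\<^sup>2 \<partial>M) \<longlonglongrightarrow> 0"
    proof (rule L2_complete[OF f(1)])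
      fix e :: real assume e: "e > 0"
      then obtain N where N: "\<And>m n. m \<ge> N \<Longrightarrow> n \<ge> N \<Longrightarrow> vdist (L2 M) (X m) (X n) < e"
        using X(2) by blast
      have "(\<integral>x. (cmod (f m x - f n x))\<^sup>2 \<partial>M) < e\<^sup>2" if "m \<ge> N" "n \<ge> N" for m n
        using N[OF that] e real_sqrt_less_iff[of "\<integral>x. (cmod (f m x - f n x))\<^sup>2 \<partial>M" "e\<^sup>2"]
        by (simp add: f L2_dist)
      then show "\<exists>N. \<forall>m\<ge>N. \<forall>n\<ge>N. (\<integral>x. (cmod (f m x - f n x))\<^sup>2 \<partial>M) < e\<^sup>2" by blast
    qed
    then obtain h where h: "sq_int M h" "(\<lambda>n. \<integral>x. (cmod (f n x - h x))\<^sup>2 \<partial>M) \<longlonglongrightarrow> 0" by blast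
    have "(\<lambda>n. vdist (L2 M) (X n) (ae_class M h)) \<longlonglongrightarrow> 0"
      using tendsto_real_sqrt[OF h(2)] h(1) by (simp add: f L2_dist)
    then show ?thesis using h(1) by blast
  qed
  show ?thesis
    unfolding hilbert_space_def
    by (intro conjI ballI allI impI; (elim conjE)?; (rule cvs add scale sym pos definite compl); assumption?)
qed

section \<open>Actions along measure preserving maps\<close>

lemma integrable_bounded_mult:
  fixes f h :: "'x \<Rightarrow> complex"
  assumes f: "integrable N f" and h [measurable]: "h \<in> borel_measurable N" and b: "AE x in N. cmod (h x) \<le> C"
  shows "integrable N (\<lambda>x. h x * f x)"
proof (rule Bochner_Integration.integrable_bound[where f = "\<lambda>x. C * f x"])
  have [measurable]: "f \<in> borel_measurable N" using f by simp
  show "(\<lambda>x. h x * f x) \<in> borel_measurable N" by measurable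
  show "AE x in N. norm (h x * f x) \<le> norm (complex_of_real C * f x)"
    using b by eventually_elim (simp add: norm_mult mult_right_mono)
qed (use f in simp)

text \<open>\<open>q\<close> will be a coordinate of a path space. Since null sets of \<mu> pull
  back to null sets of \<open>N\<close>, the function \<open>b (q x)\<close> is determined, up to a
  null set, by the class of \<open>b\<close>.\<close>

locale measure_preserving =
  N: prob_space N + prob_space \<mu> for N :: "'x measure" and \<mu> :: "'a measure" +
  fixes q :: "'x \<Rightarrow> 'a"
  assumes q [measurable]: "q \<in> measurable N \<mu>" and distr_q: "distr N \<mu> q = \<mu>"
begin

lemma AE_comp: "AE x in \<mu>. P x \<Longrightarrow> AE x in N. P (q x)"
  by (rule AE_distrD[OF q]) (simp only: distr_q)

text \<open>The image under \<open>q\<close> of the measure with density \<open>F\<close> is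
  absolutely continuous with respect to \<mu>, and \<open>h\<close> is its Radon-Nikodym density. In
  probabilistic terms, \<open>h (q x)\<close> is the conditional expectation of \<open>F\<close>
  given \<open>q\<close>.\<close>

lemma ex_pushforward_nonneg:
  fixes F :: "'x \<Rightarrow> real"
  assumes F: "integrable N F" and pos: "\<And>x. 0 \<le> F x"
  shows "\<exists>h. integrable \<mu> h \<and> (\<forall>b C. b \<in> borel_measurable \<mu> \<and> (\<forall>x. cmod (b x) \<le> C) \<longrightarrow>
    (\<integral>x. b (q x) * complex_of_real (F x) \<partial>N) = (\<integral>x. b x * complex_of_real (h x) \<partial>\<mu>))"
proof -
  have [measurable]: "F \<in> borel_measurable N" using F by simp
  define \<nu> where "\<nu> = distr (density N F) \<mu> q"
  have qD: "q \<in> measurable (density N F) \<mu>" by simp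
  have sets: "sets \<nu> = sets \<mu>" by (simp add: \<nu>_def)
  have "absolutely_continuous \<mu> \<nu>"
    unfolding absolutely_continuous_def
  proof
    fix A assume A: "A \<in> null_sets \<mu>"
    then have [measurable]: "A \<in> sets \<mu>" by auto
    have "AE x in N. q x \<notin> A"
      using AE_comp[OF AE_not_in[OF A]] .
    then have "AE x in density N F. q x \<notin> A"
      by (subst AE_density) auto
    then have "emeasure (density N F) (q -` A \<inter> space N) = 0"
      by (subst (asm) AE_iff_measurable[where N = "q -` A \<inter> space N"]) (auto intro: measurable_sets)
    then show "A \<in> null_sets \<nu>"
      using sets by (auto simp: null_sets_def \<nu>_def emeasure_distr)
  qed
  then obtain f where [measurable]: "f \<in> borel_measurable \<mu>" and f: "density \<mu> f = \<nu>"
    using Radon_Nikodym[OF _ sets] by blast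
  have space: "emeasure \<nu> (space \<mu>) < \<infinity>"
  proof -
    have "emeasure \<nu> (space \<mu>) = emeasure (density N F) (space N)"
      unfolding \<nu>_def by (subst emeasure_distr) (auto intro!: arg_cong[where f = "emeasure _"] measurable_space[OF q])
    also have "\<dots> = (\<integral>\<^sup>+x. ennreal (F x) \<partial>N)"
      by (subst emeasure_density) (auto intro!: nn_integral_cong)
    also have "\<dots> < \<infinity>" using F pos by (simp add: nn_integral_eq_integral)
    finally show ?thesis .
  qed
  have int_f: "(\<integral>\<^sup>+x. f x \<partial>\<mu>) < \<infinity>"
  proof -
    have "emeasure \<nu> (space \<mu>) = (\<integral>\<^sup>+x. f x \<partial>\<mu>)"
      unfolding f[symmetric] by (subst emeasure_density) (auto intro!: nn_integral_cong)
    then show ?thesis using space by simp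
  qed
  define h where "h x = enn2real (f x)" for x
  have [measurable]: "h \<in> borel_measurable \<mu>" unfolding h_def by measurable
  \<comment> \<open>The density is a priori extended real valued. Its integral is the finite total
    mass of \<open>F\<close>, so it is finite almost everywhere.\<close>
  have fh: "AE x in \<mu>. f x = ennreal (h x)"
    using nn_integral_PInf_AE[of f \<mu>] int_f by (auto simp: h_def less_top elim!: eventually_mono)
  then have dens: "density \<mu> (\<lambda>x. ennreal (h x)) = \<nu>"
    unfolding f[symmetric] by (intro density_cong) (auto elim!: eventually_mono)
  have "(\<integral>\<^sup>+x. ennreal (h x) \<partial>\<mu>) = (\<integral>\<^sup>+x. f x \<partial>\<mu>)"
    using fh by (intro nn_integral_cong_AE) (auto elim!: eventually_mono)
  then have int_h: "integrable \<mu> h"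
    using int_f by (intro integrableI_nonneg) (auto simp: h_def)
  have "(\<integral>x. b (q x) * complex_of_real (F x) \<partial>N) = (\<integral>x. b x * complex_of_real (h x) \<partial>\<mu>)"
    if [measurable]: "b \<in> borel_measurable \<mu>" for b
  proof -
    have "(\<integral>x. b x * complex_of_real (h x) \<partial>\<mu>) = (\<integral>x. h x *\<^sub>R b x \<partial>\<mu>)"
      by (simp add: scaleR_conv_of_real mult.commute)
    also have "\<dots> = (\<integral>x. b x \<partial>\<nu>)"
      unfolding dens[symmetric] by (rule integral_density[symmetric]) (auto simp: h_def)
    also have "\<dots> = (\<integral>x. b (q x) \<partial>density N F)"
      unfolding \<nu>_def by (rule integral_distr) simp_all
    also have "\<dots> = (\<integral>x. F x *\<^sub>R b (q x) \<partial>N)"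
      using pos by (intro integral_density) auto
    finally show ?thesis by (simp add: scaleR_conv_of_real mult.commute)
  qed
  then show ?thesis using int_h by blast
qed

text \<open>The nonnegative case is applied to the positive and negative parts of the real and
  imaginary parts. This is how functionals on the algebra are brought into the predual.\<close>

lemma ex_pushforward:
  assumes F: "integrable N F"
  shows "\<exists>h. integrable \<mu> h \<and> (\<forall>b C. b \<in> borel_measurable \<mu> \<and> (\<forall>x. cmod (b x) \<le> C) \<longrightarrow>
    (\<integral>x. b (q x) * F x \<partial>N) = (\<integral>x. b x * h x \<partial>\<mu>))"
proof -
  let ?P = "\<lambda>F h. \<forall>b C. b \<in> borel_measurable \<mu> \<and> (\<forall>x. cmod (b x) \<le> C) \<longrightarrow>
    (\<integral>x. b (q x) * complex_of_real (F x) \<partial>N) = (\<integral>x. b x * complex_of_real (h x) \<partial>\<mu>)"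
  have i: "integrable N (\<lambda>x. max 0 (Re (F x)))" "integrable N (\<lambda>x. max 0 (- Re (F x)))"
    "integrable N (\<lambda>x. max 0 (Im (F x)))" "integrable N (\<lambda>x. max 0 (- Im (F x)))"
    using F by (auto intro!: integrable_max)
  obtain h1 where h1: "integrable \<mu> h1" "?P (\<lambda>x. max 0 (Re (F x))) h1"
    using ex_pushforward_nonneg[OF i(1)] by auto
  obtain h2 where h2: "integrable \<mu> h2" "?P (\<lambda>x. max 0 (- Re (F x))) h2"
    using ex_pushforward_nonneg[OF i(2)] by auto
  obtain h3 where h3: "integrable \<mu> h3" "?P (\<lambda>x. max 0 (Im (F x))) h3"
    using ex_pushforward_nonneg[OF i(3)] by auto
  obtain h4 where h4: "integrable \<mu> h4" "?P (\<lambda>x. max 0 (- Im (F x))) h4"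
    using ex_pushforward_nonneg[OF i(4)] by auto
  define h where "h x = (complex_of_real (h1 x) - complex_of_real (h2 x)) +
    \<i> * (complex_of_real (h3 x) - complex_of_real (h4 x))" for x
  have "integrable \<mu> h"
    unfolding h_def using h1(1) h2(1) h3(1) h4(1)
    by (intro Bochner_Integration.integrable_add Bochner_Integration.integrable_diff integrable_mult_right integrable_of_real)
  moreover have "(\<integral>x. b (q x) * F x \<partial>N) = (\<integral>x. b x * h x \<partial>\<mu>)"
    if b: "b \<in> borel_measurable \<mu>" "\<forall>x. cmod (b x) \<le> C" for b C
  proof -
    have [measurable]: "b \<in> borel_measurable \<mu>" by fact
    have bN: "integrable N (\<lambda>x. b (q x) * complex_of_real (G x))" if "integrable N G" for G
      using that b(2) by (intro integrable_bounded_mult[where C = C]) auto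
    have bM: "integrable \<mu> (\<lambda>x. b x * complex_of_real (G x))" if "integrable \<mu> G" for G
      using that b(2) by (intro integrable_bounded_mult[where C = C]) auto
    have "b (q x) * F x = (b (q x) * complex_of_real (max 0 (Re (F x))) - b (q x) * complex_of_real (max 0 (- Re (F x)))) +
        \<i> * (b (q x) * complex_of_real (max 0 (Im (F x))) - b (q x) * complex_of_real (max 0 (- Im (F x))))" for x
    proof -
      have "F x = (complex_of_real (max 0 (Re (F x))) - complex_of_real (max 0 (- Re (F x)))) +
        \<i> * (complex_of_real (max 0 (Im (F x))) - complex_of_real (max 0 (- Im (F x))))"
        by (simp add: complex_eq_iff max_def)
      then have "b (q x) * F x = b (q x) * ((complex_of_real (max 0 (Re (F x))) - complex_of_real (max 0 (- Re (F x)))) +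
        \<i> * (complex_of_real (max 0 (Im (F x))) - complex_of_real (max 0 (- Im (F x)))))"
        by metis
      then show ?thesis by (simp only: distrib_left right_diff_distrib mult_ac)
    qed
    then have "(\<integral>x. b (q x) * F x \<partial>N) =
        ((\<integral>x. b (q x) * complex_of_real (max 0 (Re (F x))) \<partial>N) - (\<integral>x. b (q x) * complex_of_real (max 0 (- Re (F x))) \<partial>N)) +
        \<i> * ((\<integral>x. b (q x) * complex_of_real (max 0 (Im (F x))) \<partial>N) - (\<integral>x. b (q x) * complex_of_real (max 0 (- Im (F x))) \<partial>N))"
      by (simp only: Bochner_Integration.integral_add Bochner_Integration.integral_diff integral_mult_right_zero
        Bochner_Integration.integrable_diff integrable_mult_right bN i)
    also have "\<dots> = ((\<integral>x. b x * complex_of_real (h1 x) \<partial>\<mu>) - (\<integral>x. b x * complex_of_real (h2 x) \<partial>\<mu>)) +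
        \<i> * ((\<integral>x. b x * complex_of_real (h3 x) \<partial>\<mu>) - (\<integral>x. b x * complex_of_real (h4 x) \<partial>\<mu>))"
      by (simp only: h1(2)[rule_format, OF conjI[OF b]] h2(2)[rule_format, OF conjI[OF b]]
        h3(2)[rule_format, OF conjI[OF b]] h4(2)[rule_format, OF conjI[OF b]])
    also have "\<dots> = (\<integral>x. (b x * complex_of_real (h1 x) - b x * complex_of_real (h2 x)) +
        \<i> * (b x * complex_of_real (h3 x) - b x * complex_of_real (h4 x)) \<partial>\<mu>)"
      by (simp only: Bochner_Integration.integral_add Bochner_Integration.integral_diff integral_mult_right_zero
        Bochner_Integration.integrable_diff integrable_mult_right bM h1 h2 h3 h4)
    also have "\<dots> = (\<integral>x. b x * h x \<partial>\<mu>)"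
      by (intro Bochner_Integration.integral_cong) (simp_all add: h_def algebra_simps)
    finally show ?thesis .
  qed
  ultimately show ?thesis by blast
qed

section \<open>Multiplication by functions of one coordinate\<close>

definition act :: "('a \<Rightarrow> complex) set \<Rightarrow> ('x \<Rightarrow> complex) set \<Rightarrow> ('x \<Rightarrow> complex) set" where
  "act a u = ae_class N (\<lambda>x. ae_rep a (q x) * ae_rep u x)"

lemma act_class:
  assumes "b \<in> borel_measurable \<mu>" "f \<in> borel_measurable N"
  shows "act (ae_class \<mu> b) (ae_class N f) = ae_class N (\<lambda>x. b (q x) * f x)"
  unfolding act_def using AE_comp[OF AE_ae_rep[OF assms(1)]] AE_ae_rep[OF assms(2)]
  by (intro ae_class_eqI) auto

lemma sq_int_act: "b \<in> borel_measurable \<mu> \<Longrightarrow> (\<And>x. cmod (b x) \<le> C) \<Longrightarrow> sq_int N f \<Longrightarrow> sq_int N (\<lambda>x. b (q x) * f x)"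
  by (rule sq_int_bounded_mult[where C = C]) auto

lemma act_L2:
  assumes "a \<in> Linf \<mu>" "u \<in> carr (L2 N)"
  shows "act a u \<in> carr (L2 N)"
proof -
  obtain b C where b: "b \<in> borel_measurable \<mu>" "\<And>x. cmod (b x) \<le> C" "a = ae_class \<mu> b"
    using LinfE[OF assms(1)] by metis
  obtain f where f: "sq_int N f" "u = ae_class N f" using L2E[OF assms(2)] by metis
  show ?thesis using b f by (auto simp: act_class intro: sq_int_act)
qed

lemma bounded_op_act:
  assumes "a \<in> Linf \<mu>"
  shows "bounded_op (L2 N) (L2 N) (act a)"
proof -
  obtain b C where b [measurable]: "b \<in> borel_measurable \<mu>" and C: "\<And>x. cmod (b x) \<le> C" "C \<ge> 0" and a: "a = ae_class \<mu> b"
    using LinfE[OF assms(1)] by metis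
  have "vnorm (L2 N) (act a u) \<le> C * vnorm (L2 N) u" if "u \<in> carr (L2 N)" for u
  proof -
    obtain f where f: "sq_int N f" "u = ae_class N f"
      using \<open>u \<in> carr (L2 N)\<close> by (rule L2E)
    have "(\<integral>x. (cmod (b (q x) * f x))\<^sup>2 \<partial>N) \<le> (\<integral>x. C\<^sup>2 * (cmod (f x))\<^sup>2 \<partial>N)"
    proof (rule integral_mono)
      show "integrable N (\<lambda>x. (cmod (b (q x) * f x))\<^sup>2)"
        by (rule sq_int_integrable[OF sq_int_act[OF b C(1) f(1)]])
      show "integrable N (\<lambda>x. C\<^sup>2 * (cmod (f x))\<^sup>2)" using f(1) by simp
    qed (use C in \<open>auto simp: norm_mult power_mult_distrib intro!: mult_right_mono power_mono\<close>)
    also have "\<dots> = C\<^sup>2 * (\<integral>x. (cmod (f x))\<^sup>2 \<partial>N)" by simp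
    finally have "sqrt (\<integral>x. (cmod (b (q x) * f x))\<^sup>2 \<partial>N) \<le> C * sqrt (\<integral>x. (cmod (f x))\<^sup>2 \<partial>N)"
      using C(2) by (metis real_sqrt_le_mono real_sqrt_mult real_sqrt_abs abs_of_nonneg)
    then show ?thesis
      using sq_int_act[OF b C(1) f(1)] f b by (simp add: a act_class L2_norm)
  qed
  moreover have "act a (cls_add N u v) = cls_add N (act a u) (act a v)" if "u \<in> carr (L2 N)" "v \<in> carr (L2 N)" for u v
    using that by (auto elim!: L2E simp: a act_class cls_add_class distrib_left)
  moreover have "act a (cls_scale N z u) = cls_scale N z (act a u)" if "u \<in> carr (L2 N)" for u z
    using that by (auto elim!: L2E simp: a act_class cls_scale_class mult.left_commute)
  ultimately show ?thesis
    using act_L2[OF assms] unfolding bounded_op_def by (simp, blast)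
qed

text \<open>Since |xy| is at most |x|^2 + |y|^2, the products of the two square summable families
  are summable in mean. Their sum is one integrable function on \<open>N\<close>, and pushing it
  forward along \<open>q\<close> gives the element of the predual.\<close>

lemma act_normal:
  assumes \<xi>: "\<And>n. \<xi> n \<in> carr (L2 N)" and \<eta>: "\<And>n. \<eta> n \<in> carr (L2 N)"
    and s\<xi>: "summable (\<lambda>n. (vnorm (L2 N) (\<xi> n))\<^sup>2)" and s\<eta>: "summable (\<lambda>n. (vnorm (L2 N) (\<eta> n))\<^sup>2)"
  shows "\<exists>h. integrable \<mu> h \<and>
    (\<forall>a\<in>Linf \<mu>. (\<lambda>n::nat. vip (L2 N) (\<xi> n) (act a (\<eta> n))) sums (\<integral>x. ae_rep a x * h x \<partial>\<mu>))"
proof -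
  have "\<forall>n. \<exists>f. sq_int N f \<and> \<xi> n = ae_class N f" "\<forall>n. \<exists>f. sq_int N f \<and> \<eta> n = ae_class N f"
    using \<xi> \<eta> by (simp_all add: L2_carr)
  then obtain f g where f: "\<And>n. sq_int N (f n)" "\<And>n. \<xi> n = ae_class N (f n)"
      and g: "\<And>n. sq_int N (g n)" "\<And>n. \<eta> n = ae_class N (g n)" by metis
  define F where "F n x = cnj (f n x) * g n x" for n x
  have [measurable]: "f n \<in> borel_measurable N" "g n \<in> borel_measurable N" for n
    using f g by simp_all
  have F: "integrable N (F n)" for n
    unfolding F_def by (intro sq_int_mult f g)
  have sm: "summable (\<lambda>n. (\<integral>x. (cmod (f n x))\<^sup>2 \<partial>N) + (\<integral>x. (cmod (g n x))\<^sup>2 \<partial>N))"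
    using s\<xi> s\<eta> by (intro summable_add) (simp_all add: f g L2_norm)
  have le: "(\<integral>x. norm (F n x) \<partial>N) \<le> (\<integral>x. (cmod (f n x))\<^sup>2 \<partial>N) + (\<integral>x. (cmod (g n x))\<^sup>2 \<partial>N)" for n
  proof -
    have "(\<integral>x. norm (F n x) \<partial>N) \<le> (\<integral>x. (cmod (f n x))\<^sup>2 + (cmod (g n x))\<^sup>2 \<partial>N)"
    proof (rule integral_mono)
      show "integrable N (\<lambda>x. norm (F n x))" using F by (rule integrable_norm)
      show "integrable N (\<lambda>x. (cmod (f n x))\<^sup>2 + (cmod (g n x))\<^sup>2)" using f(1) g(1) by simp
    qed (use mult_le_sum_squares in \<open>simp add: F_def norm_mult\<close>)
    then show ?thesis using f g by simp
  qed
  have sF: "summable (\<lambda>n. \<integral>x. norm (F n x) \<partial>N)"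
    by (rule summable_comparison_test'[OF sm, of 0]) (use le in simp)
  have aF: "AE x in N. summable (\<lambda>n. norm (F n x))"
    by (rule AE_summable[OF F sF])
  have "integrable N (\<lambda>x. \<Sum>n. F n x)"
    by (rule integrable_suminf[OF F aF sF])
  then obtain h where h: "integrable \<mu> h" "\<And>b C. b \<in> borel_measurable \<mu> \<Longrightarrow> (\<And>x. cmod (b x) \<le> C) \<Longrightarrow>
      (\<integral>x. b (q x) * (\<Sum>n. F n x) \<partial>N) = (\<integral>x. b x * h x \<partial>\<mu>)"
    using ex_pushforward[of "\<lambda>x. \<Sum>n. F n x"] by metis
  have [measurable]: "h \<in> borel_measurable \<mu>" using h(1) by simp
  have "(\<lambda>n. vip (L2 N) (\<xi> n) (act a (\<eta> n))) sums (\<integral>x. ae_rep a x * h x \<partial>\<mu>)" if "a \<in> Linf \<mu>" for a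
  proof -
    obtain b C where b [measurable]: "b \<in> borel_measurable \<mu>" and C: "\<And>x. cmod (b x) \<le> C" "C \<ge> 0" and a: "a = ae_class \<mu> b"
      using LinfE[OF \<open>a \<in> Linf \<mu>\<close>] by metis
    have bF: "integrable N (\<lambda>x. b (q x) * F n x)" for n
      using F C by (intro integrable_bounded_mult[where C = C]) auto
    have "vip (L2 N) (\<xi> n) (act a (\<eta> n)) = (\<integral>x. b (q x) * F n x \<partial>N)" for n
      by (simp add: f g a act_class L2_ip F_def mult_ac)
    moreover have "(\<lambda>n. \<integral>x. b (q x) * F n x \<partial>N) sums (\<integral>x. (\<Sum>n. b (q x) * F n x) \<partial>N)"
    proof (rule sums_integral[OF bF])
      show "AE x in N. summable (\<lambda>n. norm (b (q x) * F n x))"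
        using aF by eventually_elim (auto simp: norm_mult intro: summable_mult)
      have "(\<integral>x. norm (b (q x) * F n x) \<partial>N) \<le> C * (\<integral>x. norm (F n x) \<partial>N)" for n
      proof -
        have "(\<integral>x. norm (b (q x) * F n x) \<partial>N) \<le> (\<integral>x. C * norm (F n x) \<partial>N)"
          using bF F C
          by (intro integral_mono integrable_norm integrable_mult_right) (auto simp: norm_mult intro!: mult_right_mono)
        then show ?thesis by simp
      qed
      then show "summable (\<lambda>n. \<integral>x. norm (b (q x) * F n x) \<partial>N)"
        by (intro summable_comparison_test'[OF summable_mult[OF sF, of C], of 0]) auto
    qed
    moreover have "(\<integral>x. (\<Sum>n. b (q x) * F n x) \<partial>N) = (\<integral>x. b (q x) * (\<Sum>n. F n x) \<partial>N)"
    proof (rule integral_cong_AE)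
      show "AE x in N. (\<Sum>n. b (q x) * F n x) = b (q x) * (\<Sum>n. F n x)"
        using aF by eventually_elim (rule suminf_mult, rule summable_norm_cancel)
    qed (unfold F_def, measurable)
    moreover have "\<dots> = (\<integral>x. b x * h x \<partial>\<mu>)"
      using h(2)[OF b C(1)] .
    moreover have "\<dots> = (\<integral>x. ae_rep a x * h x \<partial>\<mu>)"
      unfolding a using AE_ae_rep[OF b] by (intro integral_cong_AE) (auto elim: eventually_mono)
    ultimately show ?thesis by simp
  qed
  then show ?thesis using h(1) by blast
qed

text \<open>Bounded functions commute, so one computation serves the left action and, with the
  factors exchanged, the right action as a representation of the opposite algebra.\<close>

lemma normal_star_rep_act:
  assumes "mul = cls_mult \<mu> \<or> mul = (\<lambda>a b. cls_mult \<mu> b a)"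
  shows "normal_star_rep \<mu> mul (L2 N) act"
proof -
  have mul: "mul (ae_class \<mu> b) (ae_class \<mu> c) = ae_class \<mu> (\<lambda>x. b x * c x)"
    if "b \<in> borel_measurable \<mu>" "c \<in> borel_measurable \<mu>" for b c
    using assms that by (auto simp: cls_mult_class mult.commute)
  show ?thesis
    unfolding normal_star_rep_def
  proof (intro conjI ballI allI impI)
    show "bounded_op (L2 N) (L2 N) (act a)" if "a \<in> Linf \<mu>" for a
      by (rule bounded_op_act[OF that])
    show "act (cls_one \<mu>) u = u" if "u \<in> carr (L2 N)" for u
      using that unfolding cls_one_def by (auto elim!: L2E simp: act_class)
    fix a assume "a \<in> Linf \<mu>"
    then obtain b C where b [measurable]: "b \<in> borel_measurable \<mu>" and C: "\<And>x. cmod (b x) \<le> C" "C \<ge> 0" and a: "a = ae_class \<mu> b"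
      using LinfE by metis
    show "act (cls_scale \<mu> z a) u = vscale (L2 N) z (act a u)" if "u \<in> carr (L2 N)" for z u
      using that by (auto elim!: L2E simp: a act_class cls_scale_class mult.assoc)
    show "vip (L2 N) (act a u) v = vip (L2 N) u (act (cls_star \<mu> a) v)" if "u \<in> carr (L2 N)" "v \<in> carr (L2 N)" for u v
      using that by (auto elim!: L2E simp: a act_class cls_star_class L2_ip mult_ac)
    fix a' assume "a' \<in> Linf \<mu>"
    then obtain b' C' where b' [measurable]: "b' \<in> borel_measurable \<mu>" and a': "a' = ae_class \<mu> b'"
      using LinfE by metis
    show "act (cls_add \<mu> a a') u = vadd (L2 N) (act a u) (act a' u)" if "u \<in> carr (L2 N)" for u
      using that by (auto elim!: L2E simp: a a' act_class cls_add_class distrib_right)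
    show "act (mul a a') u = act a (act a' u)" if "u \<in> carr (L2 N)" for u
      using that by (auto elim!: L2E simp: a a' act_class mul mult.assoc)
  next
    fix \<xi> \<eta> :: "nat \<Rightarrow> ('x \<Rightarrow> complex) set"
    assume "(\<forall>n. \<xi> n \<in> carr (L2 N) \<and> \<eta> n \<in> carr (L2 N)) \<and>
        summable (\<lambda>n. (vnorm (L2 N) (\<xi> n))\<^sup>2) \<and> summable (\<lambda>n. (vnorm (L2 N) (\<eta> n))\<^sup>2)"
    then show "\<exists>h. integrable \<mu> h \<and>
           (\<forall>a\<in>Linf \<mu>. (\<lambda>n. vip (L2 N) (\<xi> n) (act a (\<eta> n))) sums (\<integral>x. ae_rep a x * h x \<partial>\<mu>))"
      by (intro act_normal) auto
  qed
qed

end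

text \<open>\<open>q\<close> and \<open>r\<close> pick the coordinates that carry the left and the
  right action. The two-point space and all path spaces are instances, with the first and the last
  point.\<close>

definition coord_L2 :: "'x measure \<Rightarrow> ('x \<Rightarrow> 'a) \<Rightarrow> ('x \<Rightarrow> 'a) \<Rightarrow>
    (('a \<Rightarrow> complex) set, ('x \<Rightarrow> complex) set) bimodule" where
  "coord_L2 N q r = cspace.extend (L2 N) (bimodule.fields
     (\<lambda>a f. ae_class N (\<lambda>x. ae_rep a (q x) * ae_rep f x))
     (\<lambda>f a. ae_class N (\<lambda>x. ae_rep f x * ae_rep a (r x))))"

lemma coord_L2_simps [simp]:
  "carr (coord_L2 N q r) = carr (L2 N)" "vzero (coord_L2 N q r) = vzero (L2 N)"
  "vadd (coord_L2 N q r) = vadd (L2 N)" "vscale (coord_L2 N q r) = vscale (L2 N)"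
  "vip (coord_L2 N q r) = vip (L2 N)"
  "lact (coord_L2 N q r) = (\<lambda>a f. ae_class N (\<lambda>x. ae_rep a (q x) * ae_rep f x))"
  "ract (coord_L2 N q r) = (\<lambda>f a. ae_class N (\<lambda>x. ae_rep f x * ae_rep a (r x)))"
  by (simp_all add: coord_L2_def cspace.defs bimodule.defs L2_def)

lemma coord_L2_norm [simp]: "vnorm (coord_L2 N q r) = vnorm (L2 N)"
  by (simp add: vnorm_def fun_eq_iff)

lemma coord_L2_dist [simp]: "vdist (coord_L2 N q r) = vdist (L2 N)"
  by (simp add: vdist_def fun_eq_iff)

lemma coord_L2_hilbert [simp]: "hilbert_space (coord_L2 N q r) = hilbert_space (L2 N)"
  by (simp add: hilbert_space_def complex_vector_space_def)

lemma coord_L2_bounded_op [simp]: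
  "bounded_op (coord_L2 N q r) K T = bounded_op (L2 N) K T"
  "bounded_op H (coord_L2 N q r) T = bounded_op H (L2 N) T"
  by (simp_all add: bounded_op_def)

lemma coord_L2_normal_star_rep [simp]:
  "normal_star_rep \<mu> mul (coord_L2 N q r) \<rho> = normal_star_rep \<mu> mul (L2 N) \<rho>"
  by (simp add: normal_star_rep_def)

theorem wstar_bimodule_coord_L2:
  assumes "measure_preserving N \<mu> q" "measure_preserving N \<mu> r"
  shows "wstar_bimodule \<mu> (coord_L2 N q r)"
proof -
  interpret q: measure_preserving N \<mu> q by fact
  interpret r: measure_preserving N \<mu> r by fact
  have l: "lact (coord_L2 N q r) = q.act" and r: "ract (coord_L2 N q r) = (\<lambda>u a. r.act a u)"
    unfolding coord_L2_simps q.act_def[abs_def] r.act_def[abs_def] by (simp_all add: mult.commute)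
  have "r.act b (q.act a u) = q.act a (r.act b u)" if "a \<in> Linf \<mu>" "b \<in> Linf \<mu>" "u \<in> carr (L2 N)" for a b u
    using that by (auto elim!: L2E LinfE simp: q.act_class r.act_class mult.left_commute)
  then show ?thesis
    unfolding wstar_bimodule_def l r
    using q.normal_star_rep_act r.normal_star_rep_act q.N.hilbert_space_L2 by simp
qed

section \<open>Extensions of a space by one Markov step\<close>

text \<open>A random pair (y, w): \<open>w\<close> has law \<open>N'\<close>, and given
  \<open>w\<close> the new point \<open>y\<close> has density \<open>k y (e w)\<close> with respect
  to \<mu>, so \<open>e w\<close> is the point to which \<open>y\<close> is attached.
  \<open>glue\<close> assembles the pair into a point of \<open>N\<close>, and \<open>h0\<close>,
  \<open>sh\<close> take it apart again.\<close>

locale markov_ext =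
  e: measure_preserving N' \<mu> e for N' :: "'b measure" and \<mu> :: "'a measure" and e +
  fixes k :: "'a \<Rightarrow> 'a \<Rightarrow> real" and N :: "'c measure" and h0 :: "'c \<Rightarrow> 'a" and sh :: "'c \<Rightarrow> 'b"
    and glue :: "'a \<Rightarrow> 'b \<Rightarrow> 'c"
  assumes k [measurable]: "case_prod k \<in> borel_measurable (\<mu> \<Otimes>\<^sub>M \<mu>)"
    and k_nonneg: "0 \<le> k y x" and k_sym: "k y x = k x y"
    and k_int: "(\<integral>\<^sup>+y. ennreal (k x y) \<partial>\<mu>) = 1"
    and h0 [measurable]: "h0 \<in> measurable N \<mu>" and sh [measurable]: "sh \<in> measurable N N'"
    and glue [measurable]: "case_prod glue \<in> measurable (\<mu> \<Otimes>\<^sub>M N') N"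
    and glue_parts: "\<omega> \<in> space N \<Longrightarrow> glue (h0 \<omega>) (sh \<omega>) = \<omega>"
    and h0_glue: "y \<in> space \<mu> \<Longrightarrow> w \<in> space N' \<Longrightarrow> h0 (glue y w) = y"
    and sh_glue: "y \<in> space \<mu> \<Longrightarrow> w \<in> space N' \<Longrightarrow> sh (glue y w) = w"
    and distr_glue: "distr (density (\<mu> \<Otimes>\<^sub>M N') (\<lambda>(y, w). ennreal (k y (e w)))) N (case_prod glue) = N"
begin

sublocale pair_prob_space \<mu> N' ..

sublocale base: pair_prob_space \<mu> \<mu> ..

lemma k_int': "(\<integral>\<^sup>+y. ennreal (k y x) \<partial>\<mu>) = 1"
  using k_int[of x] by (simp add: k_sym)

lemma k_comp [measurable]: "(\<lambda>(y, w). k y (e w)) \<in> borel_measurable (\<mu> \<Otimes>\<^sub>M N')"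
  by measurable

lemma nn_integral_ext:
  assumes F [measurable]: "F \<in> borel_measurable N"
  shows "(\<integral>\<^sup>+\<omega>. F \<omega> \<partial>N) = (\<integral>\<^sup>+w. \<integral>\<^sup>+y. ennreal (k y (e w)) * F (glue y w) \<partial>\<mu> \<partial>N')"
proof -
  let ?D = "density (\<mu> \<Otimes>\<^sub>M N') (\<lambda>(y, w). ennreal (k y (e w)))"
  have "(\<integral>\<^sup>+\<omega>. F \<omega> \<partial>N) = (\<integral>\<^sup>+\<omega>. F \<omega> \<partial>distr ?D N (case_prod glue))"
    by (simp only: distr_glue)
  also have "\<dots> = (\<integral>\<^sup>+x. F (case_prod glue x) \<partial>?D)"
    by (rule nn_integral_distr) auto
  also have "\<dots> = (\<integral>\<^sup>+x. (case x of (y, w) \<Rightarrow> ennreal (k y (e w))) * F (case_prod glue x) \<partial>(\<mu> \<Otimes>\<^sub>M N'))"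
    by (rule nn_integral_density) auto
  also have "\<dots> = (\<integral>\<^sup>+w. \<integral>\<^sup>+y. ennreal (k y (e w)) * F (glue y w) \<partial>\<mu> \<partial>N')"
    by (subst nn_integral_snd[symmetric]) auto
  finally show ?thesis .
qed

lemma integral_ext:
  fixes F :: "'c \<Rightarrow> complex"
  assumes F: "integrable N F"
  shows "(\<integral>\<omega>. F \<omega> \<partial>N) = (\<integral>w. (\<integral>y. complex_of_real (k y (e w)) * F (glue y w) \<partial>\<mu>) \<partial>N')"
proof -
  let ?k = "\<lambda>(y, w). k y (e w)"
  let ?D = "density (\<mu> \<Otimes>\<^sub>M N') (\<lambda>x. ennreal (?k x))"
  have D: "?D = density (\<mu> \<Otimes>\<^sub>M N') (\<lambda>(y, w). ennreal (k y (e w)))"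
    by (simp add: case_prod_unfold)
  have [measurable]: "F \<in> borel_measurable N" using F by simp
  have g [measurable]: "case_prod glue \<in> measurable ?D N" by simp
  have mF: "(\<lambda>x. F (case_prod glue x)) \<in> borel_measurable (\<mu> \<Otimes>\<^sub>M N')" by measurable
  have eq: "(\<lambda>x. ?k x *\<^sub>R F (case_prod glue x)) = (\<lambda>(y, w). complex_of_real (k y (e w)) * F (glue y w))"
    by (auto simp: scaleR_conv_of_real)
  have pos: "AE x in \<mu> \<Otimes>\<^sub>M N'. 0 \<le> ?k x" using k_nonneg by auto
  have "integrable (distr ?D N (case_prod glue)) F"
    unfolding D distr_glue by (rule F)
  then have "integrable ?D (\<lambda>x. F (case_prod glue x))"
    by (subst (asm) integrable_distr_eq) auto
  then have I: "integrable (\<mu> \<Otimes>\<^sub>M N') (\<lambda>(y, w). complex_of_real (k y (e w)) * F (glue y w))"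
    by (simp only: integrable_density[OF mF k_comp pos] eq)
  have "(\<integral>\<omega>. F \<omega> \<partial>N) = (\<integral>\<omega>. F \<omega> \<partial>distr ?D N (case_prod glue))"
    by (simp only: D distr_glue)
  also have "\<dots> = (\<integral>x. F (case_prod glue x) \<partial>?D)"
    by (rule integral_distr) auto
  also have "\<dots> = (\<integral>x. ?k x *\<^sub>R F (case_prod glue x) \<partial>(\<mu> \<Otimes>\<^sub>M N'))"
    by (rule integral_density[OF _ _ pos]) auto
  also have "\<dots> = (\<integral>w. (\<integral>y. complex_of_real (k y (e w)) * F (glue y w) \<partial>\<mu>) \<partial>N')"
    unfolding eq by (rule integral_snd[OF I, symmetric])
  finally show ?thesis .
qed

lemma prob_space_ext: "prob_space N"
proof
  show "emeasure N (space N) = 1"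
    using nn_integral_ext[of "\<lambda>_. 1"] by (simp add: k_int' e.N.emeasure_space_1)
qed

text \<open>The new point is integrated out in the first argument of \<open>k\<close>, where
  symmetry makes the total mass 1 as well.\<close>

lemma distr_sh: "distr N N' sh = N'"
proof (rule measure_eqI)
  fix B assume "B \<in> sets (distr N N' sh)"
  then have [measurable]: "B \<in> sets N'" by simp
  have "emeasure (distr N N' sh) B = (\<integral>\<^sup>+\<omega>. indicator B (sh \<omega>) \<partial>N)"
    by (subst nn_integral_indicator[symmetric], simp, subst nn_integral_distr) auto
  also have "\<dots> = (\<integral>\<^sup>+w. \<integral>\<^sup>+y. ennreal (k y (e w)) * indicator B w \<partial>\<mu> \<partial>N')"
    by (subst nn_integral_ext) (auto simp: sh_glue intro!: nn_integral_cong)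
  also have "\<dots> = (\<integral>\<^sup>+w. indicator B w \<partial>N')"
    by (intro nn_integral_cong) (subst nn_integral_multc, measurable, simp add: k_int')
  finally show "emeasure (distr N N' sh) B = emeasure N' B" by simp
qed simp

lemma measure_preserving_sh: "measure_preserving N N' sh"
  using prob_space_ext distr_sh e.N.prob_space_axioms
  by (simp add: measure_preserving_def measure_preserving_axioms_def)

text \<open>\<open>G\<close> sees \<open>w\<close> only through \<open>e w\<close>, whose law is
  \<mu>. This replaces \<open>N'\<close> by \<mu> whenever only the first edge matters.\<close>

lemma nn_integral_swap:
  assumes [measurable]: "case_prod G \<in> borel_measurable (\<mu> \<Otimes>\<^sub>M \<mu>)"
  shows "(\<integral>\<^sup>+w. \<integral>\<^sup>+y. G y (e w) \<partial>\<mu> \<partial>N') = (\<integral>\<^sup>+x. \<integral>\<^sup>+y. G y x \<partial>\<mu> \<partial>\<mu>)"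
proof -
  have "(\<integral>\<^sup>+x. \<integral>\<^sup>+y. G y x \<partial>\<mu> \<partial>\<mu>) = (\<integral>\<^sup>+x. \<integral>\<^sup>+y. G y x \<partial>\<mu> \<partial>distr N' \<mu> e)"
    by (simp only: e.distr_q)
  also have "\<dots> = (\<integral>\<^sup>+w. \<integral>\<^sup>+y. G y (e w) \<partial>\<mu> \<partial>N')"
    by (rule nn_integral_distr) auto
  finally show ?thesis ..
qed

text \<open>Invariance of \<mu>: once the order of integration is exchanged, the inner integral runs
  over the attachment point, in the second argument of \<open>k\<close>, and equals 1.\<close>

lemma distr_h0: "distr N \<mu> h0 = \<mu>"
proof (rule measure_eqI)
  fix A assume "A \<in> sets (distr N \<mu> h0)"
  then have [measurable]: "A \<in> sets \<mu>" by simp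
  have "emeasure (distr N \<mu> h0) A = (\<integral>\<^sup>+\<omega>. indicator A (h0 \<omega>) \<partial>N)"
    by (subst nn_integral_indicator[symmetric], simp, subst nn_integral_distr) auto
  also have "\<dots> = (\<integral>\<^sup>+w. \<integral>\<^sup>+y. ennreal (k y (e w)) * indicator A y \<partial>\<mu> \<partial>N')"
    by (subst nn_integral_ext) (auto simp: h0_glue intro!: nn_integral_cong)
  also have "\<dots> = (\<integral>\<^sup>+x. \<integral>\<^sup>+y. ennreal (k y x) * indicator A y \<partial>\<mu> \<partial>\<mu>)"
    by (rule nn_integral_swap) auto
  also have "\<dots> = (\<integral>\<^sup>+y. \<integral>\<^sup>+x. ennreal (k y x) * indicator A y \<partial>\<mu> \<partial>\<mu>)"
    by (rule base.Fubini') auto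
  also have "\<dots> = (\<integral>\<^sup>+y. indicator A y \<partial>\<mu>)"
    by (intro nn_integral_cong) (subst nn_integral_multc, measurable, simp add: k_int)
  finally show "emeasure (distr N \<mu> h0) A = emeasure \<mu> A" by simp
qed simp

lemma measure_preserving_h0: "measure_preserving N \<mu> h0"
  using prob_space_ext distr_h0 e.prob_space_axioms
  by (simp add: measure_preserving_def measure_preserving_axioms_def)

text \<open>A kernel \<open>f\<close> is \<open>bdd_kernel\<close> if it is a bounded vector for the right action in the
  one-step space.\<close>
definition bdd_kernel :: "('a \<Rightarrow> 'a \<Rightarrow> complex) \<Rightarrow> bool" where
  "bdd_kernel f \<longleftrightarrow> case_prod f \<in> borel_measurable (\<mu> \<Otimes>\<^sub>M \<mu>) \<and>
     (\<exists>C\<ge>0. AE x in \<mu>. (\<integral>\<^sup>+y. ennreal (k y x) * ennreal ((cmod (f y x))\<^sup>2) \<partial>\<mu>) \<le> ennreal C)"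

definition kernel_inner :: "('a \<Rightarrow> 'a \<Rightarrow> complex) \<Rightarrow> ('a \<Rightarrow> 'a \<Rightarrow> complex) \<Rightarrow> 'a \<Rightarrow> complex" where
  "kernel_inner f f' x = (\<integral>y. complex_of_real (k y x) * (cnj (f y x) * f' y x) \<partial>\<mu>)"

definition kernel_mult :: "('a \<Rightarrow> 'a \<Rightarrow> complex) \<Rightarrow> ('b \<Rightarrow> complex) \<Rightarrow> 'c \<Rightarrow> complex" where
  "kernel_mult f \<eta> \<omega> = f (h0 \<omega>) (e (sh \<omega>)) * \<eta> (sh \<omega>)"

lemma kernel_mult_measurable [measurable]:
  assumes [measurable]: "case_prod f \<in> borel_measurable (\<mu> \<Otimes>\<^sub>M \<mu>)" "\<eta> \<in> borel_measurable N'"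
  shows "kernel_mult f \<eta> \<in> borel_measurable N"
  unfolding kernel_mult_def by measurable

lemma kernel_inner_measurable [measurable]:
  assumes [measurable]: "case_prod f \<in> borel_measurable (\<mu> \<Otimes>\<^sub>M \<mu>)" "case_prod f' \<in> borel_measurable (\<mu> \<Otimes>\<^sub>M \<mu>)"
  shows "kernel_inner f f' \<in> borel_measurable \<mu>"
  unfolding kernel_inner_def by measurable

lemma nn_integral_kernel_mult:
  assumes [measurable]: "case_prod f \<in> borel_measurable (\<mu> \<Otimes>\<^sub>M \<mu>)" "\<eta> \<in> borel_measurable N'"
  shows "(\<integral>\<^sup>+\<omega>. ennreal ((cmod (kernel_mult f \<eta> \<omega>))\<^sup>2) \<partial>N) =
    (\<integral>\<^sup>+w. (\<integral>\<^sup>+y. ennreal (k y (e w)) * ennreal ((cmod (f y (e w)))\<^sup>2) \<partial>\<mu>) * ennreal ((cmod (\<eta> w))\<^sup>2) \<partial>N')"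
proof -
  have "(\<integral>\<^sup>+\<omega>. ennreal ((cmod (kernel_mult f \<eta> \<omega>))\<^sup>2) \<partial>N) =
    (\<integral>\<^sup>+w. \<integral>\<^sup>+y. ennreal (k y (e w)) * ennreal ((cmod (kernel_mult f \<eta> (glue y w)))\<^sup>2) \<partial>\<mu> \<partial>N')"
    by (rule nn_integral_ext) measurable
  also have "\<dots> = (\<integral>\<^sup>+w. \<integral>\<^sup>+y. (ennreal (k y (e w)) * ennreal ((cmod (f y (e w)))\<^sup>2)) * ennreal ((cmod (\<eta> w))\<^sup>2) \<partial>\<mu> \<partial>N')"
    by (intro nn_integral_cong)
      (simp add: kernel_mult_def h0_glue sh_glue norm_mult power_mult_distrib ennreal_mult mult.assoc)
  also have "\<dots> = (\<integral>\<^sup>+w. (\<integral>\<^sup>+y. ennreal (k y (e w)) * ennreal ((cmod (f y (e w)))\<^sup>2) \<partial>\<mu>) * ennreal ((cmod (\<eta> w))\<^sup>2) \<partial>N')"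
    by (intro nn_integral_cong nn_integral_multc) measurable
  finally show ?thesis .
qed

text \<open>The fibre integral over the new point is at most the constant of
  \<open>bdd_kernel\<close>, which then factors out of the integral over \<open>N'\<close>. One
  constant for all \<eta> is what makes multiplication by \<open>f\<close> a bounded
  operator.\<close>

lemma sq_int_kernel_mult:
  assumes f: "bdd_kernel f" and \<eta>: "sq_int N' \<eta>"
  shows "sq_int N (kernel_mult f \<eta>)"
    and "\<exists>C. \<forall>\<eta>. sq_int N' \<eta> \<longrightarrow> (\<integral>\<omega>. (cmod (kernel_mult f \<eta> \<omega>))\<^sup>2 \<partial>N) \<le> C * (\<integral>w. (cmod (\<eta> w))\<^sup>2 \<partial>N')"
proof -
  have [measurable]: "case_prod f \<in> borel_measurable (\<mu> \<Otimes>\<^sub>M \<mu>)" using f by (simp add: bdd_kernel_def)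
  obtain C where C: "C \<ge> 0" "AE x in \<mu>. (\<integral>\<^sup>+y. ennreal (k y x) * ennreal ((cmod (f y x))\<^sup>2) \<partial>\<mu>) \<le> ennreal C"
    using f by (auto simp: bdd_kernel_def)
  have le: "(\<integral>\<^sup>+\<omega>. ennreal ((cmod (kernel_mult f \<eta> \<omega>))\<^sup>2) \<partial>N) \<le> ennreal (C * (\<integral>w. (cmod (\<eta> w))\<^sup>2 \<partial>N'))"
    if "sq_int N' \<eta>" for \<eta>
  proof -
    have [measurable]: "\<eta> \<in> borel_measurable N'" using that by simp
    have "(\<integral>\<^sup>+\<omega>. ennreal ((cmod (kernel_mult f \<eta> \<omega>))\<^sup>2) \<partial>N) \<le> (\<integral>\<^sup>+w. ennreal C * ennreal ((cmod (\<eta> w))\<^sup>2) \<partial>N')"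
      unfolding nn_integral_kernel_mult[OF \<open>case_prod f \<in> _\<close> \<open>\<eta> \<in> _\<close>]
      using e.AE_comp[OF C(2)]
      by (intro nn_integral_mono_AE) (auto elim!: eventually_mono intro!: mult_right_mono)
    also have "\<dots> = ennreal (C * (\<integral>w. (cmod (\<eta> w))\<^sup>2 \<partial>N'))"
      using C(1) that by (simp add: nn_integral_cmult nn_integral_sq_int ennreal_mult)
    finally show ?thesis .
  qed
  have sq: "sq_int N (kernel_mult f \<eta>)" if "sq_int N' \<eta>" for \<eta>
    using le[OF that] that by (intro sq_intI) (auto simp: le_less_trans)
  show "sq_int N (kernel_mult f \<eta>)" by (rule sq[OF \<eta>])
  show "\<exists>C. \<forall>\<eta>. sq_int N' \<eta> \<longrightarrow> (\<integral>\<omega>. (cmod (kernel_mult f \<eta> \<omega>))\<^sup>2 \<partial>N) \<le> C * (\<integral>w. (cmod (\<eta> w))\<^sup>2 \<partial>N')"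
    using le C(1) by (intro exI[of _ C]) (auto simp: nn_integral_sq_int sq)
qed

text \<open>Estimating the product by the sum of the squares inside the fibre integral yields the
  sum of the two constants as a bound.\<close>

lemma kernel_inner_bounded:
  assumes f: "bdd_kernel f" and f': "bdd_kernel f'"
  shows "\<exists>C. AE x in \<mu>. cmod (kernel_inner f f' x) \<le> C"
proof -
  have [measurable]: "case_prod f \<in> borel_measurable (\<mu> \<Otimes>\<^sub>M \<mu>)" "case_prod f' \<in> borel_measurable (\<mu> \<Otimes>\<^sub>M \<mu>)"
    using f f' by (simp_all add: bdd_kernel_def)
  obtain C where C: "C \<ge> 0" "AE x in \<mu>. (\<integral>\<^sup>+y. ennreal (k y x) * ennreal ((cmod (f y x))\<^sup>2) \<partial>\<mu>) \<le> ennreal C"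
    using f by (auto simp: bdd_kernel_def)
  obtain C' where C': "C' \<ge> 0" "AE x in \<mu>. (\<integral>\<^sup>+y. ennreal (k y x) * ennreal ((cmod (f' y x))\<^sup>2) \<partial>\<mu>) \<le> ennreal C'"
    using f' by (auto simp: bdd_kernel_def)
  have "AE x in \<mu>. cmod (kernel_inner f f' x) \<le> C + C'"
    using C(2) C'(2) AE_space
  proof eventually_elim
    case (elim x)
    note [measurable] = \<open>x \<in> space \<mu>\<close>
    have "ennreal (cmod (kernel_inner f f' x)) \<le> (\<integral>\<^sup>+y. ennreal (norm (complex_of_real (k y x) * (cnj (f y x) * f' y x))) \<partial>\<mu>)"
    \<comment> \<open>Without integrability on the fibre the Bochner integral is 0 by convention and
      the bound is trivial.\<close>
    proof (cases "integrable \<mu> (\<lambda>y. complex_of_real (k y x) * (cnj (f y x) * f' y x))")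
      case True
      then show ?thesis unfolding kernel_inner_def by (rule integral_norm_bound_ennreal)
    qed (simp add: kernel_inner_def not_integrable_integral_eq)
    also have "\<dots> \<le> (\<integral>\<^sup>+y. ennreal (k y x) * ennreal ((cmod (f y x))\<^sup>2) + ennreal (k y x) * ennreal ((cmod (f' y x))\<^sup>2) \<partial>\<mu>)"
      using k_nonneg mult_le_sum_squares
      by (intro nn_integral_mono)
        (auto simp: norm_mult simp flip: ennreal_mult ennreal_plus distrib_left intro!: ennreal_leI mult_left_mono)
    also have "\<dots> = (\<integral>\<^sup>+y. ennreal (k y x) * ennreal ((cmod (f y x))\<^sup>2) \<partial>\<mu>) +
        (\<integral>\<^sup>+y. ennreal (k y x) * ennreal ((cmod (f' y x))\<^sup>2) \<partial>\<mu>)"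
      by (rule nn_integral_add) measurable
    also have "\<dots> \<le> ennreal C + ennreal C'"
      using elim by (intro add_mono) auto
    finally show ?case
      using C(1) C'(1) by (simp flip: ennreal_plus)
  qed
  then show ?thesis by blast
qed

text \<open>Integrating over the new point first leaves \<eta> and \<eta>' untouched, since they
  depend on the old part alone.\<close>

lemma inner_kernel_mult:
  assumes f: "bdd_kernel f" "bdd_kernel f'" and \<eta>: "sq_int N' \<eta>" "sq_int N' \<eta>'"
  shows "(\<integral>\<omega>. cnj (kernel_mult f \<eta> \<omega>) * kernel_mult f' \<eta>' \<omega> \<partial>N) =
    (\<integral>w. cnj (\<eta> w) * (kernel_inner f f' (e w) * \<eta>' w) \<partial>N')"
proof -
  have "(\<integral>\<omega>. cnj (kernel_mult f \<eta> \<omega>) * kernel_mult f' \<eta>' \<omega> \<partial>N) =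
    (\<integral>w. (\<integral>y. complex_of_real (k y (e w)) *
      (cnj (kernel_mult f \<eta> (glue y w)) * kernel_mult f' \<eta>' (glue y w)) \<partial>\<mu>) \<partial>N')"
    by (rule integral_ext, rule sq_int_mult) (intro sq_int_kernel_mult f \<eta>)+
  also have "\<dots> = (\<integral>w. (\<integral>y. (cnj (\<eta> w) * \<eta>' w) *
      (complex_of_real (k y (e w)) * (cnj (f y (e w)) * f' y (e w))) \<partial>\<mu>) \<partial>N')"
    by (intro Bochner_Integration.integral_cong refl) (simp add: kernel_mult_def h0_glue sh_glue mult_ac)
  also have "\<dots> = (\<integral>w. cnj (\<eta> w) * (kernel_inner f f' (e w) * \<eta>' w) \<partial>N')"
    by (intro Bochner_Integration.integral_cong refl) (simp add: kernel_inner_def mult_ac)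
  finally show ?thesis .
qed

end

context markov_ext
begin

text \<open>A Dynkin class argument gives all indicator functions, and simple functions approximate in
  the mean.\<close>
theorem rectangles_total:
  assumes add: "\<And>f g. sq_int N f \<Longrightarrow> sq_int N g \<Longrightarrow> ae_class N f \<in> S \<Longrightarrow> ae_class N g \<in> S \<Longrightarrow>
      ae_class N (\<lambda>\<omega>. f \<omega> + g \<omega>) \<in> S"
    and scale: "\<And>f a. sq_int N f \<Longrightarrow> ae_class N f \<in> S \<Longrightarrow> ae_class N (\<lambda>\<omega>. a * f \<omega>) \<in> S"
    and lim: "\<And>f X. (\<And>n::nat. sq_int N (X n)) \<Longrightarrow> sq_int N f \<Longrightarrow> (\<And>n. ae_class N (X n) \<in> S) \<Longrightarrow>
      (\<lambda>n. \<integral>\<omega>. (cmod (X n \<omega> - f \<omega>))\<^sup>2 \<partial>N) \<longlonglongrightarrow> 0 \<Longrightarrow> ae_class N f \<in> S"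
    and rect: "\<And>A B. A \<in> sets \<mu> \<Longrightarrow> B \<in> sets N' \<Longrightarrow>
      ae_class N (\<lambda>\<omega>. indicator A (h0 \<omega>) * indicator B (sh \<omega>)) \<in> S"
    and f: "sq_int N f"
  shows "ae_class N f \<in> S"
proof -
  interpret N: prob_space N by (rule prob_space_ext)
  define I :: "('a \<times> 'b) set \<Rightarrow> 'c \<Rightarrow> complex" where "I A \<omega> = indicator A (h0 \<omega>, sh \<omega>)" for A \<omega>
  have I_meas [measurable]: "I A \<in> borel_measurable N" if [measurable]: "A \<in> sets (\<mu> \<Otimes>\<^sub>M N')" for A
    unfolding I_def by measurable
  have I_sq: "sq_int N (I A)" if "A \<in> sets (\<mu> \<Otimes>\<^sub>M N')" for A
    using I_meas[OF that] by (rule N.sq_int_bounded[where C = 1]) (simp add: I_def indicator_def)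
  have I_rect: "ae_class N (I (A \<times> B)) \<in> S" if "A \<in> sets \<mu>" "B \<in> sets N'" for A B
  proof -
    have "I (A \<times> B) = (\<lambda>\<omega>. indicator A (h0 \<omega>) * indicator B (sh \<omega>))"
      by (auto simp: I_def indicator_def)
    then show ?thesis using rect[OF that] by simp
  qed
  have dynkin: "ae_class N (I A) \<in> S" if "A \<in> sets (\<mu> \<Otimes>\<^sub>M N')" for A
    \<comment> \<open>Rectangles form an intersection-stable generator of the product
      \<sigma>-algebra; complements and disjoint unions are reached by linearity and limits.\<close>
    using Int_stable_pair_measure_generator pair_measure_closed that
    unfolding sets_pair_measure
  proof (induct rule: sigma_sets_induct_disjoint)
    case (basic A)
    then show ?case using I_rect by auto
  next
    case empty
    show ?case using I_rect[of "{}" "{}"] by simp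
  next
    case (compl A)
    then have A: "A \<in> sets (\<mu> \<Otimes>\<^sub>M N')" by (simp add: sets_pair_measure)
    have "ae_class N (\<lambda>\<omega>. I (space \<mu> \<times> space N') \<omega> + (-1) * I A \<omega>) \<in> S"
      using A compl I_rect[of "space \<mu>" "space N'"]
      by (intro add scale sq_int_scale I_sq) auto
    also have "ae_class N (\<lambda>\<omega>. I (space \<mu> \<times> space N') \<omega> + (-1) * I A \<omega>) = ae_class N (I (space \<mu> \<times> space N' - A))"
      using sets.sets_into_space[OF A]
      by (intro ae_class_eqI AE_I2) (auto simp: I_def indicator_def space_pair_measure)
    finally show ?case .
  next
    case (union A)
    then have A: "A i \<in> sets (\<mu> \<Otimes>\<^sub>M N')" for i by (auto simp: sets_pair_measure)
    \<comment> \<open>Indicators of finite unions are sums because the sets are disjoint; the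
      countable union is their limit in mean square, by dominated convergence with bound 1.\<close>
    have fin: "ae_class N (I (\<Union>i<n. A i)) \<in> S" for n
    proof (induction n)
      case 0
      then show ?case using I_rect[of "{}" "{}"] by simp
    next
      case (Suc n)
      have "ae_class N (\<lambda>\<omega>. I (\<Union>i<n. A i) \<omega> + I (A n) \<omega>) \<in> S"
        using Suc union A by (intro add I_sq) auto
      moreover have "(\<lambda>\<omega>. I (\<Union>i<n. A i) \<omega> + I (A n) \<omega>) = I (\<Union>i<Suc n. A i)"
      proof
        fix \<omega>
        have "A i \<inter> A n = {}" if "i < n" for i
          using disjoint_family_onD[OF \<open>disjoint_family A\<close>, of i n] that by simp
        then have "(\<Union>i<n. A i) \<inter> A n = {}" by blast
        moreover have "(\<Union>i<Suc n. A i) = (\<Union>i<n. A i) \<union> A n"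
          by (simp only: lessThan_Suc UN_insert Un_commute)
        ultimately show "I (\<Union>i<n. A i) \<omega> + I (A n) \<omega> = I (\<Union>i<Suc n. A i) \<omega>"
          by (simp add: I_def indicator_add[symmetric])
      qed
      ultimately show ?case by simp
    qed
    have "(\<lambda>n. \<integral>\<omega>. (cmod (I (\<Union>i<n. A i) \<omega> - I (\<Union>i. A i) \<omega>))\<^sup>2 \<partial>N) \<longlonglongrightarrow> (\<integral>\<omega>. 0 \<partial>N)"
    proof (rule integral_dominated_convergence[where w = "\<lambda>_. 1"])
      show "AE \<omega> in N. (\<lambda>n. (cmod (I (\<Union>i<n. A i) \<omega> - I (\<Union>i. A i) \<omega>))\<^sup>2) \<longlonglongrightarrow> 0"
      proof (rule AE_I2)
        fix \<omega>
        have "(\<lambda>n. I (\<Union>i<n. A i) \<omega>) \<longlonglongrightarrow> I (\<Union>i. A i) \<omega>"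
          unfolding I_def by (rule LIMSEQ_indicator_UN)
        then show "(\<lambda>n. (cmod (I (\<Union>i<n. A i) \<omega> - I (\<Union>i. A i) \<omega>))\<^sup>2) \<longlonglongrightarrow> 0"
          by (intro tendsto_eq_intros) auto
      qed
      show "AE \<omega> in N. norm ((cmod (I (\<Union>i<n. A i) \<omega> - I (\<Union>i. A i) \<omega>))\<^sup>2) \<le> 1" for n
        by (auto simp: I_def indicator_def)
    qed (use A in measurable)
    then show ?case
      by (intro lim[of "\<lambda>n. I (\<Union>i<n. A i)", OF I_sq I_sq fin]) (use A in auto)
  qed
  have ind: "ae_class N (indicator B) \<in> S" if B [measurable]: "B \<in> sets N" for B
  proof -
    \<comment> \<open>\<open>B\<close> is pulled back to the product along \<open>glue\<close>.
      Since \<open>glue (h0 \<omega>) (sh \<omega>) = \<omega>\<close> on the space of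
      \<open>N\<close>, the indicator of the pullback at \<open>(h0 \<omega>, sh \<omega>)\<close>
      is that of \<open>B\<close> at \<omega>.\<close>
    let ?B' = "case_prod glue -` B \<inter> space (\<mu> \<Otimes>\<^sub>M N')"
    have "ae_class N (I ?B') \<in> S"
      by (intro dynkin measurable_sets[OF glue B])
    also have "ae_class N (I ?B') = ae_class N (indicator B)"
      using measurable_space[OF h0] measurable_space[OF sh] glue_parts
      by (intro ae_class_eqI AE_I2) (auto simp: I_def indicator_def space_pair_measure)
    finally show ?thesis .
  qed
  have "indicator {} = (\<lambda>\<omega>::'c. 0::complex)" by auto
  then have zero: "ae_class N (\<lambda>_. 0) \<in> S" using ind[of "{}"] by simp
  have sums: "ae_class N (\<lambda>\<omega>. \<Sum>v\<in>V. v * indicator (B v) \<omega>) \<in> S \<and> sq_int N (\<lambda>\<omega>. \<Sum>v\<in>V. v * indicator (B v) \<omega>)"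
    if "finite V" "\<And>v. v \<in> V \<Longrightarrow> B v \<in> sets N" for V and B :: "complex \<Rightarrow> 'c set"
    using that
  proof (induction V)
    case (insert v V)
    have "sq_int N (indicator (B v) :: 'c \<Rightarrow> complex)"
      using insert by (intro N.sq_int_bounded[where C = 1]) (auto simp: indicator_def)
    then have "ae_class N (\<lambda>\<omega>. v * indicator (B v) \<omega> + (\<Sum>v\<in>V. v * indicator (B v) \<omega>)) \<in> S \<and>
        sq_int N (\<lambda>\<omega>. v * indicator (B v) \<omega> + (\<Sum>v\<in>V. v * indicator (B v) \<omega>))"
      using insert.IH insert.prems by (intro conjI add scale sq_int_add sq_int_scale ind) simp_all
    then show ?case by (simp only: sum.insert[OF insert.hyps])
  qed (simp add: zero)
  obtain F where F: "\<And>i. simple_function N (F i)" "\<And>\<omega>. \<omega> \<in> space N \<Longrightarrow> (\<lambda>i. F i \<omega>) \<longlonglongrightarrow> f \<omega>"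
      "\<And>i \<omega>. \<omega> \<in> space N \<Longrightarrow> dist (F i \<omega>) 0 \<le> 2 * dist (f \<omega>) 0"
    using borel_measurable_implies_sequence_metric[OF sq_int_measurable[OF f], of 0] by metis
  have [measurable]: "f \<in> borel_measurable N" "F i \<in> borel_measurable N" for i
    using f F(1)[of i] by (auto intro: borel_measurable_simple_function)
  have FS: "ae_class N (F i) \<in> S \<and> sq_int N (F i)" for i
  proof -
    let ?V = "F i ` space N" and ?B = "\<lambda>v. F i -` {v} \<inter> space N"
    let ?G = "\<lambda>\<omega>. \<Sum>v\<in>?V. v * indicator (?B v) \<omega>"
    have fin: "finite ?V" and B: "\<And>v. v \<in> ?V \<Longrightarrow> ?B v \<in> sets N"
      using F(1)[of i] by (auto simp: simple_function_def)
    have "?G \<omega> = F i \<omega>" if "\<omega> \<in> space N" for \<omega>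
    proof -
      have "?G \<omega> = (\<Sum>v\<in>?V. if v = F i \<omega> then v else 0)"
        using that by (intro sum.cong) (auto simp: indicator_def)
      then show ?thesis using that fin by simp
    qed
    then have ae: "AE \<omega> in N. F i \<omega> = ?G \<omega>" by auto
    note G = sums[OF fin B]
    have "sq_int N (F i)"
      by (rule sq_int_cong_AE[OF conjunct2[OF G] _ ae]) measurable
    moreover have "ae_class N (F i) \<in> S"
      using conjunct1[OF G] by (simp only: ae_class_eqI[OF ae])
    ultimately show ?thesis by blast
  qed
  have "(\<lambda>n. \<integral>\<omega>. (cmod (F n \<omega> - f \<omega>))\<^sup>2 \<partial>N) \<longlonglongrightarrow> (\<integral>\<omega>. 0 \<partial>N)"
  \<comment> \<open>The approximants satisfy |F| \<le> 2|f|, so |F - f| \<le> 3|f|, and squaring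
    gives the constant 9.\<close>
  proof (rule integral_dominated_convergence[where w = "\<lambda>\<omega>. 9 * (cmod (f \<omega>))\<^sup>2"])
    show "AE \<omega> in N. (\<lambda>n. (cmod (F n \<omega> - f \<omega>))\<^sup>2) \<longlonglongrightarrow> 0"
    proof (rule AE_I2)
      fix \<omega> assume "\<omega> \<in> space N"
      from F(2)[OF this] show "(\<lambda>n. (cmod (F n \<omega> - f \<omega>))\<^sup>2) \<longlonglongrightarrow> 0"
        by (intro tendsto_eq_intros) auto
    qed
    show "AE \<omega> in N. norm ((cmod (F n \<omega> - f \<omega>))\<^sup>2) \<le> 9 * (cmod (f \<omega>))\<^sup>2" for n
    proof (rule AE_I2)
      fix \<omega> assume "\<omega> \<in> space N"
      then have "cmod (F n \<omega> - f \<omega>) \<le> 3 * cmod (f \<omega>)"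
        using F(3)[of \<omega> n] norm_triangle_ineq4[of "F n \<omega>" "f \<omega>"] by (simp add: dist_norm)
      then show "norm ((cmod (F n \<omega> - f \<omega>))\<^sup>2) \<le> 9 * (cmod (f \<omega>))\<^sup>2"
        using power_mono[of "cmod (F n \<omega> - f \<omega>)" "3 * cmod (f \<omega>)" 2] by (simp add: power_mult_distrib)
    qed
  qed (use f in auto)
  then show ?thesis
    by (intro lim[OF conjunct2[OF FS] f conjunct1[OF FS]]) simp
qed

end

section \<open>Bounded vectors\<close>

lemma std_bimodule_simps [simp]:
  "lact (std_bimodule \<mu>) = cls_mult \<mu>" "ract (std_bimodule \<mu>) = cls_mult \<mu>"
  by (simp_all add: std_bimodule_def cspace.defs bimodule.defs)

lemma tau_half_eq: "x \<in> Linf \<mu> \<Longrightarrow> tau_half \<mu> x = x"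
  by (auto elim!: LinfE simp: tau_half_def cls_one_def cls_mult_class)

context prob_space
begin

lemma Linf_L2: "x \<in> Linf M \<Longrightarrow> x \<in> carr (L2 M)"
  by (auto elim!: LinfE intro!: L2_class sq_int_bounded)

lemma L2_hilbert: "hilbert (L2 M)"
  by unfold_locales (rule hilbert_space_L2)

text \<open>Truncations at height \<open>n\<close> converge pointwise, and the squared error is
  dominated by |f|^2.\<close>

lemma Linf_dense:
  assumes "u \<in> carr (L2 M)"
  shows "\<exists>X. (\<forall>n. X n \<in> Linf M) \<and> hilbert.vlim (L2 M) X u"
proof -
  interpret L: hilbert "L2 M" by (rule L2_hilbert)
  obtain f where f: "sq_int M f" "u = ae_class M f" using assms by (rule L2E)
  have [measurable]: "f \<in> borel_measurable M" using f by simp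
  define F where "F n x = (if cmod (f x) \<le> real n then f x else 0)" for n :: nat and x
  have [measurable]: "F n \<in> borel_measurable M" for n unfolding F_def by measurable
  have sq: "sq_int M (F n)" for n
    by (rule sq_int_bounded[where C = "real n"]) (auto simp: F_def)
  have "(\<lambda>n. \<integral>x. (cmod (F n x - f x))\<^sup>2 \<partial>M) \<longlonglongrightarrow> (\<integral>x. 0 \<partial>M)"
  proof (rule integral_dominated_convergence[where w = "\<lambda>x. (cmod (f x))\<^sup>2"])
    show "AE x in M. (\<lambda>n. (cmod (F n x - f x))\<^sup>2) \<longlonglongrightarrow> 0"
    proof (rule AE_I2)
      fix x
      obtain m :: nat where m: "cmod (f x) \<le> real m" using real_arch_simple by blast
      have "(cmod (F n x - f x))\<^sup>2 = 0" if "n \<ge> m" for n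
        using m that order.trans[OF m, of "real n"] by (simp add: F_def)
      then show "(\<lambda>n. (cmod (F n x - f x))\<^sup>2) \<longlonglongrightarrow> 0"
        by (intro tendsto_eventually) (auto simp: eventually_sequentially)
    qed
  qed (use f in \<open>auto simp: F_def\<close>)
  then have "(\<lambda>n. vdist (L2 M) (ae_class M (F n)) u) \<longlonglongrightarrow> 0"
    using tendsto_real_sqrt by (fastforce simp: f(2) L2_dist)
  then have "L.vlim (\<lambda>n. ae_class M (F n)) u"
    using sq assms by (simp add: L.vlim_def L2_class)
  moreover have "ae_class M (F n) \<in> Linf M" for n
    by (rule LinfI[where C = "real n"]) (auto simp: F_def)
  ultimately show ?thesis by (auto intro!: exI[of _ "\<lambda>n. ae_class M (F n)"])
qed

lemma bounded_op_unique:
  assumes H: "hilbert H" and P: "bounded_op (L2 M) H P" and Q: "bounded_op (L2 M) H Q"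
    and eq: "\<And>x. x \<in> Linf M \<Longrightarrow> P x = Q x" and u: "u \<in> carr (L2 M)"
  shows "P u = Q u"
proof -
  interpret H: hilbert H by fact
  obtain X where X: "\<And>n. X n \<in> Linf M" "hilbert.vlim (L2 M) X u"
    using Linf_dense[OF u] by blast
  have "H.vlim (\<lambda>n. P (X n)) (P u)" "H.vlim (\<lambda>n. P (X n)) (Q u)"
    using bounded_op_vlim[OF L2_hilbert H P X(2)] bounded_op_vlim[OF L2_hilbert H Q X(2)]
    by (simp_all add: eq X(1))
  then show ?thesis by (rule H.vlim_unique)
qed

text \<open>\<open>pi_tau\<close> is a definite description among extensional maps. Restricting
  \<open>P\<close> gives existence, and uniqueness holds because a bounded operator is determined by
  its values on the dense subspace of bounded functions.\<close>

lemma pi_tau_eqI: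
  assumes H: "hilbert H" and P: "bounded_op (L2 M) H P" and Px: "\<And>x. x \<in> Linf M \<Longrightarrow> P x = ract H \<xi> x"
    and u: "u \<in> carr (L2 M)"
  shows "pi_tau M H \<xi> u = P u"
proof -
  let ?P = "restrict P (carr (L2 M))"
  let ?C = "\<lambda>P. P \<in> extensional (carr (L2 M)) \<and> bounded_op (L2 M) H P \<and>
     (\<forall>x\<in>Linf M. P (tau_half M x) = ract H \<xi> x)"
  interpret L: hilbert "L2 M" by (rule L2_hilbert)
  have "?C ?P"
    using P Px L.add_closed L.scale_closed by (auto simp: bounded_op_def tau_half_eq Linf_L2)
  moreover have "Q = ?P" if "?C Q" for Q
  proof (rule extensionalityI[of _ "carr (L2 M)"])
    show "Q v = ?P v" if "v \<in> carr (L2 M)" for v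
    proof -
      have "Q v = P v"
        using \<open>?C Q\<close> Px by (intro bounded_op_unique[OF H _ P _ that]) (auto simp: tau_half_eq)
      then show ?thesis using that by simp
    qed
  qed (use that in auto)
  ultimately have "pi_tau M H \<xi> = ?P"
    unfolding pi_tau_def by (rule the_equality)
  then show ?thesis using u by simp
qed

text \<open>A candidate \<open>m\<close> is confirmed by its matrix elements between arbitrary
  vectors: they determine the value of the adjoint, so neither the adjoint nor the operators behind
  \<open>pi_tau\<close> need be constructed again at each use.\<close>

lemma tau_inner_eqI:
  assumes H: "hilbert H"
    and P: "bounded_op (L2 M) H P" "\<And>x. x \<in> Linf M \<Longrightarrow> P x = ract H \<xi> x"
    and Q: "bounded_op (L2 M) H Q" "\<And>x. x \<in> Linf M \<Longrightarrow> Q x = ract H \<zeta> x"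
    and m: "m \<in> Linf M"
    and ip: "\<And>f g. f \<in> carr (L2 M) \<Longrightarrow> g \<in> carr (L2 M) \<Longrightarrow> vip H (P f) (Q g) = vip (L2 M) f (cls_mult M m g)"
  shows "tau_inner M H \<xi> \<zeta> = m"
proof -
  interpret H: hilbert H by fact
  interpret L: hilbert "L2 M" by (rule L2_hilbert)
  have mg: "cls_mult M m g \<in> carr (L2 M)" if "g \<in> carr (L2 M)" for g
  proof -
    obtain b C where b: "b \<in> borel_measurable M" "\<And>x. cmod (b x) \<le> C" "m = ae_class M b"
      using LinfE[OF m] by metis
    obtain f where f: "sq_int M f" "g = ae_class M f"
      using \<open>g \<in> carr (L2 M)\<close> by (rule L2E)
    show ?thesis
      using b f by (auto simp: cls_mult_class intro!: L2_class sq_int_bounded_mult[where C = C])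
  qed
  have adj: "adjoint_op (L2 M) H (pi_tau M H \<xi>) (pi_tau M H \<zeta> g) = cls_mult M m g"
    if g: "g \<in> carr (L2 M)" for g
    unfolding adjoint_op_def
  proof (rule the_equality)
    have Qg: "Q g \<in> carr H" and Pu: "\<And>u. u \<in> carr (L2 M) \<Longrightarrow> P u \<in> carr H"
      using P(1) Q(1) g by (auto simp: bounded_op_def)
    have *: "vip (L2 M) (cls_mult M m g) u = vip H (pi_tau M H \<zeta> g) (pi_tau M H \<xi> u)"
      if u: "u \<in> carr (L2 M)" for u
    proof -
      have "vip (L2 M) (cls_mult M m g) u = cnj (vip (L2 M) u (cls_mult M m g))"
        by (rule L.ip_cnj[OF u mg[OF g]])
      also have "\<dots> = cnj (vip H (P u) (Q g))" by (simp add: ip[OF u g])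
      also have "\<dots> = vip H (Q g) (P u)" by (rule H.ip_cnj[OF Pu[OF u] Qg, symmetric])
      finally show ?thesis
        by (simp add: pi_tau_eqI[OF H P u] pi_tau_eqI[OF H Q g])
    qed
    show "cls_mult M m g \<in> carr (L2 M) \<and> (\<forall>u\<in>carr (L2 M). vip (L2 M) (cls_mult M m g) u =
        vip H (pi_tau M H \<zeta> g) (pi_tau M H \<xi> u))"
      using * mg[OF g] by blast
    fix v assume v: "v \<in> carr (L2 M) \<and> (\<forall>u\<in>carr (L2 M). vip (L2 M) v u =
        vip H (pi_tau M H \<zeta> g) (pi_tau M H \<xi> u))"
    \<comment> \<open>The difference of two candidates is orthogonal to every vector, in particular
      to itself.\<close>
    define w where "w = L.dif v (cls_mult M m g)"
    have c: "v \<in> carr (L2 M)" "cls_mult M m g \<in> carr (L2 M)" "w \<in> carr (L2 M)"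
      using v mg[OF g] L.add_closed L.scale_closed unfolding w_def by blast+
    have "vip (L2 M) w w = vip (L2 M) v w + cnj (-1) * vip (L2 M) (cls_mult M m g) w"
      by (subst (1) w_def) (simp only: L.ip_add_left L.ip_scale_left L.scale_closed c)
    also have "\<dots> = 0" using v * c by simp
    finally have "vdist (L2 M) v (cls_mult M m g) = 0"
      unfolding vdist_def w_def[symmetric] vnorm_def by simp
    then show "v = cls_mult M m g" using c L.dist_eq_0 by blast
  qed
  show ?thesis
    unfolding tau_inner_def
  proof (rule the_equality)
    show "m \<in> Linf M \<and> (\<forall>f\<in>carr (L2 M). lact (std_bimodule M) m f =
        adjoint_op (L2 M) H (pi_tau M H \<xi>) (pi_tau M H \<zeta> f))"
      using m adj by simp
    fix m' assume m': "m' \<in> Linf M \<and> (\<forall>f\<in>carr (L2 M). lact (std_bimodule M) m' f =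
        adjoint_op (L2 M) H (pi_tau M H \<xi>) (pi_tau M H \<zeta> f))"
    \<comment> \<open>A multiplier is recovered from its value on the constant function 1.\<close>
    have "cls_mult M m' (cls_one M) = cls_mult M m (cls_one M)"
      using m' adj Linf_L2[OF cls_one_Linf] by simp
    moreover have "cls_mult M x (cls_one M) = x" if "x \<in> Linf M" for x
      using that by (auto elim!: LinfE simp: cls_one_def cls_mult_class)
    ultimately show "m' = m" using m m' by simp
  qed
qed

end

section \<open>Completions of symbols over a one-step extension\<close>

lemma bimodule_isoE:
  assumes "bimodule_iso \<mu> H K"
  obtains U V where "wstar_bimodule \<mu> H" "wstar_bimodule \<mu> K" "bounded_op H K U" "bounded_op K H V"
    "\<And>u. u \<in> carr H \<Longrightarrow> V (U u) = u" "\<And>v. v \<in> carr K \<Longrightarrow> U (V v) = v"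
    "\<And>u v. u \<in> carr H \<Longrightarrow> v \<in> carr H \<Longrightarrow> vip H u v = vip K (U u) (U v)"
    "\<And>a u. a \<in> Linf \<mu> \<Longrightarrow> u \<in> carr H \<Longrightarrow> U (lact H a u) = lact K a (U u)"
    "\<And>a u. a \<in> Linf \<mu> \<Longrightarrow> u \<in> carr H \<Longrightarrow> U (ract H u a) = ract K (U u) a"
proof -
  have HK: "wstar_bimodule \<mu> H" "wstar_bimodule \<mu> K" using assms by (auto simp: bimodule_iso_def)
  interpret H: hilbert H by unfold_locales (use HK in \<open>simp add: wstar_bimodule_def\<close>)
  obtain U where bij: "bij_betw U (carr H) (carr K)" and U: "bounded_op H K U"
    and ip: "\<And>u v. u \<in> carr H \<Longrightarrow> v \<in> carr H \<Longrightarrow> vip H u v = vip K (U u) (U v)"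
    and la: "\<And>a u. a \<in> Linf \<mu> \<Longrightarrow> u \<in> carr H \<Longrightarrow> U (lact H a u) = lact K a (U u)"
    and ra: "\<And>a u. a \<in> Linf \<mu> \<Longrightarrow> u \<in> carr H \<Longrightarrow> U (ract H u a) = ract K (U u) a"
    using assms unfolding bimodule_iso_def by metis
  define V where "V = inv_into (carr H) U"
  have VU: "V (U u) = u" if "u \<in> carr H" for u
    using bij that by (simp add: V_def bij_betw_def)
  have UV: "U (V v) = v" "V v \<in> carr H" if "v \<in> carr K" for v
    using bij that unfolding V_def bij_betw_def by (metis f_inv_into_f, metis inv_into_into)
  have "vnorm H (V v) = vnorm K v" if "v \<in> carr K" for v
    using ip[OF UV(2) UV(2)] that by (simp add: vnorm_def UV)
  moreover have "V (vadd K v w) = vadd H (V v) (V w)" if "v \<in> carr K" "w \<in> carr K" for v w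
  proof -
    have "vadd K v w = U (vadd H (V v) (V w))" using U that by (simp add: bounded_op_def UV)
    then show ?thesis using that by (simp add: VU UV)
  qed
  moreover have "V (vscale K a v) = vscale H a (V v)" if "v \<in> carr K" for a v
  proof -
    have "vscale K a v = U (vscale H a (V v))" using U that by (simp add: bounded_op_def UV)
    then show ?thesis using that by (simp add: VU UV)
  qed
  ultimately have "bounded_op K H V"
    unfolding bounded_op_def by (auto simp: UV intro!: exI[of _ 1])
  then show ?thesis
    using that[OF HK U _ VU UV(1) ip la ra] by blast
qed

lemma measure_preserving_comp:
  assumes "measure_preserving N N' f" "measure_preserving N' \<mu> g"
  shows "measure_preserving N \<mu> (\<lambda>x. g (f x))"
proof -
  interpret f: measure_preserving N N' f by fact
  interpret g: measure_preserving N' \<mu> g by fact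
  have "distr N \<mu> (\<lambda>x. g (f x)) = distr (distr N N' f) \<mu> g"
    by (subst distr_distr) (simp_all add: comp_def)
  then have "distr N \<mu> (\<lambda>x. g (f x)) = \<mu>" by (simp only: f.distr_q g.distr_q)
  then show ?thesis
    by (intro measure_preserving.intro measure_preserving_axioms.intro f.N.prob_space_axioms g.prob_space_axioms) measurable
qed

section \<open>Kernels as operators and symbols read as functions\<close>

context markov_ext
begin

interpretation N: prob_space N by (rule prob_space_ext)
interpretation h0: measure_preserving N \<mu> h0 by (rule measure_preserving_h0)
interpretation sh: measure_preserving N N' sh by (rule measure_preserving_sh)

lemma kernel_mult_cong_AE:
  "AE w in N'. \<eta> w = \<eta>' w \<Longrightarrow> AE \<omega> in N. kernel_mult f \<eta> \<omega> = kernel_mult f \<eta>' \<omega>"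
  by (drule sh.AE_comp) (auto simp: kernel_mult_def)

definition kernel_op :: "('a \<Rightarrow> 'a \<Rightarrow> complex) \<Rightarrow> ('b \<Rightarrow> complex) set \<Rightarrow> ('c \<Rightarrow> complex) set" where
  "kernel_op f u = ae_class N (kernel_mult f (ae_rep u))"

lemma kernel_op_class:
  "\<eta> \<in> borel_measurable N' \<Longrightarrow> kernel_op f (ae_class N' \<eta>) = ae_class N (kernel_mult f \<eta>)"
  unfolding kernel_op_def by (intro ae_class_eqI kernel_mult_cong_AE AE_ae_rep)

lemma bounded_op_kernel_op:
  assumes f: "bdd_kernel f"
  shows "bounded_op (L2 N') (L2 N) (kernel_op f)"
proof -
  have [measurable]: "case_prod f \<in> borel_measurable (\<mu> \<Otimes>\<^sub>M \<mu>)" using f by (simp add: bdd_kernel_def)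
  obtain C where C: "\<And>\<eta>. sq_int N' \<eta> \<Longrightarrow>
      (\<integral>\<omega>. (cmod (kernel_mult f \<eta> \<omega>))\<^sup>2 \<partial>N) \<le> C * (\<integral>w. (cmod (\<eta> w))\<^sup>2 \<partial>N')"
    using sq_int_kernel_mult(2)[OF f sq_int_zero] by blast
  have km_add: "kernel_mult f (\<lambda>w. \<eta> w + \<eta>' w) = (\<lambda>\<omega>. kernel_mult f \<eta> \<omega> + kernel_mult f \<eta>' \<omega>)" for \<eta> \<eta>'
    by (simp add: fun_eq_iff kernel_mult_def distrib_left)
  have km_scale: "kernel_mult f (\<lambda>w. a * \<eta> w) = (\<lambda>\<omega>. a * kernel_mult f \<eta> \<omega>)" for a \<eta>
    by (simp add: fun_eq_iff kernel_mult_def)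
  have "kernel_op f u \<in> carr (L2 N)" if "u \<in> carr (L2 N')" for u
    using that f by (auto elim!: L2E simp: kernel_op_class intro!: L2_class sq_int_kernel_mult)
  moreover have "kernel_op f (cls_add N' u v) = cls_add N (kernel_op f u) (kernel_op f v)"
    if "u \<in> carr (L2 N')" "v \<in> carr (L2 N')" for u v
    using that by (auto elim!: L2E simp: cls_add_class kernel_op_class km_add)
  moreover have "kernel_op f (cls_scale N' a u) = cls_scale N a (kernel_op f u)"
    if "u \<in> carr (L2 N')" for u a
    using that by (auto elim!: L2E simp: cls_scale_class kernel_op_class km_scale)
  moreover have "vnorm (L2 N) (kernel_op f u) \<le> sqrt C * vnorm (L2 N') u" if "u \<in> carr (L2 N')" for u
  proof -
    obtain \<eta> where \<eta>: "sq_int N' \<eta>" "u = ae_class N' \<eta>" using \<open>u \<in> carr (L2 N')\<close> by (rule L2E)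
    then have "vnorm (L2 N) (kernel_op f u) = sqrt (\<integral>\<omega>. (cmod (kernel_mult f \<eta> \<omega>))\<^sup>2 \<partial>N)"
      by (simp add: kernel_op_class L2_norm)
    also have "\<dots> \<le> sqrt (C * (\<integral>w. (cmod (\<eta> w))\<^sup>2 \<partial>N'))"
      using C[OF \<eta>(1)] by (rule real_sqrt_le_mono)
    finally show ?thesis using \<eta> by (simp add: L2_norm real_sqrt_mult)
  qed
  ultimately show ?thesis unfolding bounded_op_def L2_simps by blast
qed

text \<open>The common pattern of both tensor products: a symbol \<open>d\<close> is read as the
  function \<open>fk d\<close> of the new point and its attachment point, times the function
  \<open>et d\<close> of the old part. \<open>B\<close>, \<open>l\<close> and \<open>r\<close> say
  that the form and the actions agree with those of functions, and \<open>rect\<close> makes the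
  range total. The equalities are almost everywhere because they involve chosen representatives of
  classes.\<close>

theorem sep_completion_coord_L2:
  fixes D :: "'g gen set" and fk :: "'g gen \<Rightarrow> 'a \<Rightarrow> 'a \<Rightarrow> complex" and et :: "'g gen \<Rightarrow> 'b \<Rightarrow> complex"
  assumes r': "measure_preserving N' \<mu> r'"
    and fk: "\<And>d. d \<in> D \<Longrightarrow> bdd_kernel (fk d)" and et: "\<And>d. d \<in> D \<Longrightarrow> sq_int N' (et d)"
    and B: "\<And>d d'. d \<in> D \<Longrightarrow> d' \<in> D \<Longrightarrow>
      B d d' = (\<integral>w. cnj (et d w) * (kernel_inner (fk d) (fk d') (e w) * et d' w) \<partial>N')"
    and rect: "\<And>P Q. P \<in> sets \<mu> \<Longrightarrow> Q \<in> sets N' \<Longrightarrow>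
      \<exists>d\<in>D. AE \<omega> in N. kernel_mult (fk d) (et d) \<omega> = indicator P (h0 \<omega>) * indicator Q (sh \<omega>)"
    and l: "\<And>a d. a \<in> Linf \<mu> \<Longrightarrow> d \<in> D \<Longrightarrow> l a d \<in> D \<and>
      (AE \<omega> in N. kernel_mult (fk (l a d)) (et (l a d)) \<omega> = ae_rep a (h0 \<omega>) * kernel_mult (fk d) (et d) \<omega>)"
    and r: "\<And>a d. a \<in> Linf \<mu> \<Longrightarrow> d \<in> D \<Longrightarrow> r d a \<in> D \<and>
      (AE \<omega> in N. kernel_mult (fk (r d a)) (et (r d a)) \<omega> = kernel_mult (fk d) (et d) \<omega> * ae_rep a (r' (sh \<omega>)))"
  shows "bimodule_iso \<mu> (sep_completion D B l r) (coord_L2 N h0 (\<lambda>\<omega>. r' (sh \<omega>)))"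
proof -
  define J where "J d = ae_class N (kernel_mult (fk d) (et d))" for d
  let ?K = "coord_L2 N h0 (\<lambda>\<omega>. r' (sh \<omega>))"
  have sq: "sq_int N (kernel_mult (fk d) (et d))" if "d \<in> D" for d
    using that by (intro sq_int_kernel_mult fk et)
  have J: "J d \<in> carr ?K" if "d \<in> D" for d
    using sq[OF that] by (simp add: J_def)
  interpret K: hilbert ?K
    by unfold_locales (use N.hilbert_space_L2 in simp)
  have dense: "v \<in> K.lin_closure D J" if v: "v \<in> carr ?K" for v
  proof -
    obtain f where f: "sq_int N f" "v = ae_class N f" using v by (auto simp: L2_carr)
    show ?thesis
      unfolding f(2)
    proof (rule rectangles_total[OF _ _ _ _ f(1)])
      fix f g assume "sq_int N f" "sq_int N g" "ae_class N f \<in> K.lin_closure D J" "ae_class N g \<in> K.lin_closure D J"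
      then show "ae_class N (\<lambda>\<omega>. f \<omega> + g \<omega>) \<in> K.lin_closure D J"
        using K.lin_closure_add[OF J, where u = "ae_class N f" and v = "ae_class N g"]
        by (simp add: cls_add_class)
    next
      fix f a assume "sq_int N f" "ae_class N f \<in> K.lin_closure D J"
      then show "ae_class N (\<lambda>\<omega>. a * f \<omega>) \<in> K.lin_closure D J"
        using K.lin_closure_scale[OF J, where u = "ae_class N f" and a = a] by (simp add: cls_scale_class)
    next
      fix f X assume X: "\<And>n::nat. sq_int N (X n)" "sq_int N f" "\<And>n. ae_class N (X n) \<in> K.lin_closure D J"
        "(\<lambda>n. \<integral>\<omega>. (cmod (X n \<omega> - f \<omega>))\<^sup>2 \<partial>N) \<longlonglongrightarrow> 0"
      have "(\<lambda>n. vdist ?K (ae_class N (X n)) (ae_class N f)) \<longlonglongrightarrow> 0"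
        using tendsto_real_sqrt[OF X(4)] X(1,2) by (simp add: L2_dist)
      then show "ae_class N f \<in> K.lin_closure D J"
        using X(2) by (intro K.lin_closure_lim[OF J X(3)]) simp_all
    next
      fix P Q assume "P \<in> sets \<mu>" "Q \<in> sets N'"
      then obtain d where d: "d \<in> D"
        "AE \<omega> in N. kernel_mult (fk d) (et d) \<omega> = indicator P (h0 \<omega>) * indicator Q (sh \<omega>)"
        using rect by blast
      have "ae_class N (\<lambda>\<omega>. indicator P (h0 \<omega>) * indicator Q (sh \<omega>)) = J d"
        unfolding J_def by (rule ae_class_eqI[OF d(2), symmetric])
      then show "ae_class N (\<lambda>\<omega>. indicator P (h0 \<omega>) * indicator Q (sh \<omega>)) \<in> K.lin_closure D J"
        using K.lin_closure_base[OF J d(1)] by simp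
    qed
  qed
  show ?thesis
  proof (rule sep_completion_iso[where J = J])
    show "wstar_bimodule \<mu> ?K"
      by (intro wstar_bimodule_coord_L2 measure_preserving_h0 measure_preserving_comp[OF measure_preserving_sh r'])
    show "J d \<in> carr ?K" if "d \<in> D" for d by (rule J[OF that])
    show "B d d' = vip ?K (J d) (J d')" if "d \<in> D" "d' \<in> D" for d d'
      using that sq[of d] sq[of d'] by (simp add: J_def L2_ip B inner_kernel_mult fk et)
    show "\<exists>xs. snd ` set xs \<subseteq> D \<and> vdist ?K (lincomb ?K J xs) v < \<epsilon>" if "v \<in> carr ?K" "\<epsilon> > 0" for v \<epsilon>
      using dense[OF that(1)] that(2) unfolding K.lin_closure_def by blast
    show "l a d \<in> D \<and> J (l a d) = lact ?K a (J d)" if a: "a \<in> Linf \<mu>" and d: "d \<in> D" for a d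
    proof
      show "l a d \<in> D" using l[OF a d] by simp
      have "AE \<omega> in N. kernel_mult (fk (l a d)) (et (l a d)) \<omega> = ae_rep a (h0 \<omega>) * ae_rep (J d) \<omega>"
        using l[OF a d, THEN conjunct2] AE_ae_rep[OF sq_int_measurable[OF sq[OF d]]]
        unfolding J_def by eventually_elim simp
      then show "J (l a d) = lact ?K a (J d)"
        unfolding coord_L2_simps by (subst J_def) (rule ae_class_eqI)
    qed
    show "r d a \<in> D \<and> J (r d a) = ract ?K (J d) a" if a: "a \<in> Linf \<mu>" and d: "d \<in> D" for a d
    proof
      show "r d a \<in> D" using r[OF a d] by simp
      have "AE \<omega> in N. kernel_mult (fk (r d a)) (et (r d a)) \<omega> = ae_rep (J d) \<omega> * ae_rep a (r' (sh \<omega>))"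
        using r[OF a d, THEN conjunct2] AE_ae_rep[OF sq_int_measurable[OF sq[OF d]]]
        unfolding J_def by eventually_elim simp
      then show "J (r d a) = ract ?K (J d) a"
        unfolding coord_L2_simps by (subst J_def) (rule ae_class_eqI)
    qed
  qed
qed

text \<open>A kernel that ignores the attachment point is averaged against a probability density, so
  its fibre integrals are at most \<open>C\<^sup>2\<close>.\<close>

lemma bdd_kernel_Linf:
  assumes [measurable]: "b \<in> borel_measurable \<mu>" and C: "AE y in \<mu>. cmod (b y) \<le> C"
  shows "bdd_kernel (\<lambda>y x. b y)"
  unfolding bdd_kernel_def
proof (intro conjI exI[of _ "C\<^sup>2"] AE_I2)
  fix x
  have "(\<integral>\<^sup>+y. ennreal (k y x) * ennreal ((cmod (b y))\<^sup>2) \<partial>\<mu>) \<le> (\<integral>\<^sup>+y. ennreal (k x y) * ennreal (C\<^sup>2) \<partial>\<mu>)"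
    using C by (intro nn_integral_mono_AE)
      (auto simp: k_sym[of x] elim!: eventually_mono intro!: mult_left_mono ennreal_leI power_mono)
  also have "\<dots> \<le> ennreal (C\<^sup>2)" if "x \<in> space \<mu>"
    using that by (subst nn_integral_multc) (auto simp: k_int)
  finally show "(\<integral>\<^sup>+y. ennreal (k y x) * ennreal ((cmod (b y))\<^sup>2) \<partial>\<mu>) \<le> ennreal (C\<^sup>2)" if "x \<in> space \<mu>"
    using that by simp
qed auto

end

section \<open>Heat tensors and relative tensor products\<close>

context prob_space
begin

text \<open>The hypothesis is tested on the set where \<phi> exceeds \<open>C\<close>: the excess
  has integral 0 there, so that set is null.\<close>

lemma AE_le_of_nn_integral_le:
  fixes \<phi> :: "'a \<Rightarrow> ennreal"
  assumes [measurable]: "\<phi> \<in> borel_measurable M"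
    and le: "\<And>A. A \<in> sets M \<Longrightarrow> (\<integral>\<^sup>+x. \<phi> x * indicator A x \<partial>M) \<le> ennreal C * emeasure M A"
  shows "AE x in M. \<phi> x \<le> ennreal C"
proof -
  define A where "A = {x \<in> space M. ennreal C < \<phi> x}"
  have [measurable]: "A \<in> sets M" unfolding A_def by measurable
  have int_C: "(\<integral>\<^sup>+x. ennreal C * indicator A x \<partial>M) = ennreal C * emeasure M A"
    by (rule nn_integral_cmult_indicator) measurable
  \<comment> \<open>The integral of a difference in \<open>ennreal\<close> splits only for a
    subtrahend with finite integral.\<close>
  have fin: "(\<integral>\<^sup>+x. ennreal C * indicator A x \<partial>M) \<noteq> \<infinity>"
    unfolding int_C by (simp add: ennreal_mult_eq_top_iff)
  have lt: "(\<integral>\<^sup>+x. \<phi> x * indicator A x \<partial>M) < top"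
    by (rule le_less_trans[OF le]) (use fin in \<open>auto simp: int_C less_top\<close>)
  have "(\<integral>\<^sup>+x. (\<phi> x - ennreal C) * indicator A x \<partial>M) = (\<integral>\<^sup>+x. \<phi> x * indicator A x - ennreal C * indicator A x \<partial>M)"
    by (intro nn_integral_cong) (auto simp: indicator_def)
  also have "\<dots> = (\<integral>\<^sup>+x. \<phi> x * indicator A x \<partial>M) - (\<integral>\<^sup>+x. ennreal C * indicator A x \<partial>M)"
    by (rule nn_integral_diff[OF _ _ fin]) (measurable, auto simp: A_def indicator_def)
  also have "\<dots> = 0"
    using le[of A] lt by (simp add: int_C diff_eq_0_ennreal)
  finally have "AE x in M. (\<phi> x - ennreal C) * indicator A x = 0"
    by (subst (asm) nn_integral_0_iff_AE) auto
  then show ?thesis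
    using AE_space by eventually_elim (auto simp: A_def indicator_def intro: ennreal_minus_eq_0 split: if_splits)
qed

end

text \<open>The two-point space, seen as a one-step extension of \<open>\<mu>\<close> itself. The evaluation map is the
  constant \<open>id\<close> because a measurability rule for \<open>\<lambda>x. x\<close> would loop.\<close>
locale markov_pair = markov_ext \<mu> \<mu> id k N h0 sh glue
  for \<mu> :: "'a measure" and k :: "'a \<Rightarrow> 'a \<Rightarrow> real" and N :: "'c measure" and h0 sh glue
begin

interpretation N: prob_space N by (rule prob_space_ext)
interpretation h0: measure_preserving N \<mu> h0 by (rule measure_preserving_h0)
interpretation sh: measure_preserving N \<mu> sh by (rule measure_preserving_sh)

lemma rep_cls_mult:
  assumes "a \<in> Linf \<mu>" "u \<in> carr (L2 \<mu>)"
  shows "AE x in \<mu>. ae_rep (cls_mult \<mu> a u) x = ae_rep a x * ae_rep u x"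
    and "cls_mult \<mu> a u \<in> carr (L2 \<mu>)" "cls_mult \<mu> u a = cls_mult \<mu> a u"
proof -
  obtain b C where b: "b \<in> borel_measurable \<mu>" "\<And>x. cmod (b x) \<le> C" "a = ae_class \<mu> b"
    using LinfE[OF assms(1)] by metis
  obtain f where f: "sq_int \<mu> f" "u = ae_class \<mu> f" using assms(2) by (rule L2E)
  have m: "(\<lambda>x. b x * f x) \<in> borel_measurable \<mu>" using b f by simp
  have eq: "cls_mult \<mu> (ae_class \<mu> b) (ae_class \<mu> f) = ae_class \<mu> (\<lambda>x. b x * f x)" using b f by (simp add: cls_mult_class)
  show "AE x in \<mu>. ae_rep (cls_mult \<mu> a u) x = ae_rep a x * ae_rep u x"
    using AE_ae_rep[OF m] AE_ae_rep[OF b(1)] AE_ae_rep[OF sq_int_measurable[OF f(1)]]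
    unfolding b(3) f(2) eq by eventually_elim simp
  show "cls_mult \<mu> a u \<in> carr (L2 \<mu>)"
    unfolding b(3) f(2) eq using b f by (intro L2_class sq_int_bounded_mult[where C = C]) auto
  show "cls_mult \<mu> u a = cls_mult \<mu> a u"
    unfolding b(3) f(2) eq using b f by (simp add: cls_mult_class mult.commute)
qed

lemma Linf_rep:
  assumes "a \<in> Linf \<mu>"
  shows "ae_rep a \<in> borel_measurable \<mu>" "\<exists>C. AE x in \<mu>. cmod (ae_rep a x) \<le> C" "ae_class \<mu> (ae_rep a) = a"
proof -
  obtain b C where b: "b \<in> borel_measurable \<mu>" "\<And>x. cmod (b x) \<le> C" "a = ae_class \<mu> b"
    using LinfE[OF assms(1)] by metis
  show "ae_rep a \<in> borel_measurable \<mu>" "ae_class \<mu> (ae_rep a) = a"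
    using b by (simp_all add: ae_class_ae_rep ae_rep_measurable)
  show "\<exists>C. AE x in \<mu>. cmod (ae_rep a x) \<le> C"
    using AE_ae_rep[OF b(1)] b(2,3) by (intro exI[of _ C]) (auto elim!: eventually_mono)
qed

lemma indicator_Linf: "A \<in> sets \<mu> \<Longrightarrow> ae_class \<mu> (indicator A) \<in> Linf \<mu>"
  by (rule LinfI[where C = 1]) (auto simp: indicator_def)

text \<open>Here the old space is \<mu>, and the symbol of \<open>x\<close> and \<xi> is the
  function \<open>x(y) \<xi>(w)\<close>, so its kernel ignores the attachment point.\<close>

theorem heat_tensor_iso:
  assumes k: "k = p s"
  shows "bimodule_iso \<mu> (heat_tensor \<mu> p s) (coord_L2 N h0 sh)"
  unfolding heat_tensor_def
proof (rule sep_completion_coord_L2[of "\<lambda>x. x" _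
      "\<lambda>d y x. ae_rep (the_atom (fst d)) y" "\<lambda>d. ae_rep (the_atom (snd d))"])
  show "measure_preserving \<mu> \<mu> (\<lambda>x. x)" using e.measure_preserving_axioms by (simp add: id_def)
  let ?D = "Atom ` Linf \<mu> \<times> Atom ` carr (L2 \<mu>) :: ('a \<Rightarrow> complex) set gen set"
  show bk: "bdd_kernel (\<lambda>y x. ae_rep (the_atom (fst d)) y)" if "d \<in> ?D" for d
    using that Linf_rep bdd_kernel_Linf by fastforce
  show et: "sq_int \<mu> (ae_rep (the_atom (snd d)))" if "d \<in> ?D" for d
    using that by (auto intro: L2_rep)
  show "(case d of (x, \<xi>) \<Rightarrow> \<lambda>(y, \<eta>). vip (L2 \<mu>) (the_atom \<xi>)
        (lact (std_bimodule \<mu>)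
          (heat_Linf \<mu> p s (cls_mult \<mu> (cls_star \<mu> (the_atom x)) (the_atom y))) (the_atom \<eta>))) d' =
      (\<integral>w. cnj (ae_rep (the_atom (snd d)) w) *
        (kernel_inner (\<lambda>y x. ae_rep (the_atom (fst d)) y) (\<lambda>y x. ae_rep (the_atom (fst d')) y) (id w) *
          ae_rep (the_atom (snd d')) w) \<partial>\<mu>)"
    if d: "d \<in> ?D" and d': "d' \<in> ?D" for d d'
  proof -
    obtain x u where x: "x \<in> Linf \<mu>" "u \<in> carr (L2 \<mu>)" "d = (Atom x, Atom u)" using d by auto
    obtain y v where y: "y \<in> Linf \<mu>" "v \<in> carr (L2 \<mu>)" "d' = (Atom y, Atom v)" using d' by auto
    note [measurable] = Linf_rep(1)[OF x(1)] Linf_rep(1)[OF y(1)]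
    have uv: "sq_int \<mu> (ae_rep u)" "sq_int \<mu> (ae_rep v)" "ae_class \<mu> (ae_rep u) = u" "ae_class \<mu> (ae_rep v) = v"
      using L2_rep[OF x(2)] L2_rep[OF y(2)] by auto
    let ?z = "cls_mult \<mu> (cls_star \<mu> x) y" and ?m = "kernel_inner (\<lambda>y' _. ae_rep x y') (\<lambda>y' _. ae_rep y y')"
    have z: "?z = ae_class \<mu> (\<lambda>w. cnj (ae_rep x w) * ae_rep y w)"
      by (subst (1) Linf_rep(3)[OF x(1), symmetric], subst (1) Linf_rep(3)[OF y(1), symmetric])
        (simp add: cls_star_class cls_mult_class)
    have zr: "AE w in \<mu>. ae_rep ?z w = cnj (ae_rep x w) * ae_rep y w"
      unfolding z by (rule AE_ae_rep) measurable
    have zm [measurable]: "ae_rep ?z \<in> borel_measurable \<mu>"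
      unfolding z by measurable
    \<comment> \<open>\<open>heat_Linf\<close> integrates against \<open>p s w y'\<close> and the
      kernel inner product against \<open>k y' w\<close>; symmetry identifies them.\<close>
    have "heat_Linf \<mu> p s ?z = ae_class \<mu> ?m"
      unfolding heat_Linf_def
    proof (intro ae_class_eqI AE_I2)
      fix w assume w [measurable]: "w \<in> space \<mu>"
      show "(\<integral>y'. complex_of_real (p s w y') * ae_rep ?z y' \<partial>\<mu>) = ?m w"
        unfolding kernel_inner_def k[symmetric]
        using zr by (intro integral_cong_AE) (auto simp: k_sym[of w] elim!: eventually_mono)
    qed
    then have "vip (L2 \<mu>) u (cls_mult \<mu> (heat_Linf \<mu> p s ?z) v) =
        vip (L2 \<mu>) (ae_class \<mu> (ae_rep u)) (cls_mult \<mu> (ae_class \<mu> ?m) (ae_class \<mu> (ae_rep v)))"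
      by (simp only: uv)
    also have "\<dots> = (\<integral>w. cnj (ae_rep u w) * (?m w * ae_rep v w) \<partial>\<mu>)"
      using uv(1,2) by (subst cls_mult_class, simp, simp, subst L2_ip) simp_all
    finally show ?thesis by (simp add: x(3) y(3))
  qed
  show "\<exists>d\<in>?D. AE \<omega> in N. kernel_mult (\<lambda>y x. ae_rep (the_atom (fst d)) y) (ae_rep (the_atom (snd d))) \<omega> =
      indicator P (h0 \<omega>) * indicator Q (sh \<omega>)" if "P \<in> sets \<mu>" "Q \<in> sets \<mu>" for P Q
  proof
    let ?P = "ae_class \<mu> (indicator P :: 'a \<Rightarrow> complex)" and ?Q = "ae_class \<mu> (indicator Q :: 'a \<Rightarrow> complex)"
    show "(Atom ?P, Atom ?Q) \<in> ?D"
      using indicator_Linf[OF that(1)] e.N.Linf_L2[OF indicator_Linf[OF that(2)]] by auto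
    have "AE \<omega> in N. ae_rep ?P (h0 \<omega>) = indicator P (h0 \<omega>)" "AE \<omega> in N. ae_rep ?Q (sh \<omega>) = indicator Q (sh \<omega>)"
      using that by (auto intro!: h0.AE_comp sh.AE_comp AE_ae_rep)
    then show "AE \<omega> in N. kernel_mult (\<lambda>y x. ae_rep (the_atom (fst (Atom ?P, Atom ?Q))) y)
        (ae_rep (the_atom (snd (Atom ?P, Atom ?Q)))) \<omega> = indicator P (h0 \<omega>) * indicator Q (sh \<omega>)"
      by eventually_elim (simp add: kernel_mult_def)
  qed
  show "(case d of (x, \<xi>) \<Rightarrow> (Atom (cls_mult \<mu> a (the_atom x)), \<xi>)) \<in> ?D \<and>
      (AE \<omega> in N. kernel_mult (\<lambda>y x. ae_rep (the_atom (fst (case d of (x, \<xi>) \<Rightarrow> (Atom (cls_mult \<mu> a (the_atom x)), \<xi>)))) y)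
        (ae_rep (the_atom (snd (case d of (x, \<xi>) \<Rightarrow> (Atom (cls_mult \<mu> a (the_atom x)), \<xi>))))) \<omega> =
        ae_rep a (h0 \<omega>) * kernel_mult (\<lambda>y x. ae_rep (the_atom (fst d)) y) (ae_rep (the_atom (snd d))) \<omega>)"
    if a: "a \<in> Linf \<mu>" and d: "d \<in> ?D" for a d
  proof -
    obtain x u where x: "x \<in> Linf \<mu>" "u \<in> carr (L2 \<mu>)" "d = (Atom x, Atom u)" using d by auto
    show ?thesis
      using h0.AE_comp[OF rep_cls_mult(1)[OF a e.N.Linf_L2[OF x(1)]]] a x
      by (auto simp: kernel_mult_def elim!: eventually_mono)
  qed
  show "(case d of (x, \<xi>) \<Rightarrow> \<lambda>b. (x, Atom (ract (std_bimodule \<mu>) (the_atom \<xi>) b))) a \<in> ?D \<and>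
      (AE \<omega> in N. kernel_mult (\<lambda>y x. ae_rep (the_atom (fst ((case d of (x, \<xi>) \<Rightarrow> \<lambda>b. (x, Atom (ract (std_bimodule \<mu>) (the_atom \<xi>) b))) a))) y)
        (ae_rep (the_atom (snd ((case d of (x, \<xi>) \<Rightarrow> \<lambda>b. (x, Atom (ract (std_bimodule \<mu>) (the_atom \<xi>) b))) a)))) \<omega> =
        kernel_mult (\<lambda>y x. ae_rep (the_atom (fst d)) y) (ae_rep (the_atom (snd d))) \<omega> * ae_rep a (sh \<omega>))"
    if a: "a \<in> Linf \<mu>" and d: "d \<in> ?D" for a d
  proof -
    obtain x u where x: "x \<in> Linf \<mu>" "u \<in> carr (L2 \<mu>)" "d = (Atom x, Atom u)" using d by auto
    show ?thesis
      using sh.AE_comp[OF rep_cls_mult(1)[OF a x(2)]] rep_cls_mult(2,3)[OF a x(2)] a x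
      by (auto simp: kernel_mult_def mult_ac elim!: eventually_mono)
  qed
qed

end

text \<open>The same kernel \<open>k\<close> drives both extensions: \<open>N1\<close> carries a
  single edge, and \<open>N\<close> the paths obtained by attaching such an edge to
  \<open>N'\<close>. The relative tensor product of the spaces over \<open>N1\<close> and
  \<open>N'\<close> is to be found over \<open>N\<close>.\<close>

locale markov_step = markov_ext N' \<mu> e k N h0 sh glue + one: markov_pair \<mu> k N1 h1 s1 g1
  for N' :: "'b measure" and \<mu> :: "'a measure" and e k and N :: "'c measure" and h0 sh glue
    and N1 :: "'d measure" and h1 s1 g1
begin

interpretation N: prob_space N by (rule prob_space_ext)
interpretation h0: measure_preserving N \<mu> h0 by (rule measure_preserving_h0)
interpretation sh: measure_preserving N N' sh by (rule measure_preserving_sh)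

definition first :: "'c \<Rightarrow> 'd" where "first \<omega> = g1 (h0 \<omega>) (e (sh \<omega>))"

lemma first_measurable [measurable]: "first \<in> measurable N N1"
proof -
  have "(\<lambda>\<omega>. (h0 \<omega>, e (sh \<omega>))) \<in> measurable N (\<mu> \<Otimes>\<^sub>M \<mu>)"
    by (intro measurable_Pair h0 measurable_compose[OF sh e.q])
  from measurable_compose[OF this one.glue] show ?thesis
    by (simp add: first_def[abs_def])
qed

lemma h1_first: "\<omega> \<in> space N \<Longrightarrow> h1 (first \<omega>) = h0 \<omega>"
  unfolding first_def
  by (intro one.h0_glue measurable_space[OF h0] measurable_space[OF e.q] measurable_space[OF sh])

text \<open>The law of the first edge involves the old part only through \<open>e w\<close>, which
  has law \<mu>; both measures are then given by the same double integral.\<close>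

lemma measure_preserving_first: "measure_preserving N N1 first"
proof -
  have "distr N N1 first = N1"
  proof (rule measure_eqI)
    fix B assume "B \<in> sets (distr N N1 first)"
    then have B [measurable]: "B \<in> sets N1" by simp
    have "emeasure (distr N N1 first) B = (\<integral>\<^sup>+\<omega>. indicator B (first \<omega>) \<partial>N)"
      by (subst nn_integral_indicator[symmetric], simp, subst nn_integral_distr) auto
    also have "\<dots> = (\<integral>\<^sup>+w. \<integral>\<^sup>+y. ennreal (k y (e w)) * indicator B (first (glue y w)) \<partial>\<mu> \<partial>N')"
      by (rule nn_integral_ext) measurable
    also have "\<dots> = (\<integral>\<^sup>+w. \<integral>\<^sup>+y. ennreal (k y (e w)) * indicator B (g1 y (e w)) \<partial>\<mu> \<partial>N')"
      by (intro nn_integral_cong) (simp add: first_def h0_glue sh_glue)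
    also have "\<dots> = (\<integral>\<^sup>+x. \<integral>\<^sup>+y. ennreal (k y x) * indicator B (g1 y x) \<partial>\<mu> \<partial>\<mu>)"
      by (rule nn_integral_swap) measurable
    also have "\<dots> = (\<integral>\<^sup>+\<omega>. indicator B \<omega> \<partial>N1)"
      by (subst one.nn_integral_ext) simp_all
    finally show "emeasure (distr N N1 first) B = emeasure N1 B" by simp
  qed simp
  then show ?thesis
    by (intro measure_preserving.intro measure_preserving_axioms.intro prob_space_ext one.prob_space_ext) simp_all
qed

interpretation first: measure_preserving N N1 first by (rule measure_preserving_first)

definition ker :: "('d \<Rightarrow> complex) set \<Rightarrow> 'a \<Rightarrow> 'a \<Rightarrow> complex" where
  "ker u y x = ae_rep u (g1 y x)"

lemma ker_measurable:
  assumes "u \<in> carr (L2 N1)"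
  shows "case_prod (ker u) \<in> borel_measurable (\<mu> \<Otimes>\<^sub>M \<mu>)"
proof -
  have [measurable]: "ae_rep u \<in> borel_measurable N1" using L2_rep(1)[OF assms] by simp
  show ?thesis unfolding ker_def by measurable
qed

lemma kernel_mult_ker: "\<omega> \<in> space N1 \<Longrightarrow> one.kernel_mult (ker u) \<eta> \<omega> = ae_rep u \<omega> * \<eta> (s1 \<omega>)"
  by (simp add: one.kernel_mult_def ker_def one.glue_parts)

text \<open>\<open>pi_tau\<close> sends a bounded \<open>x\<close> to the product of
  \<open>u\<close> and \<open>x\<close>. \<open>kernel_op (ker u)\<close> expresses this product by
  a formula that, for a bounded kernel, extends to all square integrable \<open>x\<close>.\<close>

lemma ract_eq_kernel_op:
  assumes "u \<in> carr (L2 N1)"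
  shows "ract (coord_L2 N1 h1 s1) u x = one.kernel_op (ker u) x"
  unfolding one.kernel_op_def coord_L2_simps
  by (intro ae_class_eqI AE_I2) (simp add: kernel_mult_ker)

section \<open>Bounded vectors in a copy of the two-point space\<close>

context
  fixes H :: "(('a \<Rightarrow> complex) set, 'g tvec) bimodule" and U V
  assumes H: "wstar_bimodule \<mu> H" and U: "bounded_op H (coord_L2 N1 h1 s1) U" and V: "bounded_op (coord_L2 N1 h1 s1) H V"
    and VU: "\<And>u. u \<in> carr H \<Longrightarrow> V (U u) = u" and UV: "\<And>v. v \<in> carr (coord_L2 N1 h1 s1) \<Longrightarrow> U (V v) = v"
    and ip: "\<And>u v. u \<in> carr H \<Longrightarrow> v \<in> carr H \<Longrightarrow> vip H u v = vip (coord_L2 N1 h1 s1) (U u) (U v)"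
    and la: "\<And>a u. a \<in> Linf \<mu> \<Longrightarrow> u \<in> carr H \<Longrightarrow> U (lact H a u) = lact (coord_L2 N1 h1 s1) a (U u)"
    and ra: "\<And>a u. a \<in> Linf \<mu> \<Longrightarrow> u \<in> carr H \<Longrightarrow> U (ract H u a) = ract (coord_L2 N1 h1 s1) (U u) a"
begin

interpretation H: hilbert H by unfold_locales (use H in \<open>simp add: wstar_bimodule_def\<close>)

lemma U_in: "u \<in> carr H \<Longrightarrow> U u \<in> carr (L2 N1)"
  using U by (simp add: bounded_op_def)

lemma V_in: "v \<in> carr (L2 N1) \<Longrightarrow> V v \<in> carr H"
  using V by (simp add: bounded_op_def)

lemma bounded_op_lact: "a \<in> Linf \<mu> \<Longrightarrow> bounded_op H H (lact H a)"
  and bounded_op_ract: "a \<in> Linf \<mu> \<Longrightarrow> bounded_op H H (\<lambda>u. ract H u a)"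
  using H by (simp_all add: wstar_bimodule_def normal_star_rep_def)

lemma lact_in: "a \<in> Linf \<mu> \<Longrightarrow> u \<in> carr H \<Longrightarrow> lact H a u \<in> carr H"
  and ract_in: "a \<in> Linf \<mu> \<Longrightarrow> u \<in> carr H \<Longrightarrow> ract H u a \<in> carr H"
  using bounded_op_lact[of a] bounded_op_ract[of a] by (simp_all add: bounded_op_def)

lemma norm_U: "u \<in> carr H \<Longrightarrow> vnorm H u = vnorm (L2 N1) (U u)"
  by (simp add: vnorm_def ip)

lemma norm_ract:
  assumes u: "u \<in> carr H" and \<eta>: "\<eta> \<in> borel_measurable \<mu>" "AE x in \<mu>. cmod (\<eta> x) \<le> C"
  shows "vnorm H (ract H u (ae_class \<mu> \<eta>)) = sqrt (\<integral>\<omega>. (cmod (one.kernel_mult (ker (U u)) \<eta> \<omega>))\<^sup>2 \<partial>N1)"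
proof -
  have "vnorm H (ract H u (ae_class \<mu> \<eta>)) = vnorm (L2 N1) (ract (coord_L2 N1 h1 s1) (U u) (ae_class \<mu> \<eta>))"
    using u LinfI[OF \<eta>] by (simp only: norm_U ract_in ra)
  also have "\<dots> = vnorm (L2 N1) (ae_class N1 (one.kernel_mult (ker (U u)) \<eta>))"
    using \<eta> by (simp only: ract_eq_kernel_op[OF U_in[OF u]] one.kernel_op_class)
  also have "\<dots> = sqrt (\<integral>\<omega>. (cmod (one.kernel_mult (ker (U u)) \<eta> \<omega>))\<^sup>2 \<partial>N1)"
    by (intro L2_norm one.kernel_mult_measurable ker_measurable U_in u \<eta>)
  finally show ?thesis .
qed

text \<open>Testing the defining inequality on the indicator of \<open>A\<close> bounds the integral
  over \<open>A\<close> of the fibre second moment by \<open>c\<^sup>2\<close> times the measure of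
  \<open>A\<close>. As \<open>A\<close> is arbitrary, the fibre second moment is at most
  \<open>c\<^sup>2\<close> almost everywhere.\<close>

lemma tau_bounded_bdd_kernel:
  assumes u: "u \<in> tau_bounded \<mu> H"
  shows "one.bdd_kernel (ker (U u))"
proof -
  have uH: "u \<in> carr H" using u by (simp add: tau_bounded_def)
  obtain c where c: "c > 0" "\<And>x. x \<in> Linf \<mu> \<Longrightarrow> vnorm H (ract H u x) \<le> c * vnorm (L2 \<mu>) (tau_half \<mu> x)"
    using u by (auto simp: tau_bounded_def)
  note [measurable] = ker_measurable[OF U_in[OF uH]]
  let ?F = "\<lambda>\<eta>. one.kernel_mult (ker (U u)) \<eta>"
  have sq: "sq_int N1 (?F (indicator A))" if [measurable]: "A \<in> sets \<mu>" for A
  proof -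
    have [measurable]: "ae_rep (U u) \<in> borel_measurable N1" using L2_rep(1)[OF U_in[OF uH]] by simp
    have "sq_int N1 (\<lambda>\<omega>. indicator A (s1 \<omega>) * ae_rep (U u) \<omega>)"
      by (rule sq_int_bounded_mult[OF L2_rep(1)[OF U_in[OF uH]], where C = 1]) (measurable, simp add: indicator_def)
    then show ?thesis
      by (rule sq_int_cong_AE) (measurable, rule AE_I2, simp add: kernel_mult_ker mult.commute)
  qed
  have "(\<integral>\<^sup>+x. (\<integral>\<^sup>+y. ennreal (k y x) * ennreal ((cmod (ker (U u) y x))\<^sup>2) \<partial>\<mu>) * indicator A x \<partial>\<mu>)
      \<le> ennreal (c\<^sup>2) * emeasure \<mu> A" if A [measurable]: "A \<in> sets \<mu>" for A
  proof -
    let ?A = "indicator A :: 'a \<Rightarrow> complex"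
    have bd: "AE x in \<mu>. cmod (?A x) \<le> 1" by (simp add: indicator_def)
    have "sqrt (\<integral>\<omega>. (cmod (?F ?A \<omega>))\<^sup>2 \<partial>N1) \<le> c * vnorm (L2 \<mu>) (ae_class \<mu> ?A)"
      using c(2)[OF one.indicator_Linf[OF A]] norm_ract[OF uH _ bd] one.indicator_Linf[OF A]
      by (simp add: tau_half_eq)
    also have "vnorm (L2 \<mu>) (ae_class \<mu> ?A) = sqrt (measure \<mu> A)"
    proof -
      have "(\<lambda>x. (cmod (?A x))\<^sup>2) = indicator A" by (auto simp: indicator_def)
      then show ?thesis by (subst L2_norm) simp_all
    qed
    also have "c * sqrt (measure \<mu> A) = sqrt (c\<^sup>2 * measure \<mu> A)"
      using c(1) by (simp add: real_sqrt_mult)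
    finally have le: "(\<integral>\<omega>. (cmod (?F ?A \<omega>))\<^sup>2 \<partial>N1) \<le> c\<^sup>2 * measure \<mu> A"
      by (simp only: real_sqrt_le_iff)
    have "(\<integral>\<^sup>+x. (\<integral>\<^sup>+y. ennreal (k y x) * ennreal ((cmod (ker (U u) y x))\<^sup>2) \<partial>\<mu>) * indicator A x \<partial>\<mu>) =
        (\<integral>\<^sup>+\<omega>. ennreal ((cmod (?F ?A \<omega>))\<^sup>2) \<partial>N1)"
      by (subst one.nn_integral_kernel_mult) (auto intro!: nn_integral_cong simp: indicator_def)
    also have "\<dots> = ennreal (\<integral>\<omega>. (cmod (?F ?A \<omega>))\<^sup>2 \<partial>N1)"
      by (rule nn_integral_sq_int[OF sq[OF A]])
    also have "\<dots> \<le> ennreal (c\<^sup>2) * emeasure \<mu> A"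
      using le by (simp add: e.emeasure_eq_measure flip: ennreal_mult)
    finally show ?thesis .
  qed
  then have "AE x in \<mu>. (\<integral>\<^sup>+y. ennreal (k y x) * ennreal ((cmod (ker (U u) y x))\<^sup>2) \<partial>\<mu>) \<le> ennreal (c\<^sup>2)"
    by (intro e.AE_le_of_nn_integral_le) measurable
  then show ?thesis
    unfolding one.bdd_kernel_def using ker_measurable[OF U_in[OF uH]] by (auto intro!: exI[of _ "c\<^sup>2"])
qed

text \<open>An indicator of the new point is bounded by 1, and the second coordinate preserves the
  measure, so the defining inequality holds with constant 1. These vectors supply the first sides of
  the rectangles.\<close>

lemma tau_boundedI:
  assumes A: "A \<in> sets \<mu>"
  shows "V (ae_class N1 (\<lambda>\<omega>. indicator A (h1 \<omega>))) \<in> tau_bounded \<mu> H"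
proof -
  have [measurable]: "A \<in> sets \<mu>" by fact
  let ?f = "\<lambda>\<omega>. indicator A (h1 \<omega>) :: complex"
  have f: "sq_int N1 ?f" by (rule first.sq_int_bounded[where C = 1]) (auto simp: indicator_def)
  let ?u = "V (ae_class N1 ?f)"
  have Vu: "?u \<in> carr H" using f by (intro V_in L2_class)
  have Uu: "U ?u = ae_class N1 ?f" using f by (intro UV) simp
  have "vnorm H (ract H ?u x) \<le> 1 * vnorm (L2 \<mu>) (tau_half \<mu> x)" if x: "x \<in> Linf \<mu>" for x
  proof -
    obtain b C where b [measurable]: "b \<in> borel_measurable \<mu>" and C: "\<And>x. cmod (b x) \<le> C" and xb: "x = ae_class \<mu> b"
      using LinfE[OF x] by metis
    have sqb: "sq_int \<mu> b" using C by (intro e.sq_int_bounded[where C = C]) auto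
    have "AE \<omega> in N1. one.kernel_mult (ker (U ?u)) b \<omega> = ?f \<omega> * b (s1 \<omega>)"
      unfolding Uu using AE_ae_rep[OF sq_int_measurable[OF f]] AE_space
      by eventually_elim (simp add: kernel_mult_ker)
    then have eq: "(\<integral>\<omega>. (cmod (one.kernel_mult (ker (U ?u)) b \<omega>))\<^sup>2 \<partial>N1) = (\<integral>\<omega>. (cmod (?f \<omega> * b (s1 \<omega>)))\<^sup>2 \<partial>N1)"
      using ker_measurable[OF U_in[OF Vu]]
      by (intro integral_cong_AE) (auto elim!: eventually_mono)
    interpret s1: measure_preserving N1 \<mu> s1 by (rule one.measure_preserving_sh)
    have sqs: "sq_int N1 (\<lambda>\<omega>. b (s1 \<omega>))"
      using C by (intro first.sq_int_bounded[where C = C]) auto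
    have "(\<integral>\<omega>. (cmod (?f \<omega> * b (s1 \<omega>)))\<^sup>2 \<partial>N1) \<le> (\<integral>\<omega>. (cmod (b (s1 \<omega>)))\<^sup>2 \<partial>N1)"
    proof (rule integral_mono)
      show "integrable N1 (\<lambda>\<omega>. (cmod (?f \<omega> * b (s1 \<omega>)))\<^sup>2)"
        using sqs by (intro sq_int_integrable sq_int_bounded_mult[where C = 1]) (auto simp: indicator_def)
    qed (use sqs in \<open>auto simp: indicator_def\<close>)
    also have "\<dots> = (\<integral>x. (cmod (b x))\<^sup>2 \<partial>distr N1 \<mu> s1)"
      by (rule integral_distr[symmetric]) measurable
    also have "\<dots> = (\<integral>x. (cmod (b x))\<^sup>2 \<partial>\<mu>)" by (simp only: s1.distr_q)
    finally have "vnorm H (ract H ?u x) \<le> sqrt (\<integral>x. (cmod (b x))\<^sup>2 \<partial>\<mu>)"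
      unfolding xb norm_ract[OF Vu b AE_I2, OF C] eq by (rule real_sqrt_le_mono)
    then show ?thesis using x by (simp add: tau_half_eq) (simp add: xb L2_norm)
  qed
  then show ?thesis
    unfolding tau_bounded_def using Vu by (auto intro!: exI[of _ "1::real"])
qed

text \<open>The left action commutes with the right one and is bounded, so it only enlarges the
  constant.\<close>

lemma tau_bounded_lact:
  assumes u: "u \<in> tau_bounded \<mu> H" and a: "a \<in> Linf \<mu>"
  shows "lact H a u \<in> tau_bounded \<mu> H"
proof -
  have uH: "u \<in> carr H" using u by (simp add: tau_bounded_def)
  obtain c where c: "c > 0" "\<And>x. x \<in> Linf \<mu> \<Longrightarrow> vnorm H (ract H u x) \<le> c * vnorm (L2 \<mu>) (tau_half \<mu> x)"
    using u by (auto simp: tau_bounded_def)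
  obtain C where C: "\<And>v. v \<in> carr H \<Longrightarrow> vnorm H (lact H a v) \<le> C * vnorm H v"
    using bounded_op_lact[OF a] unfolding bounded_op_def by blast
  \<comment> \<open>\<open>tau_bounded\<close> asks for a positive constant while \<open>C\<close>
    could be 0 or negative, hence \<open>\<bar>C\<bar> + 1\<close>.\<close>
  have "vnorm H (ract H (lact H a u) x) \<le> ((\<bar>C\<bar> + 1) * c) * vnorm (L2 \<mu>) (tau_half \<mu> x)"
    if x: "x \<in> Linf \<mu>" for x
  proof -
    have "ract H (lact H a u) x = lact H a (ract H u x)"
      using H a x uH by (simp add: wstar_bimodule_def)
    then have "vnorm H (ract H (lact H a u) x) \<le> C * vnorm H (ract H u x)"
      using C[OF ract_in[OF x uH]] by simp
    also have "\<dots> \<le> (\<bar>C\<bar> + 1) * vnorm H (ract H u x)"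
      using ract_in[OF x uH] by (intro mult_right_mono) auto
    also have "\<dots> \<le> (\<bar>C\<bar> + 1) * (c * vnorm (L2 \<mu>) (tau_half \<mu> x))"
      using c(2)[OF x] by (intro mult_left_mono) auto
    finally show ?thesis by (simp add: mult.assoc)
  qed
  moreover have "(\<bar>C\<bar> + 1) * c > 0" using c(1) by simp
  ultimately show ?thesis
    unfolding tau_bounded_def using lact_in[OF a uH] by blast
qed

text \<open>Composing \<open>kernel_op\<close> with the inverse isomorphism \<open>V\<close>
  realizes \<open>pi_tau\<close>, and \<open>inner_kernel_mult\<close> on the two-point space shows
  that its matrix elements are those of multiplication by the kernel inner product.\<close>

lemma tau_inner_eq:
  assumes u: "u \<in> tau_bounded \<mu> H" and v: "v \<in> tau_bounded \<mu> H"
  shows "tau_inner \<mu> H u v = ae_class \<mu> (one.kernel_inner (ker (U u)) (ker (U v)))"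
proof -
  have bk: "one.bdd_kernel (ker (U u))" "one.bdd_kernel (ker (U v))"
    by (rule tau_bounded_bdd_kernel[OF u], rule tau_bounded_bdd_kernel[OF v])
  have uv: "u \<in> carr H" "v \<in> carr H" using u v by (simp_all add: tau_bounded_def)
  let ?m = "one.kernel_inner (ker (U u)) (ker (U v))"
  have m [measurable]: "?m \<in> borel_measurable \<mu>"
    by (intro one.kernel_inner_measurable ker_measurable U_in uv)
  have P: "bounded_op (L2 \<mu>) H (\<lambda>f. V (one.kernel_op (ker (U u)) f))" if b: "one.bdd_kernel (ker (U u))" for u
  proof -
    have K: "bounded_op (L2 \<mu>) (L2 N1) (one.kernel_op (ker (U u)))" by (rule one.bounded_op_kernel_op[OF b])
    then obtain C where C: "\<And>f. f \<in> carr (L2 \<mu>) \<Longrightarrow> vnorm (L2 N1) (one.kernel_op (ker (U u)) f) \<le> C * vnorm (L2 \<mu>) f"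
      unfolding bounded_op_def by blast
    have nb: "vnorm H (V (one.kernel_op (ker (U u)) f)) \<le> C * vnorm (L2 \<mu>) f" if "f \<in> carr (L2 \<mu>)" for f
    proof -
      have "one.kernel_op (ker (U u)) f \<in> carr (L2 N1)" using K that by (simp add: bounded_op_def)
      then show ?thesis using C[OF that] by (simp add: norm_U V_in UV)
    qed
    show ?thesis
      unfolding bounded_op_def
    proof (intro conjI ballI allI exI[of _ C] nb)
    qed (use K V in \<open>simp_all add: bounded_op_def\<close>)
  qed
  have Px: "V (one.kernel_op (ker (U u)) x) = ract H u x" if "x \<in> Linf \<mu>" "u \<in> carr H" for u x
    using that by (simp only: ract_eq_kernel_op[symmetric] U_in ra[symmetric] VU ract_in)
  show ?thesis
  proof (rule e.tau_inner_eqI[OF H.hilbert_axioms P[OF bk(1)] Px[OF _ uv(1)] P[OF bk(2)] Px[OF _ uv(2)]])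
    show "ae_class \<mu> ?m \<in> Linf \<mu>"
      using one.kernel_inner_bounded[OF bk] LinfI[OF m] by blast
    fix f g assume fg: "f \<in> carr (L2 \<mu>)" "g \<in> carr (L2 \<mu>)"
    obtain f' where f': "sq_int \<mu> f'" "f = ae_class \<mu> f'" using fg(1) by (rule L2E)
    obtain g' where g': "sq_int \<mu> g'" "g = ae_class \<mu> g'" using fg(2) by (rule L2E)
    have c: "one.kernel_op (ker (U u)) f \<in> carr (L2 N1)" "one.kernel_op (ker (U v)) g \<in> carr (L2 N1)"
      using fg one.bounded_op_kernel_op[OF bk(1)] one.bounded_op_kernel_op[OF bk(2)] by (simp_all add: bounded_op_def)
    have "vip H (V (one.kernel_op (ker (U u)) f)) (V (one.kernel_op (ker (U v)) g)) =
        vip (L2 N1) (one.kernel_op (ker (U u)) f) (one.kernel_op (ker (U v)) g)"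
      using c by (simp add: ip V_in UV)
    also have "\<dots> = (\<integral>\<omega>. cnj (one.kernel_mult (ker (U u)) f' \<omega>) * one.kernel_mult (ker (U v)) g' \<omega> \<partial>N1)"
      unfolding f'(2) g'(2) using f'(1) g'(1) one.sq_int_kernel_mult(1)[OF bk(1) f'(1)] one.sq_int_kernel_mult(1)[OF bk(2) g'(1)]
      by (simp add: one.kernel_op_class L2_ip)
    also have "\<dots> = (\<integral>w. cnj (f' w) * (?m w * g' w) \<partial>\<mu>)"
      using one.inner_kernel_mult[OF bk f'(1) g'(1)] by simp
    also have "\<dots> = vip (L2 \<mu>) f (cls_mult \<mu> (ae_class \<mu> ?m) g)"
      unfolding f'(2) g'(2) using f'(1) g'(1) by (simp add: cls_mult_class L2_ip)
    finally show "vip H (V (one.kernel_op (ker (U u)) f)) (V (one.kernel_op (ker (U v)) g)) =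
        vip (L2 \<mu>) f (cls_mult \<mu> (ae_class \<mu> ?m) g)" .
  qed
qed

text \<open>A symbol (\<xi>, \<eta>) is read as the function
  \<open>(U \<xi>)(first \<omega>) (W \<eta>)(sh \<omega>)\<close>. The form multiplies \<eta>' by
  \<open>tau_inner\<close>, a kernel inner product evaluated at the first point of the old path,
  which is exactly the one-step formula. \<open>D\<close>, \<open>B\<close>, \<open>l\<close>,
  \<open>r\<close> are variables with defining equations so that the tupled abstractions of
  \<open>rel_tensor\<close> stay out of the proof.\<close>

lemma rel_tensor_iso_aux:
  fixes K :: "(('a \<Rightarrow> complex) set, 'g tvec) bimodule"
  assumes K: "bimodule_iso \<mu> K (coord_L2 N' e r')" and r': "measure_preserving N' \<mu> r'"
    and D: "D = tau_bounded \<mu> H \<times> carr K"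
    and B: "\<And>\<xi> \<eta> \<xi>' \<eta>'. B (\<xi>, \<eta>) (\<xi>', \<eta>') = vip K \<eta> (lact K (tau_inner \<mu> H \<xi> \<xi>') \<eta>')"
    and l: "\<And>a \<xi> \<eta>. l a (\<xi>, \<eta>) = (lact H a \<xi>, \<eta>)" and r: "\<And>a \<xi> \<eta>. r (\<xi>, \<eta>) a = (\<xi>, ract K \<eta> a)"
  shows "bimodule_iso \<mu> (sep_completion D B l r) (coord_L2 N h0 (\<lambda>\<omega>. r' (sh \<omega>)))"
proof -
  obtain W X where K': "wstar_bimodule \<mu> K" and W: "bounded_op K (coord_L2 N' e r') W" and X: "bounded_op (coord_L2 N' e r') K X"
    and XW: "\<And>v. v \<in> carr K \<Longrightarrow> X (W v) = v" and WX: "\<And>v. v \<in> carr (coord_L2 N' e r') \<Longrightarrow> W (X v) = v"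
    and ipK: "\<And>u v. u \<in> carr K \<Longrightarrow> v \<in> carr K \<Longrightarrow> vip K u v = vip (coord_L2 N' e r') (W u) (W v)"
    and laK: "\<And>a u. a \<in> Linf \<mu> \<Longrightarrow> u \<in> carr K \<Longrightarrow> W (lact K a u) = lact (coord_L2 N' e r') a (W u)"
    and raK: "\<And>a u. a \<in> Linf \<mu> \<Longrightarrow> u \<in> carr K \<Longrightarrow> W (ract K u a) = ract (coord_L2 N' e r') (W u) a"
    by (rule bimodule_isoE[OF K]) blast
  have W_in: "W v \<in> carr (L2 N')" if "v \<in> carr K" for v using W that by (simp add: bounded_op_def)
  have X_in: "X v \<in> carr K" if "v \<in> carr (L2 N')" for v using X that by (simp add: bounded_op_def)
  have actK: "lact K a v \<in> carr K" "ract K v a \<in> carr K" if "a \<in> Linf \<mu>" "v \<in> carr K" for a v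
  proof -
    have "bounded_op K K (lact K a)" "bounded_op K K (\<lambda>u. ract K u a)"
      using K' that(1) by (simp_all add: wstar_bimodule_def normal_star_rep_def)
    then show "lact K a v \<in> carr K" "ract K v a \<in> carr K" using that(2) by (simp_all add: bounded_op_def)
  qed
  interpret r': measure_preserving N' \<mu> r' by fact
  define fk where "fk d = ker (U (fst d))" for d :: "'g gen"
  define et where "et d = ae_rep (W (snd d))" for d :: "'g gen"
  \<comment> \<open>\<open>bdd_kernel\<close> and \<open>kernel_inner\<close> involve only \<mu> and
    \<open>k\<close>, so what was shown over the two-point space holds verbatim over the
    extension.\<close>
  have bk: "bdd_kernel (ker (U u))" if "u \<in> tau_bounded \<mu> H" for u
    by (rule tau_bounded_bdd_kernel[OF that])
  have et_sq: "sq_int N' (ae_rep (W v))" if "v \<in> carr K" for v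
    using L2_rep(1)[OF W_in[OF that]] .
  have uH: "u \<in> carr H" if "u \<in> tau_bounded \<mu> H" for u using that by (simp add: tau_bounded_def)
  have rep_first: "AE \<omega> in N. ae_rep (ae_class N1 f) (first \<omega>) = f (first \<omega>)" if "f \<in> borel_measurable N1" for f
    by (rule first.AE_comp[OF AE_ae_rep[OF that]])
  have km: "kernel_mult (ker u) \<eta> \<omega> = ae_rep u (first \<omega>) * \<eta> (sh \<omega>)" for u \<eta> \<omega>
    by (simp add: kernel_mult_def ker_def first_def)
  show ?thesis
  proof (rule sep_completion_coord_L2[OF r', where fk = fk and et = et])
    show "bdd_kernel (fk d)" "sq_int N' (et d)" if "d \<in> D" for d
      using that bk et_sq by (auto simp: D fk_def et_def)
  next
    fix d d' assume "d \<in> D" "d' \<in> D"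
    then obtain u v u' v' where d: "d = (u, v)" "u \<in> tau_bounded \<mu> H" "v \<in> carr K"
      and d': "d' = (u', v')" "u' \<in> tau_bounded \<mu> H" "v' \<in> carr K" by (auto simp: D)
    let ?m = "kernel_inner (ker (U u)) (ker (U u'))"
    have m [measurable]: "?m \<in> borel_measurable \<mu>"
      by (intro kernel_inner_measurable ker_measurable U_in uH d d')
    have tm: "tau_inner \<mu> H u u' = ae_class \<mu> ?m"
      by (rule tau_inner_eq[OF d(2) d'(2)])
    have mL: "ae_class \<mu> ?m \<in> Linf \<mu>"
      using kernel_inner_bounded[OF bk[OF d(2)] bk[OF d'(2)]] LinfI[OF m] by blast
    have "B d d' = vip K v (lact K (ae_class \<mu> ?m) v')"
      by (simp only: d(1) d'(1) B tm)
    also have "\<dots> = vip (L2 N') (W v) (e.act (ae_class \<mu> ?m) (W v'))"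
      by (simp only: ipK[OF d(3) actK(1)[OF mL d'(3)]] laK[OF mL d'(3)] coord_L2_simps e.act_def)
    also have "\<dots> = vip (L2 N') (ae_class N' (ae_rep (W v))) (e.act (ae_class \<mu> ?m) (ae_class N' (ae_rep (W v'))))"
      by (simp only: L2_rep(2)[OF W_in[OF d(3)]] L2_rep(2)[OF W_in[OF d'(3)]])
    also have "\<dots> = (\<integral>w. cnj (ae_rep (W v) w) * (?m (e w) * ae_rep (W v') w) \<partial>N')"
      using et_sq[OF d(3)] et_sq[OF d'(3)] by (simp add: e.act_class L2_ip)
    finally show "B d d' = (\<integral>w. cnj (et d w) * (kernel_inner (fk d) (fk d') (e w) * et d' w) \<partial>N')"
      by (simp add: d(1) d'(1) fk_def et_def)
  next
    fix P Q assume P: "P \<in> sets \<mu>" and Q: "Q \<in> sets N'"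
    have [measurable]: "P \<in> sets \<mu>" "Q \<in> sets N'" by fact+
    let ?P = "\<lambda>\<omega>. indicator P (h1 \<omega>) :: complex" and ?Q = "indicator Q :: 'b \<Rightarrow> complex"
    have sqP: "sq_int N1 ?P" by (rule first.sq_int_bounded[where C = 1]) (auto simp: indicator_def)
    have sqQ: "sq_int N' ?Q" by (rule e.N.sq_int_bounded[where C = 1]) (auto simp: indicator_def)
    \<comment> \<open>The two sides of the rectangle become the two factors of a symbol;
      \<open>h1 (first \<omega>) = h0 \<omega>\<close> turns the first factor into a function of the
      new point.\<close>
    let ?d = "(V (ae_class N1 ?P), X (ae_class N' ?Q))"
    have "?d \<in> D" using tau_boundedI[OF P] X_in sqQ by (simp add: D)
    moreover have "AE \<omega> in N. kernel_mult (fk ?d) (et ?d) \<omega> = indicator P (h0 \<omega>) * indicator Q (sh \<omega>)"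
      using rep_first[OF sq_int_measurable[OF sqP]] sh.AE_comp[OF AE_ae_rep[OF sq_int_measurable[OF sqQ]]] AE_space
    proof eventually_elim
      case (elim \<omega>)
      then show ?case
        using sqP sqQ h1_first[of \<omega>] by (simp add: fk_def et_def UV WX km)
    qed
    ultimately show "\<exists>d\<in>D. AE \<omega> in N. kernel_mult (fk d) (et d) \<omega> = indicator P (h0 \<omega>) * indicator Q (sh \<omega>)"
      by blast
  next
    fix a d assume a: "a \<in> Linf \<mu>" and "d \<in> D"
    then obtain u v where d: "d = (u, v)" "u \<in> tau_bounded \<mu> H" "v \<in> carr K" by (auto simp: D)
    have ra: "ae_rep a \<in> borel_measurable \<mu>" by (rule one.Linf_rep(1)[OF a])
    have ru: "ae_rep (U u) \<in> borel_measurable N1" using L2_rep(1)[OF U_in[OF uH[OF d(2)]]] by simp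
    have rv: "ae_rep (W v) \<in> borel_measurable N'" using et_sq[OF d(3)] by simp
    have mu: "(\<lambda>\<omega>. ae_rep a (h1 \<omega>) * ae_rep (U u) \<omega>) \<in> borel_measurable N1"
      by (intro borel_measurable_times measurable_compose[OF one.h0 ra] ru)
    have mv: "(\<lambda>w. ae_rep (W v) w * ae_rep a (r' w)) \<in> borel_measurable N'"
      by (intro borel_measurable_times measurable_compose[OF r'.q ra] rv)
    \<comment> \<open>The representative of a product agrees with the product of representatives off
      a null set of \<open>N1\<close>, which pulls back to a null set of \<open>N\<close> along
      \<open>first\<close>.\<close>
    have "AE \<omega> in N. kernel_mult (fk (l a d)) (et (l a d)) \<omega> = ae_rep a (h0 \<omega>) * kernel_mult (fk d) (et d) \<omega>"
      using rep_first[OF mu] AE_space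
    proof eventually_elim
      case (elim \<omega>)
      then show ?case
        using h1_first[of \<omega>] by (simp add: fk_def et_def d(1) l km la[OF a uH[OF d(2)]])
    qed
    then show "l a d \<in> D \<and> (AE \<omega> in N. kernel_mult (fk (l a d)) (et (l a d)) \<omega> = ae_rep a (h0 \<omega>) * kernel_mult (fk d) (et d) \<omega>)"
      using tau_bounded_lact[OF d(2) a] d by (simp add: D l)
    have "AE \<omega> in N. kernel_mult (fk (r d a)) (et (r d a)) \<omega> = kernel_mult (fk d) (et d) \<omega> * ae_rep a (r' (sh \<omega>))"
      using sh.AE_comp[OF AE_ae_rep[OF mv]]
      by eventually_elim (simp add: fk_def et_def d(1) r km raK[OF a d(3)])
    then show "r d a \<in> D \<and> (AE \<omega> in N. kernel_mult (fk (r d a)) (et (r d a)) \<omega> = kernel_mult (fk d) (et d) \<omega> * ae_rep a (r' (sh \<omega>)))"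
      using actK(2)[OF a d(3)] d by (simp add: D r)
  qed
qed

end

theorem rel_tensor_iso:
  fixes H K :: "(('a \<Rightarrow> complex) set, 'g tvec) bimodule"
  assumes H: "bimodule_iso \<mu> H (coord_L2 N1 h1 s1)" and K: "bimodule_iso \<mu> K (coord_L2 N' e r')"
    and r': "measure_preserving N' \<mu> r'"
  shows "bimodule_iso \<mu> (rel_tensor \<mu> H K) (coord_L2 N h0 (\<lambda>\<omega>. r' (sh \<omega>)))"
proof -
  obtain U V where "wstar_bimodule \<mu> H" "bounded_op H (coord_L2 N1 h1 s1) U" "bounded_op (coord_L2 N1 h1 s1) H V"
    "\<And>u. u \<in> carr H \<Longrightarrow> V (U u) = u" "\<And>v. v \<in> carr (coord_L2 N1 h1 s1) \<Longrightarrow> U (V v) = v"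
    "\<And>u v. u \<in> carr H \<Longrightarrow> v \<in> carr H \<Longrightarrow> vip H u v = vip (coord_L2 N1 h1 s1) (U u) (U v)"
    "\<And>a u. a \<in> Linf \<mu> \<Longrightarrow> u \<in> carr H \<Longrightarrow> U (lact H a u) = lact (coord_L2 N1 h1 s1) a (U u)"
    "\<And>a u. a \<in> Linf \<mu> \<Longrightarrow> u \<in> carr H \<Longrightarrow> U (ract H u a) = ract (coord_L2 N1 h1 s1) (U u) a"
    by (rule bimodule_isoE[OF H]) blast
  then show ?thesis
    unfolding rel_tensor_def by (rule rel_tensor_iso_aux[OF _ _ _ _ _ _ _ _ K r' refl]) simp_all
qed

end

section \<open>Path spaces\<close>

lemma all_nat_split: "(\<forall>i. P i) \<longleftrightarrow> P 0 \<and> (\<forall>i. P (Suc i))"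
  by (metis not0_implies_Suc)

text \<open>\<open>case_nat y w\<close> prepends \<open>y\<close> to \<open>w\<close>. Separating
  index 0 from the successors splits both the membership and the extensionality condition of a
  box.\<close>

lemma case_nat_PiE:
  "case_nat y w \<in> Pi\<^sub>E {0..Suc n} A \<longleftrightarrow> y \<in> A 0 \<and> w \<in> Pi\<^sub>E {0..n} (\<lambda>i. A (Suc i))"
  unfolding PiE_iff extensional_def Ball_def mem_Collect_eq
  by (subst (1 2) all_nat_split) auto

locale markov_kernel = prob_space \<mu> for \<mu> :: "'a measure" +
  fixes p :: "real \<Rightarrow> 'a \<Rightarrow> 'a \<Rightarrow> real"
  assumes p_measurable: "t > 0 \<Longrightarrow> case_prod (p t) \<in> borel_measurable (\<mu> \<Otimes>\<^sub>M \<mu>)"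
    and p_sym: "t > 0 \<Longrightarrow> p t x y = p t y x" and p_nonneg: "t > 0 \<Longrightarrow> 0 \<le> p t x y"
    and p_int: "t > 0 \<Longrightarrow> (\<integral>\<^sup>+y. ennreal (p t x y) \<partial>\<mu>) = 1"
begin

abbreviation path_space :: "nat \<Rightarrow> (nat \<Rightarrow> 'a) measure" where
  "path_space n \<equiv> Pi\<^sub>M {0..n} (\<lambda>_. \<mu>)"

sublocale path: product_sigma_finite "\<lambda>_::nat. \<mu>"
  by (rule product_sigma_finite.intro) (rule sigma_finite_measure_axioms)

lemma prob_path_space: "prob_space (path_space n)"
  by (intro prob_space_PiM prob_space_axioms)

definition weight :: "real list \<Rightarrow> (nat \<Rightarrow> 'a) \<Rightarrow> ennreal" where
  "weight ts x = (\<Prod>i<length ts. ennreal (p (ts ! i) (x i) (x (Suc i))))"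

lemma path_measure_weight: "path_measure \<mu> p ts = density (path_space (length ts)) (weight ts)"
  by (simp add: path_measure_def weight_def[abs_def])

lemma weight_Cons: "weight (s # ts) (case_nat y w) = ennreal (p s y (w 0)) * weight ts w"
  by (simp add: weight_def prod.lessThan_Suc_shift del: prod.lessThan_Suc)

lemma coord_measurable: "i \<le> n \<Longrightarrow> (\<lambda>x. x i) \<in> measurable (path_space n) \<mu>"
  by (rule measurable_component_singleton) simp

lemma weight_measurable [measurable]:
  assumes "\<forall>s\<in>set ts. 0 < s"
  shows "weight ts \<in> borel_measurable (path_space (length ts))"
  unfolding weight_def
proof (intro borel_measurable_prod_ennreal measurable_compose[OF _ measurable_ennreal])
  fix i assume i: "i \<in> {..<length ts}"
  have "(\<lambda>x. (x i, x (Suc i))) \<in> measurable (path_space (length ts)) (\<mu> \<Otimes>\<^sub>M \<mu>)"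
    using i by (intro measurable_Pair coord_measurable) auto
  from measurable_compose[OF this p_measurable[of "ts ! i"]]
  show "(\<lambda>x. p (ts ! i) (x i) (x (Suc i))) \<in> borel_measurable (path_space (length ts))"
    using assms i by simp
qed

lemma p_first_measurable:
  assumes s: "s > 0"
  shows "(\<lambda>(y, w). ennreal (p s y (w 0))) \<in> borel_measurable (\<mu> \<Otimes>\<^sub>M path_space n)"
proof -
  have "(\<lambda>x. (fst x, snd x 0)) \<in> measurable (\<mu> \<Otimes>\<^sub>M path_space n) (\<mu> \<Otimes>\<^sub>M \<mu>)"
    by (intro measurable_Pair measurable_fst measurable_compose[OF measurable_snd coord_measurable]) simp
  from measurable_compose[OF measurable_compose[OF this p_measurable[OF s]] measurable_ennreal]
  show ?thesis by (simp add: case_prod_unfold)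
qed

lemma case_nat_measurable: "(\<lambda>(y, w). case_nat y w) \<in> measurable (\<mu> \<Otimes>\<^sub>M path_space n) (path_space (Suc n))"
proof (rule measurable_PiM_single')
  fix i assume "i \<in> {0..Suc n}"
  then show "(\<lambda>x. (case x of (y, w) \<Rightarrow> case_nat y w) i) \<in> measurable (\<mu> \<Otimes>\<^sub>M path_space n) \<mu>"
    by (cases i) (auto simp: case_prod_unfold intro: measurable_compose[OF measurable_snd coord_measurable])
next
  show "(\<lambda>x i. (case x of (y, w) \<Rightarrow> case_nat y w) i) \<in> space (\<mu> \<Otimes>\<^sub>M path_space n) \<rightarrow> (\<Pi>\<^sub>E i\<in>{0..Suc n}. space \<mu>)"
    by (rule funcsetI) (simp add: space_pair_measure space_PiM case_prod_unfold case_nat_PiE mem_Times_iff)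
qed

text \<open>A finite product measure is determined by its values on boxes, and prepending a point
  corresponds to splitting off the first side of a box.\<close>

lemma distr_case_nat: "distr (\<mu> \<Otimes>\<^sub>M path_space n) (path_space (Suc n)) (\<lambda>(y, w). case_nat y w) = path_space (Suc n)"
proof (rule path.PiM_eqI)
  interpret n: prob_space "path_space n" by (rule prob_path_space)
  fix A :: "nat \<Rightarrow> 'a set" assume A: "\<And>i. i \<in> {0..Suc n} \<Longrightarrow> A i \<in> sets \<mu>"
  have sub: "A 0 \<subseteq> space \<mu>" "Pi\<^sub>E {0..n} (\<lambda>i. A (Suc i)) \<subseteq> space (path_space n)"
    unfolding space_PiM using A[THEN sets.sets_into_space] by (simp, intro PiE_mono, simp)
  have "(\<lambda>(y, w). case_nat y w) -` (Pi\<^sub>E {0..Suc n} A) \<inter> space (\<mu> \<Otimes>\<^sub>M path_space n) =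
      A 0 \<times> Pi\<^sub>E {0..n} (\<lambda>i. A (Suc i))"
    using sub by (simp add: set_eq_iff case_nat_PiE space_pair_measure split_paired_all del: PiE_iff) blast
  then have "emeasure (distr (\<mu> \<Otimes>\<^sub>M path_space n) (path_space (Suc n)) (\<lambda>(y, w). case_nat y w)) (Pi\<^sub>E {0..Suc n} A) =
      emeasure (\<mu> \<Otimes>\<^sub>M path_space n) (A 0 \<times> Pi\<^sub>E {0..n} (\<lambda>i. A (Suc i)))"
    using A by (subst emeasure_distr[OF case_nat_measurable]) (auto intro!: sets_PiM_I_finite)
  also have "\<dots> = emeasure \<mu> (A 0) * (\<Prod>i\<in>{0..n}. emeasure \<mu> (A (Suc i)))"
  proof -
    have "emeasure (path_space n) (Pi\<^sub>E {0..n} (\<lambda>i. A (Suc i))) = (\<Prod>i\<in>{0..n}. emeasure \<mu> (A (Suc i)))"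
      by (rule path.emeasure_PiM) (use A in auto)
    then show ?thesis
      using A by (subst n.emeasure_pair_measure_Times) (auto intro!: sets_PiM_I_finite)
  qed
  also have "\<dots> = (\<Prod>i\<in>{0..Suc n}. emeasure \<mu> (A i))"
    by (simp only: prod.atLeast0_atMost_Suc_shift comp_def)
  finally show "emeasure (distr (\<mu> \<Otimes>\<^sub>M path_space n) (path_space (Suc n)) (\<lambda>(y, w). case_nat y w)) (Pi\<^sub>E {0..Suc n} A) =
      (\<Prod>i\<in>{0..Suc n}. emeasure \<mu> (A i))" .
qed auto

text \<open>The product over one index consists of extensional functions on \<open>{0..0}\<close>,
  so it is a copy of \<mu> and not \<mu> itself; this map is the identification.\<close>

abbreviation single :: "'a \<Rightarrow> nat \<Rightarrow> 'a" where
  "single x \<equiv> \<lambda>i\<in>{0..0}. x"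

lemma single_measurable: "single \<in> measurable \<mu> (path_space 0)"
  by (rule measurable_restrict) simp

lemma distr_single: "distr \<mu> (path_space 0) single = path_space 0"
proof (rule path.PiM_eqI)
  fix A :: "nat \<Rightarrow> 'a set" assume A: "\<And>i. i \<in> {0..0} \<Longrightarrow> A i \<in> sets \<mu>"
  have "single -` (Pi\<^sub>E {0..0} A) \<inter> space \<mu> = A 0"
    using A[of 0, THEN sets.sets_into_space] by (auto simp: PiE_iff)
  then show "emeasure (distr \<mu> (path_space 0) single) (Pi\<^sub>E {0..0} A) = (\<Prod>i\<in>{0..0}. emeasure \<mu> (A i))"
    using A by (subst emeasure_distr[OF single_measurable]) (auto intro!: sets_PiM_I_finite)
qed auto

lemma glue_parts: "\<omega> \<in> space (path_space (Suc n)) \<Longrightarrow> case_nat (\<omega> 0) (\<lambda>i\<in>{0..n}. \<omega> (Suc i)) = \<omega>"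
  by (auto simp: space_PiM PiE_iff extensional_def fun_eq_iff split: nat.split)

text \<open>The recursion for path measures, with the weight of the tail still written as a density
  over the unweighted product. An empty tail gives the two-point space; for longer paths the weight
  is absorbed into the measure of the tail.\<close>

lemma density_extension:
  assumes ts: "\<forall>t\<in>set (s # ts). 0 < t"
  shows "distr (density (\<mu> \<Otimes>\<^sub>M path_space (length ts)) (\<lambda>(y, w). ennreal (p s y (w 0)) * weight ts w))
    (path_measure \<mu> p (s # ts)) (\<lambda>(y, w). case_nat y w) = path_measure \<mu> p (s # ts)"
proof -
  let ?n = "length ts"
  have "path_measure \<mu> p (s # ts) = density (distr (\<mu> \<Otimes>\<^sub>M path_space ?n) (path_space (Suc ?n)) (\<lambda>(y, w). case_nat y w)) (weight (s # ts))"
    by (simp only: path_measure_weight distr_case_nat length_Cons)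
  also have "\<dots> = distr (density (\<mu> \<Otimes>\<^sub>M path_space ?n) (\<lambda>x. weight (s # ts) (case x of (y, w) \<Rightarrow> case_nat y w)))
      (path_space (Suc ?n)) (\<lambda>(y, w). case_nat y w)"
    using weight_measurable[OF ts] by (intro density_distr case_nat_measurable) simp
  also have "(\<lambda>x. weight (s # ts) (case x of (y, w) \<Rightarrow> case_nat y w)) = (\<lambda>(y, w). ennreal (p s y (w 0)) * weight ts w)"
    by (auto simp: weight_Cons)
  also have "distr (density (\<mu> \<Otimes>\<^sub>M path_space ?n) (\<lambda>(y, w). ennreal (p s y (w 0)) * weight ts w))
      (path_space (Suc ?n)) (\<lambda>(y, w). case_nat y w) =
    distr (density (\<mu> \<Otimes>\<^sub>M path_space ?n) (\<lambda>(y, w). ennreal (p s y (w 0)) * weight ts w))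
      (path_measure \<mu> p (s # ts)) (\<lambda>(y, w). case_nat y w)"
    by (rule distr_cong) (simp_all add: path_measure_weight)
  finally show ?thesis ..
qed

section \<open>Path measures as one-step extensions\<close>

lemma measurable_path [simp]:
  "measurable (path_measure \<mu> p ts) M = measurable (path_space (length ts)) M"
  "measurable M (path_measure \<mu> p ts) = measurable M (path_space (length ts))"
  "space (path_measure \<mu> p ts) = space (path_space (length ts))"
  "sets (path_measure \<mu> p ts) = sets (path_space (length ts))"
  by (auto simp: path_measure_weight intro!: measurable_cong_sets)

text \<open>With an empty tail the recursion is based on \<open>path_space 0\<close>, whereas
  \<open>markov_pair\<close> is based on \<mu>. The density is carried along \<open>single\<close>
  and then composed with \<open>case_nat\<close>.\<close>

lemma markov_pair_path:
  assumes s: "s > 0"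
  shows "markov_pair \<mu> (p s) (path_measure \<mu> p [s]) (\<lambda>\<omega>. \<omega> 0) (\<lambda>\<omega>. \<omega> 1) (\<lambda>y x. case_nat y (single x))"
proof -
  have j: "(\<lambda>(y, x). (y, single x)) \<in> measurable (\<mu> \<Otimes>\<^sub>M \<mu>) (\<mu> \<Otimes>\<^sub>M path_space 0)"
    unfolding case_prod_unfold
    by (intro measurable_Pair measurable_fst measurable_compose[OF measurable_snd single_measurable])
  have "measure_preserving \<mu> \<mu> id"
    by unfold_locales (simp_all add: id_def distr_id)
  moreover have "(\<lambda>(y, x). case_nat y (single x)) \<in> measurable (\<mu> \<Otimes>\<^sub>M \<mu>) (path_space (Suc 0))"
    using measurable_compose[OF j case_nat_measurable] by (simp add: case_prod_unfold)
  moreover have "distr (density (\<mu> \<Otimes>\<^sub>M \<mu>) (\<lambda>(y, w). ennreal (p s y (id w)))) (path_measure \<mu> p [s])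
      (\<lambda>(y, x). case_nat y (single x)) = path_measure \<mu> p [s]"
  proof -
    let ?j = "\<lambda>(y, x). (y, single x)"
    have w: "(\<lambda>(y, w). ennreal (p s y (w 0)) * weight [] w) = (\<lambda>(y, w). ennreal (p s y (w 0)))"
      by (simp add: weight_def)
    note pm = p_first_measurable[OF s, of 0]
    have "\<mu> \<Otimes>\<^sub>M path_space 0 = distr \<mu> \<mu> (\<lambda>x. x) \<Otimes>\<^sub>M distr \<mu> (path_space 0) single"
      by (simp only: distr_single distr_id)
    also have "\<dots> = distr (\<mu> \<Otimes>\<^sub>M \<mu>) (\<mu> \<Otimes>\<^sub>M path_space 0) ?j"
      by (rule pair_measure_distr[OF _ single_measurable])
        (simp, simp only: distr_single prob_space_imp_sigma_finite[OF prob_path_space])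
    finally have P: "\<mu> \<Otimes>\<^sub>M path_space 0 = distr (\<mu> \<Otimes>\<^sub>M \<mu>) (\<mu> \<Otimes>\<^sub>M path_space 0) ?j" .
    have "path_measure \<mu> p [s] = distr (density (\<mu> \<Otimes>\<^sub>M path_space 0) (\<lambda>(y, w). ennreal (p s y (w 0))))
        (path_measure \<mu> p [s]) (\<lambda>(y, w). case_nat y w)"
      using density_extension[of s "[]"] s by (simp add: w)
    also have "density (\<mu> \<Otimes>\<^sub>M path_space 0) (\<lambda>(y, w). ennreal (p s y (w 0))) =
        distr (density (\<mu> \<Otimes>\<^sub>M \<mu>) (\<lambda>x. (\<lambda>(y, w). ennreal (p s y (w 0))) (?j x))) (\<mu> \<Otimes>\<^sub>M path_space 0) ?j"
      by (subst P) (rule density_distr[OF pm j])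
    also have "(\<lambda>x. (\<lambda>(y, w). ennreal (p s y (w 0))) (?j x)) = (\<lambda>(y, w). ennreal (p s y (id w)))"
      by auto
    also have "distr (distr (density (\<mu> \<Otimes>\<^sub>M \<mu>) (\<lambda>(y, w). ennreal (p s y (id w)))) (\<mu> \<Otimes>\<^sub>M path_space 0) ?j)
        (path_measure \<mu> p [s]) (\<lambda>(y, w). case_nat y w) =
      distr (density (\<mu> \<Otimes>\<^sub>M \<mu>) (\<lambda>(y, w). ennreal (p s y (id w)))) (path_measure \<mu> p [s]) (\<lambda>(y, x). case_nat y (single x))"
      using case_nat_measurable[of 0] j
      by (subst distr_distr) (simp_all add: comp_def case_prod_unfold)
    finally show ?thesis ..
  qed
  moreover have "case_nat (\<omega> 0) (single (\<omega> 1)) = \<omega>" if "\<omega> \<in> space (path_space (Suc 0))" for \<omega>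
  proof -
    have "single (\<omega> 1) = (\<lambda>i\<in>{0..0}. \<omega> (Suc i))" by (auto simp: restrict_def)
    then show ?thesis using glue_parts[OF that] by simp
  qed
  ultimately show ?thesis
    using s coord_measurable[of _ "Suc 0"]
    by (intro markov_pair.intro markov_ext.intro markov_ext_axioms.intro)
      (simp_all add: p_measurable p_nonneg p_int p_sym[of s])
qed

lemma markov_step_path:
  assumes ts: "\<forall>t\<in>set (s # ts). 0 < t" and e: "measure_preserving (path_measure \<mu> p ts) \<mu> (\<lambda>w. w 0)"
  shows "markov_step (path_measure \<mu> p ts) \<mu> (\<lambda>w. w 0) (p s) (path_measure \<mu> p (s # ts)) (\<lambda>\<omega>. \<omega> 0)
    (\<lambda>\<omega>. \<lambda>i\<in>{0..length ts}. \<omega> (Suc i)) case_nat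
    (path_measure \<mu> p [s]) (\<lambda>\<omega>. \<omega> 0) (\<lambda>\<omega>. \<omega> 1) (\<lambda>y x. case_nat y (single x))"
proof -
  let ?n = "length ts"
  have s: "s > 0" and ts': "\<forall>t\<in>set ts. 0 < t" using ts by auto
  interpret e: measure_preserving "path_measure \<mu> p ts" \<mu> "\<lambda>w. w 0" by fact
  note wm = weight_measurable[OF ts']
  have sets: "sets (\<mu> \<Otimes>\<^sub>M path_measure \<mu> p ts) = sets (\<mu> \<Otimes>\<^sub>M path_space ?n)"
    by (intro sets_pair_measure_cong) simp_all
  note pm = p_first_measurable[OF s, of ?n]
  \<comment> \<open>\<mu> is written with density 1 so that the rule for products of densities
    applies; the two successive densities then multiply to the integrand of
    \<open>density_extension\<close>.\<close>
  have "\<mu> \<Otimes>\<^sub>M path_measure \<mu> p ts = density \<mu> (\<lambda>_. 1) \<Otimes>\<^sub>M density (path_space ?n) (weight ts)"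
    by (simp add: density_1 path_measure_weight)
  also have "\<dots> = density (\<mu> \<Otimes>\<^sub>M path_space ?n) (\<lambda>(y, w). 1 * weight ts w)"
    using wm e.N.sigma_finite_measure_axioms prob_path_space[of ?n]
    by (intro pair_measure_density) (simp_all add: path_measure_weight prob_space_imp_sigma_finite)
  finally have P: "\<mu> \<Otimes>\<^sub>M path_measure \<mu> p ts = density (\<mu> \<Otimes>\<^sub>M path_space ?n) (\<lambda>(y, w). weight ts w)"
    by simp
  have "density (\<mu> \<Otimes>\<^sub>M path_measure \<mu> p ts) (\<lambda>(y, w). ennreal (p s y (w 0))) =
      density (\<mu> \<Otimes>\<^sub>M path_space ?n) (\<lambda>x. (\<lambda>(y, w). weight ts w) x * (\<lambda>(y, w). ennreal (p s y (w 0))) x)"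
    unfolding P using wm pm by (intro density_density_eq) (simp_all add: case_prod_unfold)
  also have "(\<lambda>x. (\<lambda>(y, w). weight ts w) x * (\<lambda>(y, w). ennreal (p s y (w 0))) x) =
      (\<lambda>(y, w). ennreal (p s y (w 0)) * weight ts w)"
    by (auto simp: mult.commute)
  finally have D: "distr (density (\<mu> \<Otimes>\<^sub>M path_measure \<mu> p ts) (\<lambda>(y, w). ennreal (p s y (w 0))))
      (path_measure \<mu> p (s # ts)) (\<lambda>(y, w). case_nat y w) = path_measure \<mu> p (s # ts)"
    by (simp only: density_extension[OF ts])
  have sh: "(\<lambda>\<omega>. \<lambda>i\<in>{0..?n}. \<omega> (Suc i)) \<in> measurable (path_space (Suc ?n)) (path_space ?n)"
    by (intro measurable_restrict coord_measurable) simp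
  have glue: "case_prod case_nat \<in> measurable (\<mu> \<Otimes>\<^sub>M path_measure \<mu> p ts) (path_space (Suc ?n))"
    using case_nat_measurable[of ?n] by (simp only: measurable_cong_sets[OF sets refl])
  have "markov_ext (path_measure \<mu> p ts) \<mu> (\<lambda>w. w 0) (p s) (path_measure \<mu> p (s # ts)) (\<lambda>\<omega>. \<omega> 0)
    (\<lambda>\<omega>. \<lambda>i\<in>{0..?n}. \<omega> (Suc i)) case_nat"
  proof (intro markov_ext.intro markov_ext_axioms.intro e)
    \<comment> \<open>Extensionality of \<open>w\<close> matters here: the restricted shift is
      \<open>undefined\<close> beyond the last index, and so is \<open>w\<close>.\<close>
    show "(\<lambda>i\<in>{0..?n}. case_nat y w (Suc i)) = w" if "w \<in> space (path_measure \<mu> p ts)" for y and w :: "nat \<Rightarrow> 'a"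
      using that by (auto simp: space_PiM PiE_iff extensional_def fun_eq_iff restrict_def)
  qed (use s D sh glue coord_measurable glue_parts in \<open>simp_all add: p_measurable p_nonneg p_int p_sym[of s]\<close>)
  then show ?thesis
    using markov_pair_path[OF s] by (rule markov_step.intro)
qed

lemma path_L2_eq: "path_L2 \<mu> p ts = coord_L2 (path_measure \<mu> p ts) (\<lambda>x. x 0) (\<lambda>x. x (length ts))"
  by (simp add: path_L2_def coord_L2_def Let_def)

text \<open>The two coordinate statements belong to the induction: the first point of the tail is
  where the next point is attached, and its last point carries the right action.\<close>

theorem HT_path_L2:
  assumes "ts \<noteq> []" "\<forall>t\<in>set ts. 0 < t"
  shows "measure_preserving (path_measure \<mu> p ts) \<mu> (\<lambda>x. x 0) \<and>
    measure_preserving (path_measure \<mu> p ts) \<mu> (\<lambda>x. x (length ts)) \<and>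
    bimodule_iso \<mu> (HT \<mu> p ts) (path_L2 \<mu> p ts)"
  using assms
proof (induction ts)
  case (Cons s ts)
  then have s: "s > 0" by simp
  interpret one: markov_pair \<mu> "p s" "path_measure \<mu> p [s]" "\<lambda>\<omega>. \<omega> 0" "\<lambda>\<omega>. \<omega> 1" "\<lambda>y x. case_nat y (single x)"
    by (rule markov_pair_path[OF s])
  show ?case
  proof (cases ts)
    case Nil
    then show ?thesis
      using one.heat_tensor_iso[of p s] one.measure_preserving_h0 one.measure_preserving_sh
      by (simp add: path_L2_eq)
  next
    case (Cons s' ts')
    then have IH: "measure_preserving (path_measure \<mu> p ts) \<mu> (\<lambda>x. x 0)"
        "measure_preserving (path_measure \<mu> p ts) \<mu> (\<lambda>x. x (length ts))"
        "bimodule_iso \<mu> (HT \<mu> p ts) (coord_L2 (path_measure \<mu> p ts) (\<lambda>x. x 0) (\<lambda>x. x (length ts)))"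
      using Cons.IH Cons.prems by (auto simp: path_L2_eq)
    interpret step: markov_step "path_measure \<mu> p ts" \<mu> "\<lambda>w. w 0" "p s" "path_measure \<mu> p (s # ts)" "\<lambda>\<omega>. \<omega> 0"
      "\<lambda>\<omega>. \<lambda>i\<in>{0..length ts}. \<omega> (Suc i)" case_nat
      "path_measure \<mu> p [s]" "\<lambda>\<omega>. \<omega> 0" "\<lambda>\<omega>. \<omega> 1" "\<lambda>y x. case_nat y (single x)"
      by (rule markov_step_path[OF Cons.prems(2) IH(1)])
    \<comment> \<open>The shift by one makes the last point of the tail, at index
      \<open>length ts\<close>, the last point of the longer path.\<close>
    have last: "(\<lambda>\<omega>. (\<lambda>i\<in>{0..length ts}. \<omega> (Suc i)) (length ts)) = (\<lambda>\<omega>::nat \<Rightarrow> 'a. \<omega> (length (s # ts)))"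
      by simp
    have "measure_preserving (path_measure \<mu> p (s # ts)) \<mu> (\<lambda>\<omega>. \<omega> (length (s # ts)))"
      using measure_preserving_comp[OF step.measure_preserving_sh IH(2)] unfolding last .
    moreover have "bimodule_iso \<mu> (HT \<mu> p (s # ts)) (path_L2 \<mu> p (s # ts))"
      using step.rel_tensor_iso[OF one.heat_tensor_iso[of p s, OF refl] IH(3) IH(2)]
      unfolding last path_L2_eq by (simp only: \<open>ts = s' # ts'\<close> HT.simps)
    ultimately show ?thesis using step.measure_preserving_h0 by blast
  qed
qed simp

end

lemma markov_kernel_heat_kernel:
  fixes \<mu> :: "'a measure"
  assumes "prob_space \<mu>" "heat_kernel \<mu> T p"
  shows "markov_kernel \<mu> p"
proof (intro markov_kernel.intro markov_kernel_axioms.intro assms(1))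
  have h: "\<forall>t>0. case_prod (p t) \<in> borel_measurable (\<mu> \<Otimes>\<^sub>M \<mu>)"
    "\<forall>t>0. \<forall>x y. p t x y = p t y x \<and> 0 \<le> p t x y" "\<forall>t>0. \<forall>x. (\<integral>\<^sup>+y. ennreal (p t x y) \<partial>\<mu>) = 1"
    using assms(2) unfolding heat_kernel_def by blast+
  fix t :: real and x y :: 'a assume t: "t > 0"
  show "case_prod (p t) \<in> borel_measurable (\<mu> \<Otimes>\<^sub>M \<mu>)" "p t x y = p t y x" "0 \<le> p t x y"
    "(\<integral>\<^sup>+y. ennreal (p t x y) \<partial>\<mu>) = 1"
    using h t by blast+
qed

theorem proposition5p3:
  fixes \<A> :: "('a::{t2_space,second_countable_topology}, 'n::finite) chart set"
    and g :: "('a, 'n) metric"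
    and \<mu> :: "'a measure"
    and T :: "real \<Rightarrow> ('a \<Rightarrow> complex) set \<Rightarrow> ('a \<Rightarrow> complex) set"
    and p :: "real \<Rightarrow> 'a \<Rightarrow> 'a \<Rightarrow> real"
    and t :: real
    and ts :: "real list"
  assumes "compact_riemannian_manifold \<A> g"
    and "normalized_riemannian_measure \<A> g \<mu>"
    and "heat_semigroup \<A> g \<mu> T"
    and "heat_kernel \<mu> T p"
    and "t > 0"
    and "ts \<in> time_partitions t"
  shows "bimodule_iso \<mu> (HT \<mu> p ts) (path_L2 \<mu> p ts)"
proof -
  interpret markov_kernel \<mu> p
    using assms by (intro markov_kernel_heat_kernel) (auto simp: normalized_riemannian_measure_def)
  show ?thesis
    using HT_path_L2[of ts] assms(6) by (auto simp: time_partitions_def)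
qed

end
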